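(* Let $p\in(0,\infty)$, let $\mathfrak M$ be a finite factor with $\mathscr P_{1/2}(\mathfrak M)\neq\emptyset$, and let $\phi$ be a surjective $L^p$-isometry on $\mathscr P_{1/2}(\mathfrak M)$. Then there exists a $*$-automorphism or a $*$-anti-automorphism $\varphi$ of $\mathfrak M$ such that $\phi$ is of one of the following forms: (1) $\phi(P)=\varphi(P)$ for every $P\in\mathscr P_{1/2}(\mathfrak M)$; (2) $\phi(P)=I-\varphi(P)$ for every $P\in\mathscr P_{1/2}(\mathfrak M)$.
   Context: A finite factor is a von Neumann algebra factor admitting a (unique, faithful, normal) tracial state $\tau$, i.e. $M_n(\mathbb C)$ or a $\mathrm{II}_1$ factor. $\mathscr P_{1/2}(\mathfrak M)$ is the set of projections $P\in\mathfrak M$ with $\tau(P)=1/2$, and $\|A\|_p:=\tau(|A|^p)^{1/p}$. A map $\phi:\mathscr P_{1/2}(\mathfrak M)\to\mathscr P_{1/2}(\mathfrak M)$ is an $L^p$-isometry if $\|P-Q\|_p=\|\phi(P)-\phi(Q)\|_p$ for all $P,Q$. A $*$-anti-automorphism is a complex-linear bijection $\varphi$ of $\mathfrak M$ with $\varphi(A^* )=\varphi(A)^*$ and $\varphi(AB)=\varphi(B)\varphi(A)$. *)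

theory Defs
  imports "HOL-Analysis.Analysis"
begin

section \<open>Complex Hilbert spaces\<close>

text \<open>The inner product is conjugate-linear in its first argument. The underlying real normed space
  is the one of the library, so that the type of real-linear bounded operators and its topologies can
  be reused.\<close>

class complex_inner_space = real_normed_vector +
  fixes scaleC :: "complex \<Rightarrow> 'a \<Rightarrow> 'a"
    and cinner :: "'a \<Rightarrow> 'a \<Rightarrow> complex"
  assumes scaleC_add_right: "scaleC a (x + y) = scaleC a x + scaleC a y"
    and scaleC_add_left: "scaleC (a + b) x = scaleC a x + scaleC b x"
    and scaleC_scaleC: "scaleC a (scaleC b x) = scaleC (a * b) x"
    and scaleC_complex_of_real: "scaleC (complex_of_real r) x = r *\<^sub>R x"
    and cinner_commute: "cinner x y = cnj (cinner y x)"
    and cinner_add_right: "cinner x (y + z) = cinner x y + cinner x z"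
    and cinner_scaleC_right: "cinner x (scaleC a y) = a * cinner x y"
    and cinner_self: "cinner x x = complex_of_real ((norm x)\<^sup>2)"

class complex_hilbert_space = complex_inner_space + complete_space

lemma norm_scaleC: "norm (scaleC a (x :: 'h::complex_inner_space)) = cmod a * norm x"
proof -
  have "cinner (scaleC a x) (scaleC a x) = a * cnj (cinner x (scaleC a x))"
    by (metis cinner_commute cinner_scaleC_right)
  also have "\<dots> = a * cnj a * cinner x x"
    using cinner_commute[of x x] by (simp add: cinner_scaleC_right)
  finally have "complex_of_real ((norm (scaleC a x))\<^sup>2) = complex_of_real ((cmod a * norm x)\<^sup>2)"
    by (simp only: cinner_self complex_norm_square[symmetric] of_real_mult power_mult_distrib of_real_power)
  then have "(norm (scaleC a x))\<^sup>2 = (cmod a * norm x)\<^sup>2"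
    by (simp only: of_real_eq_iff)
  then show ?thesis
    by simp
qed

lemma bounded_linear_scaleC: "bounded_linear (scaleC a :: 'h::complex_inner_space \<Rightarrow> 'h)"
proof (rule bounded_linear_intro[where K = "cmod a"])
  fix x y :: 'h and r :: real
  show "scaleC a (x + y) = scaleC a x + scaleC a y"
    by (rule scaleC_add_right)
  show "scaleC a (r *\<^sub>R x) = r *\<^sub>R scaleC a x"
    by (simp add: scaleC_complex_of_real[symmetric] scaleC_scaleC mult.commute)
  show "norm (scaleC a x) \<le> norm x * cmod a"
    by (simp add: norm_scaleC)
qed

section \<open>Operators\<close>

text \<open>\<open>'h \<Rightarrow>\<^sub>L 'h\<close> consists of the bounded real-linear maps; \<open>B(H)\<close> is the subset \<open>bounded_ops\<close>
  of complex-linear ones.\<close>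

definition bounded_ops :: "('h::complex_hilbert_space \<Rightarrow>\<^sub>L 'h) set" where
  "bounded_ops = {A. \<forall>c x. blinfun_apply A (scaleC c x) = scaleC c (blinfun_apply A x)}"

lift_definition scaleC_op :: "complex \<Rightarrow> ('h::complex_hilbert_space \<Rightarrow>\<^sub>L 'h) \<Rightarrow> ('h \<Rightarrow>\<^sub>L 'h)"
  is "\<lambda>c f x. scaleC c (f x)"
  by (rule bounded_linear_compose[OF bounded_linear_scaleC])

definition adjoint_op :: "('h::complex_hilbert_space \<Rightarrow>\<^sub>L 'h) \<Rightarrow> ('h \<Rightarrow>\<^sub>L 'h)" where
  "adjoint_op A = (THE B. \<forall>x y. cinner (blinfun_apply A x) y = cinner x (blinfun_apply B y))"

definition op_le :: "('h::complex_hilbert_space \<Rightarrow>\<^sub>L 'h) \<Rightarrow> ('h \<Rightarrow>\<^sub>L 'h) \<Rightarrow> bool" where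
  "op_le A B \<longleftrightarrow> (\<forall>x. cinner x (blinfun_apply (B - A) x) \<in> \<real>\<^sub>\<ge>\<^sub>0)"

definition op_spectrum :: "('h::complex_hilbert_space \<Rightarrow>\<^sub>L 'h) \<Rightarrow> complex set" where
  "op_spectrum A = {z. \<not> (\<exists>S. S o\<^sub>L (A - scaleC_op z id_blinfun) = id_blinfun
                              \<and> (A - scaleC_op z id_blinfun) o\<^sub>L S = id_blinfun)}"

definition poly_op :: "real poly \<Rightarrow> ('h::complex_hilbert_space \<Rightarrow>\<^sub>L 'h) \<Rightarrow> ('h \<Rightarrow>\<^sub>L 'h)" where
  "poly_op q A = (\<Sum>i\<le>degree q. coeff q i *\<^sub>R ((\<lambda>B. A o\<^sub>L B) ^^ i) id_blinfun)"

text \<open>The continuous functional calculus: for self-adjoint \<open>A\<close> and \<open>f\<close> continuous on the (real)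
  spectrum of \<open>A\<close>, the operator \<open>f(A)\<close> is the norm limit of \<open>q\<^sub>n(A)\<close> whenever the polynomials \<open>q\<^sub>n\<close>
  converge to \<open>f\<close> uniformly on the spectrum.\<close>

definition cont_fun_calc :: "(real \<Rightarrow> real) \<Rightarrow> ('h::complex_hilbert_space \<Rightarrow>\<^sub>L 'h) \<Rightarrow> ('h \<Rightarrow>\<^sub>L 'h)" where
  "cont_fun_calc f A = (THE B. \<forall>q :: nat \<Rightarrow> real poly.
     uniform_limit {s. complex_of_real s \<in> op_spectrum A} (\<lambda>n. poly (q n)) f sequentially
       \<longrightarrow> (\<lambda>n. poly_op (q n) A) \<longlonglongrightarrow> B)"

definition abs_op :: "('h::complex_hilbert_space \<Rightarrow>\<^sub>L 'h) \<Rightarrow> ('h \<Rightarrow>\<^sub>L 'h)" where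
  "abs_op A = cont_fun_calc sqrt (adjoint_op A o\<^sub>L A)"

text \<open>For positive \<open>A\<close> and \<open>p > 0\<close>; recall that \<open>0 powr p = 0\<close>.\<close>

definition powr_op :: "('h::complex_hilbert_space \<Rightarrow>\<^sub>L 'h) \<Rightarrow> real \<Rightarrow> ('h \<Rightarrow>\<^sub>L 'h)" where
  "powr_op A p = cont_fun_calc (\<lambda>t. t powr p) A"

section \<open>Finite factors\<close>

text \<open>\<open>bounded_ops\<close> is strong-operator closed among the real-linear operators, so closedness there is the
  same as closedness in \<open>B(H)\<close>.\<close>

definition von_neumann_algebra :: "('h::complex_hilbert_space \<Rightarrow>\<^sub>L 'h) set \<Rightarrow> bool" where
  "von_neumann_algebra M \<longleftrightarrow>
     M \<subseteq> bounded_ops \<and> id_blinfun \<in> M \<and>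
     (\<forall>A\<in>M. \<forall>B\<in>M. A + B \<in> M \<and> A o\<^sub>L B \<in> M) \<and>
     (\<forall>c. \<forall>A\<in>M. scaleC_op c A \<in> M) \<and>
     (\<forall>A\<in>M. adjoint_op A \<in> M) \<and>
     closedin strong_operator_topology M"

definition vn_factor :: "('h::complex_hilbert_space \<Rightarrow>\<^sub>L 'h) set \<Rightarrow> bool" where
  "vn_factor M \<longleftrightarrow> von_neumann_algebra M \<and>
     {A\<in>M. \<forall>B\<in>M. A o\<^sub>L B = B o\<^sub>L A} = range (\<lambda>c. scaleC_op c id_blinfun)"

text \<open>A functional on \<open>M\<close> is a function on all operators of which only the values on \<open>M\<close> matter.\<close>

definition tracial_state ::
  "('h::complex_hilbert_space \<Rightarrow>\<^sub>L 'h) set \<Rightarrow> (('h \<Rightarrow>\<^sub>L 'h) \<Rightarrow> complex) \<Rightarrow> bool" where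
  "tracial_state M \<tau> \<longleftrightarrow>
     (\<forall>A\<in>M. \<forall>B\<in>M. \<tau> (A + B) = \<tau> A + \<tau> B) \<and>
     (\<forall>c. \<forall>A\<in>M. \<tau> (scaleC_op c A) = c * \<tau> A) \<and>
     (\<forall>A\<in>M. \<tau> (adjoint_op A o\<^sub>L A) \<in> \<real>\<^sub>\<ge>\<^sub>0) \<and>
     \<tau> id_blinfun = 1 \<and>
     (\<forall>A\<in>M. \<forall>B\<in>M. \<tau> (A o\<^sub>L B) = \<tau> (B o\<^sub>L A))"

definition faithful_on ::
  "('h::complex_hilbert_space \<Rightarrow>\<^sub>L 'h) set \<Rightarrow> (('h \<Rightarrow>\<^sub>L 'h) \<Rightarrow> complex) \<Rightarrow> bool" where
  "faithful_on M \<tau> \<longleftrightarrow> (\<forall>A\<in>M. \<tau> (adjoint_op A o\<^sub>L A) = 0 \<longrightarrow> A = 0)"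

text \<open>Normality of a positive functional: it preserves suprema of bounded upward directed sets of
  self-adjoint elements.\<close>

definition normal_on ::
  "('h::complex_hilbert_space \<Rightarrow>\<^sub>L 'h) set \<Rightarrow> (('h \<Rightarrow>\<^sub>L 'h) \<Rightarrow> complex) \<Rightarrow> bool" where
  "normal_on M \<tau> \<longleftrightarrow>
     (\<forall>D A. D \<subseteq> M \<and> D \<noteq> {} \<and> (\<forall>T\<in>D. adjoint_op T = T) \<and>
        (\<forall>S\<in>D. \<forall>T\<in>D. \<exists>U\<in>D. op_le S U \<and> op_le T U) \<and>
        A \<in> M \<and> (\<forall>T\<in>D. op_le T A) \<and> (\<forall>B\<in>M. (\<forall>T\<in>D. op_le T B) \<longrightarrow> op_le A B)
        \<longrightarrow> Re (\<tau> A) = (SUP T\<in>D. Re (\<tau> T)))"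

text \<open>Uniqueness of the trace is a theorem for factors and is not part of the definition.\<close>

definition finite_factor ::
  "('h::complex_hilbert_space \<Rightarrow>\<^sub>L 'h) set \<Rightarrow> (('h \<Rightarrow>\<^sub>L 'h) \<Rightarrow> complex) \<Rightarrow> bool" where
  "finite_factor M \<tau> \<longleftrightarrow> vn_factor M \<and> tracial_state M \<tau> \<and> faithful_on M \<tau> \<and> normal_on M \<tau>"

definition half_projections ::
  "('h::complex_hilbert_space \<Rightarrow>\<^sub>L 'h) set \<Rightarrow> (('h \<Rightarrow>\<^sub>L 'h) \<Rightarrow> complex) \<Rightarrow> ('h \<Rightarrow>\<^sub>L 'h) set" where
  "half_projections M \<tau> = {P\<in>M. P o\<^sub>L P = P \<and> adjoint_op P = P \<and> \<tau> P = 1 / 2}"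

section \<open>Isometries and (anti-)automorphisms\<close>

definition Lp_norm ::
  "(('h::complex_hilbert_space \<Rightarrow>\<^sub>L 'h) \<Rightarrow> complex) \<Rightarrow> real \<Rightarrow> ('h \<Rightarrow>\<^sub>L 'h) \<Rightarrow> real" where
  "Lp_norm \<tau> p A = Re (\<tau> (powr_op (abs_op A) p)) powr (1 / p)"

definition Lp_isometry_on ::
  "(('h::complex_hilbert_space \<Rightarrow>\<^sub>L 'h) \<Rightarrow> complex) \<Rightarrow> real \<Rightarrow> ('h \<Rightarrow>\<^sub>L 'h) set
     \<Rightarrow> (('h \<Rightarrow>\<^sub>L 'h) \<Rightarrow> ('h \<Rightarrow>\<^sub>L 'h)) \<Rightarrow> bool" where
  "Lp_isometry_on \<tau> p X \<phi> \<longleftrightarrow> \<phi> \<in> X \<rightarrow> X \<and>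
     (\<forall>P\<in>X. \<forall>Q\<in>X. Lp_norm \<tau> p (P - Q) = Lp_norm \<tau> p (\<phi> P - \<phi> Q))"

definition star_linear_bij ::
  "('h::complex_hilbert_space \<Rightarrow>\<^sub>L 'h) set \<Rightarrow> (('h \<Rightarrow>\<^sub>L 'h) \<Rightarrow> ('h \<Rightarrow>\<^sub>L 'h)) \<Rightarrow> bool" where
  "star_linear_bij M \<Phi> \<longleftrightarrow> bij_betw \<Phi> M M \<and>
     (\<forall>A\<in>M. \<forall>B\<in>M. \<Phi> (A + B) = \<Phi> A + \<Phi> B) \<and>
     (\<forall>c. \<forall>A\<in>M. \<Phi> (scaleC_op c A) = scaleC_op c (\<Phi> A)) \<and>
     (\<forall>A\<in>M. \<Phi> (adjoint_op A) = adjoint_op (\<Phi> A))"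

definition star_automorphism ::
  "('h::complex_hilbert_space \<Rightarrow>\<^sub>L 'h) set \<Rightarrow> (('h \<Rightarrow>\<^sub>L 'h) \<Rightarrow> ('h \<Rightarrow>\<^sub>L 'h)) \<Rightarrow> bool" where
  "star_automorphism M \<Phi> \<longleftrightarrow> star_linear_bij M \<Phi> \<and>
     (\<forall>A\<in>M. \<forall>B\<in>M. \<Phi> (A o\<^sub>L B) = \<Phi> A o\<^sub>L \<Phi> B)"

definition star_anti_automorphism ::
  "('h::complex_hilbert_space \<Rightarrow>\<^sub>L 'h) set \<Rightarrow> (('h \<Rightarrow>\<^sub>L 'h) \<Rightarrow> ('h \<Rightarrow>\<^sub>L 'h)) \<Rightarrow> bool" where
  "star_anti_automorphism M \<Phi> \<longleftrightarrow> star_linear_bij M \<Phi> \<and>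
     (\<forall>A\<in>M. \<forall>B\<in>M. \<Phi> (A o\<^sub>L B) = \<Phi> B o\<^sub>L \<Phi> A)"

end

theory Submission
  imports Defs "HOL-Computational_Algebra.Fundamental_Theorem_Algebra"
begin

text \<open>
  Put \<open>U = 2P - 1\<close>: the isometry becomes a bijection of the set \<open>S0\<close> of symmetries of trace \<open>0\<close>. Since
  \<open>-U\<close> is the only point at maximal distance from \<open>U\<close>, \<open>\<phi>(-U) = -\<phi>(U)\<close>. If \<open>p = 2\<close>, the distance of \<open>V\<close> and
  \<open>W\<close> is a function of \<open>\<tau>(VW)\<close>. If \<open>p \<noteq> 2\<close>, the strict concavity or convexity of \<open>s powr (p/2)\<close>, applied to
  \<open>(U - V)\<^sup>2/4\<close> and \<open>(U + V)\<^sup>2/4\<close>, shows that pairs with \<open>UV + VU\<close> scalar are preserved. Given \<open>V, W\<close>, some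
  \<open>Z \<in> S0\<close> anticommutes with both, \<open>\<phi>\<close> maps the circle through \<open>W\<close> and \<open>Z\<close> to a circle, and along it the
  distance to \<open>V\<close> has at \<open>Z\<close> a derivative proportional to \<open>\<tau>(VW)\<close>. Hence \<open>\<tau>(VW)\<close> is preserved in all cases and
  \<open>\<phi>\<close> extends linearly. For an anticommuting pair \<open>U, V\<close> the factor consists of the \<open>2 \<times> 2\<close> matrices over
  \<open>{U, V}'\<close>, and the extension induces on \<open>{U, V}'\<close> a Jordan homomorphism onto a prime ring, which by a theorem
  of Herstein is multiplicative or antimultiplicative. It therefore extends to a *-automorphism or
  *-antiautomorphism that agrees with \<open>\<plusminus>\<phi>\<close> on \<open>U\<close> and on everything anticommuting with \<open>U\<close>, and an isometry
  fixing those symmetries is the identity.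
\<close>

section \<open>Inner products and adjoints\<close>

text \<open>The obstacle is that \<phi> lives only on symmetries of trace zero: their real span
  contains no nonzero scalar and is not closed under Jordan products, so the multiplication must be
  recovered from trace identities alone. The way out is a Pauli triple \<open>U\<close>,
  \<open>V\<close>, \<open>\<i> U V\<close>: multiplying a self-adjoint \<open>h\<close> of the
  commutant by \<open>V\<close> moves it into the span, and what comes out on the other side does
  not depend on the member of the triple that is used. Form (2) originates in two signs. One,
  \<kappa>, tells whether the triple keeps its orientation; the other, \<epsilon>, whether the map
  on the commutant keeps the order of products. When they disagree it is the negative of \<phi> that
  extends to the algebra. Powers of absolute values are evaluated only where the square is scalar.
  Elsewhere \<open>s powr (p/2)\<close> is squeezed between quadratics on \<open>[0, 1]\<close>, and
  only the traces of \<open>D * D\<close> and of its square enter. Projections come from strong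
  limits of sign functions and from an exhaustion in which the faithful trace replaces Zorn's lemma,
  so no Borel functional calculus enters.\<close>

lemma cinner_add_left: "cinner (x + y) z = cinner x z + cinner y (z :: 'h::complex_inner_space)"
  by (metis cinner_add_right cinner_commute complex_cnj_add)

lemma cinner_scaleC_left: "cinner (scaleC a x) y = cnj a * cinner x (y :: 'h::complex_inner_space)"
  by (metis cinner_scaleC_right cinner_commute complex_cnj_mult)

lemma cinner_scaleR_right: "cinner x (r *\<^sub>R y) = of_real r * cinner x (y :: 'h::complex_inner_space)"
  by (metis cinner_scaleC_right scaleC_complex_of_real)

lemma cinner_scaleR_left: "cinner (r *\<^sub>R x) y = of_real r * cinner x (y :: 'h::complex_inner_space)"
  by (metis cinner_scaleC_left scaleC_complex_of_real complex_cnj_complex_of_real)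

lemma cinner_zero_right [simp]: "cinner x (0 :: 'h::complex_inner_space) = 0"
  using cinner_scaleR_right[of x 0 0] by simp

lemma cinner_zero_left [simp]: "cinner (0 :: 'h::complex_inner_space) x = 0"
  using cinner_scaleR_left[of 0 0 x] by simp

lemma cinner_minus_right [simp]: "cinner x (- y) = - cinner x (y :: 'h::complex_inner_space)"
  using cinner_scaleR_right[of x "-1" y] by simp

lemma cinner_minus_left [simp]: "cinner (- x) y = - cinner x (y :: 'h::complex_inner_space)"
  using cinner_scaleR_left[of "-1" x y] by simp

lemma cinner_diff_right: "cinner x (y - z) = cinner x y - cinner x (z :: 'h::complex_inner_space)"
  using cinner_add_right[of x y "- z"] by simp

lemma cinner_diff_left: "cinner (x - y) z = cinner x z - cinner y (z :: 'h::complex_inner_space)"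
  using cinner_add_left[of x "- y" z] by simp

lemmas cinner_linear = cinner_add_left cinner_add_right cinner_diff_left cinner_diff_right
  cinner_scaleC_left cinner_scaleC_right cinner_scaleR_left cinner_scaleR_right

lemma Re_cinner_commute: "Re (cinner x y) = Re (cinner y (x :: 'h::complex_inner_space))"
  by (metis cinner_commute cnj.simps(1))

lemma Re_cinner_self [simp]: "Re (cinner x (x :: 'h::complex_inner_space)) = (norm x)\<^sup>2"
  by (simp add: cinner_self)

lemma norm_add_sq: "(norm (x + y :: 'h::complex_inner_space))\<^sup>2 = (norm x)\<^sup>2 + 2 * Re (cinner x y) + (norm y)\<^sup>2"
proof -
  have "(norm (x + y))\<^sup>2 = Re (cinner (x + y) (x + y))"
    by simp
  also have "\<dots> = (norm x)\<^sup>2 + 2 * Re (cinner x y) + (norm y)\<^sup>2"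
    unfolding cinner_linear using Re_cinner_commute[of y x] by (simp add: cinner_self)
  finally show ?thesis .
qed

lemma norm_diff_sq: "(norm (x - y :: 'h::complex_inner_space))\<^sup>2 = (norm x)\<^sup>2 - 2 * Re (cinner x y) + (norm y)\<^sup>2"
  using norm_add_sq[of x "- y"] by simp

lemma Re_cinner_le: "Re (cinner x y) \<le> norm x * norm (y :: 'h::complex_inner_space)"
proof (cases "x = 0 \<or> y = 0")
  case False
  have "0 \<le> (norm (norm y *\<^sub>R x - norm x *\<^sub>R y))\<^sup>2"
    by simp
  also have "\<dots> = 2 * (norm x * norm y) * (norm x * norm y - Re (cinner x y))"
    unfolding norm_diff_sq by (simp add: cinner_scaleR_left cinner_scaleR_right power2_eq_square algebra_simps)
  finally show ?thesis
    using False by (auto simp: zero_le_mult_iff mult_le_0_iff)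
qed auto

lemma cinner_norm_le: "cmod (cinner x y) \<le> norm x * norm (y :: 'h::complex_inner_space)"
proof (cases "cinner x y = 0")
  case False
  \<comment> \<open>The phase \<open>a\<close> makes the inner product real and nonnegative, which
    reduces the claim to \<open>Re_cinner_le\<close>.\<close>
  define a where "a = cnj (cinner x y) / cmod (cinner x y)"
  have "cmod a = 1"
    using False by (simp add: a_def norm_divide)
  have "cinner x (scaleC a y) = of_real (cmod (cinner x y))"
    using False unfolding a_def cinner_scaleC_right
    by (simp add: mult.commute complex_norm_square[symmetric] field_simps power2_eq_square flip: of_real_mult)
  then have "cmod (cinner x y) = Re (cinner x (scaleC a y))"
    by simp
  also have "\<dots> \<le> norm x * norm (scaleC a y)"
    by (rule Re_cinner_le)
  finally show ?thesis
    using \<open>cmod a = 1\<close> by (simp add: norm_scaleC)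
qed simp

lemma cinner_eqI: "(\<And>x. cinner x y = cinner x z) \<Longrightarrow> y = (z :: 'h::complex_inner_space)"
proof -
  assume "\<And>x. cinner x y = cinner x z"
  then have "cinner (y - z) (y - z) = 0"
    by (simp add: cinner_diff_right)
  then show ?thesis
    by (simp add: cinner_self)
qed

lemma bounded_bilinear_cinner: "bounded_bilinear (cinner :: 'h::complex_inner_space \<Rightarrow> _)"
proof
  show "\<exists>K. \<forall>a b :: 'h. norm (cinner a b) \<le> norm a * norm b * K"
    by (intro exI[of _ 1]) (simp add: cinner_norm_le)
qed (simp_all add: cinner_linear scaleR_conv_of_real)

lemmas tendsto_cinner [tendsto_intros] = bounded_bilinear.tendsto[OF bounded_bilinear_cinner]

text \<open>The representing vector minimizes \<open>\<parallel>x\<parallel>\<^sup>2 - 2 Re (f x)\<close>.\<close>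

lemma riesz_real:
  fixes f :: "'h::complex_hilbert_space \<Rightarrow> real"
  assumes "bounded_linear f"
  shows "\<exists>y. \<forall>x. f x = Re (cinner y x)"
proof -
  interpret f: bounded_linear f by fact
  obtain K where K: "\<And>x. \<bar>f x\<bar> \<le> norm x * K"
    using f.bounded by auto
  define q where "q x = (norm x)\<^sup>2 - 2 * f x" for x
  have q_ge: "- K\<^sup>2 \<le> q x" for x
  proof -
    have "0 \<le> (norm x - K)\<^sup>2" by simp
    also have "\<dots> = (norm x)\<^sup>2 - 2 * (norm x * K) + K\<^sup>2" by (simp add: power2_diff)
    finally show ?thesis
      using K[of x] unfolding q_def by linarith
  qed
  define m where "m = Inf (range q)"
  have bdd: "bdd_below (range q)"
    using q_ge by (intro bdd_belowI2)
  have m_le: "m \<le> q x" for x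
    unfolding m_def by (intro cInf_lower bdd) simp
  have "\<exists>x. q x < m + 1 / Suc n" for n
    using cInf_lessD[of "range q" "m + 1 / Suc n"] unfolding m_def by auto
  then obtain X where X: "\<And>n. q (X n) < m + 1 / Suc n"
    by metis
  \<comment> \<open>The parallelogram identity at the midpoint bounds the distance of two points by
    their excess over the infimum, so a minimizing sequence is Cauchy.\<close>
  have close: "(norm (x - y))\<^sup>2 \<le> 2 * (q x - m) + 2 * (q y - m)" for x y
  proof -
    define w where "w = (1/2) *\<^sub>R (x + y)"
    have "2 * q x + 2 * q y - 4 * q w = (norm (x - y))\<^sup>2"
      unfolding q_def w_def norm_scaleR power_mult_distrib norm_diff_sq norm_add_sq
      by (simp add: f.scaleR f.add power2_eq_square algebra_simps)
    then show ?thesis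
      using m_le[of w] by (simp add: algebra_simps)
  qed
  have "Cauchy X"
  proof (rule metric_CauchyI)
    fix e :: real assume "0 < e"
    then obtain N :: nat where N: "4 / e\<^sup>2 < N"
      using reals_Archimedean2 by blast
    show "\<exists>M. \<forall>m\<ge>M. \<forall>n\<ge>M. dist (X m) (X n) < e"
    proof (intro exI[of _ "Suc N"] allI impI)
      fix i j assume ij: "Suc N \<le> i" "Suc N \<le> j"
      have small: "q (X i) - m < 1 / N" if "Suc N \<le> i" for i
      proof -
        have "0 < real N"
          using N \<open>0 < e\<close> by (smt (verit) divide_pos_pos zero_less_power)
        then have "1 / real (Suc i) \<le> 1 / N"
          using that by (intro divide_left_mono) auto
        then show ?thesis
          using X[of i] by linarith
      qed
      have "(dist (X i) (X j))\<^sup>2 < 4 / N"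
        using close[of "X i" "X j"] small[OF ij(1)] small[OF ij(2)] by (simp add: dist_norm)
      also have "\<dots> < e\<^sup>2"
        using N \<open>0 < e\<close> by (cases "N = 0") (auto simp: field_simps)
      finally show "dist (X i) (X j) < e"
        using \<open>0 < e\<close> by (intro power_less_imp_less_base[of _ 2 e]) auto
    qed
  qed
  then obtain y where y: "X \<longlonglongrightarrow> y"
    using Cauchy_convergent_iff convergent_def by blast
  have "(\<lambda>n. q (X n)) \<longlonglongrightarrow> q y"
    unfolding q_def by (intro tendsto_intros y f.tendsto)
  moreover have "(\<lambda>n. m + 1 / Suc n) \<longlonglongrightarrow> m + 0"
    by (intro tendsto_intros LIMSEQ_Suc lim_1_over_n)
  ultimately have "q y \<le> m + 0"
    by (rule LIMSEQ_le) (use X less_imp_le in blast)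
  have "f x = Re (cinner y x)" for x
  proof -
    have *: "0 \<le> 2 * t * (Re (cinner y x) - f x) + t\<^sup>2 * (norm x)\<^sup>2" for t :: real
    proof -
      have "q (y + t *\<^sub>R x) = q y + 2 * t * (Re (cinner y x) - f x) + t\<^sup>2 * (norm x)\<^sup>2"
        unfolding q_def norm_add_sq norm_scaleR power_mult_distrib
        by (simp add: f.scaleR f.add cinner_scaleR_right algebra_simps)
      then show ?thesis
        using m_le[of "y + t *\<^sub>R x"] \<open>q y \<le> m + 0\<close> by linarith
    qed
    show ?thesis
    proof (rule ccontr)
      define d where "d = Re (cinner y x) - f x"
      assume "f x \<noteq> Re (cinner y x)"
      then have d: "d \<noteq> 0" by (simp add: d_def)
      \<comment> \<open>At \<open>t = - d / N\<close> the linear term outweighs the quadratic one;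
        the summand 1 keeps \<open>N\<close> positive even for \<open>x = 0\<close>.\<close>
      define N where "N = (norm x)\<^sup>2 + 1"
      have N: "0 < N" "(norm x)\<^sup>2 < N" by (simp_all add: N_def add_nonneg_pos)
      have "0 \<le> 2 * (- d / N) * d + (- d / N)\<^sup>2 * (norm x)\<^sup>2"
        using *[of "- d / N"] unfolding d_def .
      also have "\<dots> \<le> 2 * (- d / N) * d + (- d / N)\<^sup>2 * N"
        using N by (intro add_left_mono mult_left_mono) auto
      also have "\<dots> = - d\<^sup>2 / N"
        using N by (simp add: field_simps power2_eq_square)
      finally show False
        using d N by (simp add: divide_simps)
    qed
  qed
  then show ?thesis by blast
qed

lemma riesz:
  fixes f :: "'h::complex_hilbert_space \<Rightarrow> complex"
  assumes f: "bounded_linear f" and hom: "\<And>c x. f (scaleC c x) = c * f x"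
  shows "\<exists>y. \<forall>x. f x = cinner y x"
proof -
  obtain y where y: "\<And>x. Re (f x) = Re (cinner y x)"
    using riesz_real[OF bounded_linear_compose[OF bounded_linear_Re f]] by auto
  \<comment> \<open>The imaginary part at \<open>x\<close> is the real part at
    \<open>- \<i> x\<close>.\<close>
  have "Im (f x) = Im (cinner y x)" for x
    using y[of "scaleC (- \<i>) x"] by (simp add: hom cinner_scaleC_right)
  with y show ?thesis
    by (metis complex_eqI)
qed

lemma adjoint_exists:
  fixes A :: "'h::complex_hilbert_space \<Rightarrow>\<^sub>L 'h"
  assumes A: "A \<in> bounded_ops"
  shows "\<exists>B. \<forall>x y. cinner (blinfun_apply A x) y = cinner x (blinfun_apply B y)"
proof -
  have "\<exists>z. \<forall>x. cinner y (blinfun_apply A x) = cinner z x" for y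
  proof (rule riesz)
    show "bounded_linear (\<lambda>x. cinner y (blinfun_apply A x))"
      by (rule bounded_linear_compose[OF bounded_bilinear.bounded_linear_right[OF bounded_bilinear_cinner]
            blinfun.bounded_linear_right])
    show "cinner y (blinfun_apply A (scaleC c x)) = c * cinner y (blinfun_apply A x)" for c x
      using A by (simp add: bounded_ops_def cinner_scaleC_right)
  qed
  then obtain b where b: "\<And>y x. cinner y (blinfun_apply A x) = cinner (b y) x"
    by metis
  have b': "cinner (blinfun_apply A x) y = cinner x (b y)" for x y
    by (metis b cinner_commute)
  have "bounded_linear b"
  proof (rule bounded_linear_intro[where K = "norm A"])
    show "b (x + y) = b x + b y" for x y
      by (rule cinner_eqI) (simp add: cinner_add_right flip: b')
    show "b (r *\<^sub>R x) = r *\<^sub>R b x" for r x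
      by (rule cinner_eqI) (simp add: cinner_scaleR_right flip: b')
    fix y
    have "(norm (b y))\<^sup>2 = Re (cinner (blinfun_apply A (b y)) y)"
      by (simp add: b')
    also have "\<dots> \<le> norm (blinfun_apply A (b y)) * norm y"
      by (rule Re_cinner_le)
    also have "\<dots> \<le> (norm A * norm (b y)) * norm y"
      by (intro mult_right_mono norm_blinfun) simp
    finally show "norm (b y) \<le> norm y * norm A"
      by (cases "norm (b y) = 0") (auto simp: power2_eq_square algebra_simps)
  qed
  then show ?thesis
    using b' by (intro exI[of _ "Blinfun b"]) (simp add: bounded_linear_Blinfun_apply)
qed

lemma adjoint_op_eqI:
  assumes "\<And>x y. cinner (blinfun_apply A x) y = cinner x (blinfun_apply B y)"
  shows "adjoint_op A = B"
  unfolding adjoint_op_def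
proof (rule the_equality)
  show "\<forall>x y. cinner (blinfun_apply A x) y = cinner x (blinfun_apply B y)"
    using assms by blast
  fix C assume "\<forall>x y. cinner (blinfun_apply A x) y = cinner x (blinfun_apply C y)"
  then show "C = B"
    using assms by (intro blinfun_eqI cinner_eqI) metis
qed

lemma cinner_adjoint_op:
  assumes "A \<in> bounded_ops"
  shows "cinner (blinfun_apply A x) y = cinner x (blinfun_apply (adjoint_op A) y)"
  using adjoint_exists[OF assms] adjoint_op_eqI by metis

section \<open>The algebra of bounded operators\<close>

lemma scaleC_zero [simp]: "scaleC a (0 :: 'h::complex_inner_space) = 0"
  using bounded_linear.linear[OF bounded_linear_scaleC] by (rule linear_0)

text \<open>With a type of their own, the complex-linear operators become a normed algebra for the
  type classes, so that powers, series, limits and ring simplification apply directly.\<close>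

typedef (overloaded) 'h cop = "bounded_ops :: ('h::complex_hilbert_space \<Rightarrow>\<^sub>L 'h) set"
proof
  show "0 \<in> (bounded_ops :: ('h \<Rightarrow>\<^sub>L 'h) set)"
    by (simp add: bounded_ops_def)
qed

setup_lifting type_definition_cop

lift_definition app :: "'h::complex_hilbert_space cop \<Rightarrow> 'h \<Rightarrow> 'h" is blinfun_apply .

lemma scaleC_minus: "scaleC a (- x :: 'h::complex_inner_space) = - scaleC a x"
  using bounded_linear.linear[OF bounded_linear_scaleC] by (rule linear_neg)

lemma scaleC_diff: "scaleC a (x - y :: 'h::complex_inner_space) = scaleC a x - scaleC a y"
  using bounded_linear.linear[OF bounded_linear_scaleC] by (rule linear_diff)

lemma scaleC_scaleR: "scaleC a (r *\<^sub>R x :: 'h::complex_inner_space) = r *\<^sub>R scaleC a x"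
  using bounded_linear.linear[OF bounded_linear_scaleC] by (rule linear_scale)

lemma scaleC_one [simp]: "scaleC 1 (x :: 'h::complex_inner_space) = x"
  using scaleC_complex_of_real[of 1 x] by simp

instantiation cop :: (complex_hilbert_space) real_normed_algebra
begin

lift_definition zero_cop :: "'a cop" is 0
  by (simp add: bounded_ops_def)
lift_definition plus_cop :: "'a cop \<Rightarrow> 'a cop \<Rightarrow> 'a cop" is "(+)"
  by (simp add: bounded_ops_def scaleC_add_right blinfun.add_left)
lift_definition minus_cop :: "'a cop \<Rightarrow> 'a cop \<Rightarrow> 'a cop" is "(-)"
  by (simp add: bounded_ops_def scaleC_diff blinfun.diff_left)
lift_definition uminus_cop :: "'a cop \<Rightarrow> 'a cop" is uminus
  by (simp add: bounded_ops_def scaleC_minus blinfun.minus_left)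
lift_definition times_cop :: "'a cop \<Rightarrow> 'a cop \<Rightarrow> 'a cop" is "(o\<^sub>L)"
  by (simp add: bounded_ops_def)
lift_definition scaleR_cop :: "real \<Rightarrow> 'a cop \<Rightarrow> 'a cop" is "(*\<^sub>R)"
  by (simp add: bounded_ops_def scaleC_scaleR blinfun.scaleR_left)
lift_definition norm_cop :: "'a cop \<Rightarrow> real" is norm .
lift_definition dist_cop :: "'a cop \<Rightarrow> 'a cop \<Rightarrow> real" is dist .
lift_definition sgn_cop :: "'a cop \<Rightarrow> 'a cop" is sgn
  by (simp add: bounded_ops_def scaleC_scaleR blinfun.scaleR_left sgn_div_norm)
definition uniformity_cop :: "('a cop \<times> 'a cop) filter"
  where "uniformity_cop = (INF e\<in>{0 <..}. principal {(x, y). dist x y < e})"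
definition open_cop :: "'a cop set \<Rightarrow> bool"
  where "open_cop S = (\<forall>x\<in>S. \<forall>\<^sub>F (x', y) in uniformity. x' = x \<longrightarrow> y \<in> S)"

instance
proof
  show "uniformity = (INF e\<in>{0 <..}. principal {(x, y :: 'a cop). dist x y < e})"
    by (rule uniformity_cop_def)
  show "open U = (\<forall>x\<in>U. \<forall>\<^sub>F (x', y) in uniformity. x' = x \<longrightarrow> y \<in> U)" for U :: "'a cop set"
    by (rule open_cop_def)
qed (transfer; auto simp: dist_norm sgn_div_norm norm_triangle_ineq norm_blinfun_compose intro!: blinfun_eqI simp:
    blinfun.bilinear_simps scaleR_add_right scaleR_add_left)+

end

text \<open>The unit is added through \<open>monoid_mult\<close> because
  \<open>real_normed_algebra_1\<close> demands \<open>0 \<noteq> 1\<close>, which fails on the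
  trivial Hilbert space.\<close>

instantiation cop :: (complex_hilbert_space) monoid_mult
begin

lift_definition one_cop :: "'a cop" is id_blinfun
  by (simp add: bounded_ops_def)

instance
  by standard (transfer; auto intro!: blinfun_eqI)+

end

lemma app_simps [simp]:
  "app 0 x = 0" "app 1 x = x" "app (A + B) x = app A x + app B x" "app (A - B) x = app A x - app B x"
  "app (- A) x = - app A x" "app (A * B) x = app A (app B x)" "app (r *\<^sub>R A) x = r *\<^sub>R app A x"
  by (transfer; simp add: blinfun.bilinear_simps)+

lemma cop_eqI: "(\<And>x. app A x = app B x) \<Longrightarrow> A = B"
  by transfer (rule blinfun_eqI)

lemma norm_app: "norm (app A x) \<le> norm A * norm x"
  by transfer (rule norm_blinfun)

lemma cop_bound: "0 \<le> K \<Longrightarrow> (\<And>x. norm (app A x) \<le> K * norm x) \<Longrightarrow> norm A \<le> K"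
  by transfer (rule norm_blinfun_bound)

lemma bounded_linear_app: "bounded_linear (app A)"
  by transfer (rule blinfun.bounded_linear_right)

lemma bounded_bilinear_app: "bounded_bilinear app"
proof
  show "\<exists>K. \<forall>A x. norm (app A x :: 'a) \<le> norm A * norm x * K"
    by (intro exI[of _ 1]) (simp add: norm_app)
qed (transfer; simp add: blinfun.bilinear_simps)+

lemmas tendsto_app = bounded_bilinear.tendsto[OF bounded_bilinear_app]
lemmas app_arg_simps = bounded_bilinear.add_right[OF bounded_bilinear_app] bounded_bilinear.diff_right[OF bounded_bilinear_app]
  bounded_bilinear.scaleR_right[OF bounded_bilinear_app] bounded_bilinear.zero_right[OF bounded_bilinear_app]
  bounded_bilinear.minus_right[OF bounded_bilinear_app]

lemma app_scaleC: "app A (scaleC c x) = scaleC c (app A x)"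
  by transfer (simp add: bounded_ops_def)

lift_definition cscale :: "complex \<Rightarrow> 'h::complex_hilbert_space cop \<Rightarrow> 'h cop" is scaleC_op
  unfolding bounded_ops_def by (simp add: scaleC_op.rep_eq scaleC_scaleC mult.commute)

lemma app_cscale [simp]: "app (cscale c A) x = scaleC c (app A x)"
  by transfer (simp add: scaleC_op.rep_eq)

lift_definition star :: "'h::complex_hilbert_space cop \<Rightarrow> 'h cop" is adjoint_op
proof -
  fix A :: "'h \<Rightarrow>\<^sub>L 'h" assume A: "A \<in> bounded_ops"
  show "adjoint_op A \<in> bounded_ops"
    unfolding bounded_ops_def mem_Collect_eq
  proof (intro allI cinner_eqI)
    fix c x y
    show "cinner y (blinfun_apply (adjoint_op A) (scaleC c x)) = cinner y (scaleC c (blinfun_apply (adjoint_op A) x))"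
      by (simp add: cinner_scaleC_right flip: cinner_adjoint_op[OF A])
  qed
qed

lemma cinner_star: "cinner (app A x) y = cinner x (app (star A) y)"
  by transfer (rule cinner_adjoint_op)

lemma star_eqI: "(\<And>x y. cinner (app A x) y = cinner x (app B y)) \<Longrightarrow> star A = B"
  by transfer (rule adjoint_op_eqI)

lemma cinner_star': "cinner (app (star A) x) y = cinner x (app A y)"
  by (metis cinner_star cinner_commute)

lemma star_simps [simp]:
  "star (star A) = A" "star 0 = 0" "star 1 = 1" "star (A + B) = star A + star B"
  "star (A - B) = star A - star B" "star (- A) = - star A" "star (r *\<^sub>R A) = r *\<^sub>R star A"
  "star (cscale c A) = cscale (cnj c) (star A)" "star (A * B) = star B * star A"
  by (rule star_eqI; simp add: cinner_star' cinner_linear; simp add: cinner_star cinner_linear)+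

lemma cscale_simps [simp]:
  "cscale c A * B = cscale c (A * B)" "A * cscale c B = cscale c (A * B)"
  "cscale a (cscale b A) = cscale (a * b) A" "cscale 1 A = A" "cscale 0 A = 0" "cscale c 0 = 0"
  "cscale c (r *\<^sub>R A) = r *\<^sub>R cscale c A" "cscale c (- A) = - cscale c A"
  using scaleC_complex_of_real[of 0]
  by (auto intro!: cop_eqI simp: app_scaleC scaleC_scaleC scaleC_scaleR scaleC_minus)

lemma cscale_add: "cscale c (A + B) = cscale c A + cscale c B"
  and cscale_diff: "cscale c (A - B) = cscale c A - cscale c B"
  and cscale_add_left: "cscale (a + b) A = cscale a A + cscale b A"
  by (auto intro!: cop_eqI simp: scaleC_add_right scaleC_diff scaleC_add_left)

lemma cscale_of_real: "cscale (of_real r) A = r *\<^sub>R A"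
  by (rule cop_eqI) (simp add: scaleC_complex_of_real)

lemma cscale_uminus: "cscale (- c) A = - cscale c A"
  using cscale_simps(3)[of "-1" c A] cscale_of_real[of "-1" "cscale c A"] by simp

subclass (in complex_hilbert_space) banach ..

instance cop :: (complex_hilbert_space) banach
proof
  fix X :: "nat \<Rightarrow> 'a cop" assume "Cauchy X"
  then have "Cauchy (\<lambda>n. Rep_cop (X n))"
    unfolding Cauchy_def by (simp add: dist_cop.rep_eq)
  then obtain B where B: "(\<lambda>n. Rep_cop (X n)) \<longlonglongrightarrow> B"
    by (metis Cauchy_convergent_iff convergent_def)
  have "B \<in> bounded_ops"
    unfolding bounded_ops_def
  proof clarify
    fix c x
    have "(\<lambda>n. blinfun_apply (Rep_cop (X n)) (scaleC c x)) \<longlonglongrightarrow> blinfun_apply B (scaleC c x)"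
      by (intro tendsto_intros B)
    moreover have "(\<lambda>n. scaleC c (blinfun_apply (Rep_cop (X n)) x)) \<longlonglongrightarrow> scaleC c (blinfun_apply B x)"
      by (intro bounded_linear.tendsto[OF bounded_linear_scaleC] tendsto_intros B)
    moreover have "blinfun_apply (Rep_cop (X n)) (scaleC c x) = scaleC c (blinfun_apply (Rep_cop (X n)) x)" for n
      using Rep_cop[of "X n"] by (simp add: bounded_ops_def)
    ultimately show "blinfun_apply B (scaleC c x) = scaleC c (blinfun_apply B x)"
      using LIMSEQ_unique by simp
  qed
  then have "X \<longlonglongrightarrow> Abs_cop B"
    using B by (simp add: tendsto_iff dist_cop.rep_eq Abs_cop_inverse)
  then show "convergent X"
    by (auto simp: convergent_def)
qed

section \<open>Spectrum and functional calculus of self-adjoint operators\<close>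

definition quad_form :: "'h::complex_hilbert_space cop \<Rightarrow> 'h \<Rightarrow> real" where
  "quad_form T x = Re (cinner x (app T x))"

lemma quad_form_simps [simp]:
  "quad_form 0 x = 0" "quad_form 1 x = (norm x)\<^sup>2" "quad_form (S + T) x = quad_form S x + quad_form T x" "quad_form (S - T) x = quad_form S x - quad_form T x"
  "quad_form (- T) x = - quad_form T x" "quad_form (r *\<^sub>R T) x = r * quad_form T x"
  by (simp_all add: quad_form_def cinner_linear)

lemma quad_form_star_mult: "quad_form (star T * T) x = (norm (app T x))\<^sup>2"
  by (simp add: quad_form_def flip: cinner_star)

text \<open>Polarization writes \<open>Re (cinner y (app T x))\<close> as a difference of two values
  of \<open>quad_form\<close>, which the parallelogram law bounds; \<open>y\<close> is
  \<open>app T x\<close> rescaled to the length of \<open>x\<close>.\<close>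

lemma sa_norm_le:
  assumes T: "star T = T" and K: "\<And>x. \<bar>quad_form T x\<bar> \<le> K * (norm x)\<^sup>2" and "0 \<le> K"
  shows "norm T \<le> K"
proof (rule cop_bound)
  fix x
  show "norm (app T x) \<le> K * norm x"
  proof (cases "app T x = 0 \<or> x = 0")
    case False
    define y where "y = (norm x / norm (app T x)) *\<^sub>R app T x"
    have ny: "norm y = norm x"
      using False by (simp add: y_def)
    have sym: "Re (cinner x (app T y)) = Re (cinner y (app T x))"
      by (metis T cinner_star Re_cinner_commute)
    have "4 * Re (cinner y (app T x)) = quad_form T (x + y) - quad_form T (x - y)"
      unfolding quad_form_def using sym by (simp add: app_arg_simps cinner_linear)
    also have "\<dots> \<le> K * (norm (x + y))\<^sup>2 + K * (norm (x - y))\<^sup>2"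
      using K[of "x + y"] K[of "x - y"] by linarith
    also have "\<dots> = 4 * K * (norm x)\<^sup>2"
      using ny by (simp add: norm_add_sq norm_diff_sq algebra_simps)
    finally have "Re (cinner y (app T x)) \<le> K * (norm x)\<^sup>2"
      by simp
    moreover have "Re (cinner y (app T x)) = norm x * norm (app T x)"
      using False unfolding y_def by (simp add: cinner_scaleR_left power2_eq_square)
    ultimately show ?thesis
      using False by (simp add: power2_eq_square)
  qed (use \<open>0 \<le> K\<close> in \<open>auto simp: app_arg_simps\<close>)
qed fact

definition inv_op :: "'h::complex_hilbert_space cop \<Rightarrow> bool" where
  "inv_op A \<longleftrightarrow> (\<exists>S. S * A = 1 \<and> A * S = 1)"

lemma inv_op_mult: "inv_op A \<Longrightarrow> inv_op B \<Longrightarrow> inv_op (A * B)"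
  unfolding inv_op_def
proof (elim exE conjE)
  fix S T assume h: "S * A = 1" "A * S = 1" "T * B = 1" "B * T = 1"
  show "\<exists>R. R * (A * B) = 1 \<and> A * B * R = 1"
  proof (intro exI conjI)
    have "T * S * (A * B) = T * (S * A) * B" by (simp add: mult.assoc)
    then show "T * S * (A * B) = 1" using h by simp
    have "A * B * (T * S) = A * (B * T) * S" by (simp add: mult.assoc)
    then show "A * B * (T * S) = 1" using h by simp
  qed
qed

text \<open>\<open>S * B\<close> is a left inverse of \<open>A\<close> and \<open>B * S\<close> a
  right inverse, and such a pair always coincides.\<close>

lemma inv_op_factor:
  assumes "inv_op (A * B)" "A * B = B * A"
  shows "inv_op A" 
proof -
  obtain S where S: "S * (A * B) = 1" "A * B * S = 1"
    using assms(1) unfolding inv_op_def by blast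
  have r: "A * (B * S) = 1"
    using S(2) by (simp add: mult.assoc)
  have l: "S * B * A = 1"
    using S(1) unfolding assms(2) by (simp add: mult.assoc)
  have "S * B = S * B * (A * (B * S))"
    using r by simp
  also have "\<dots> = B * S"
    using l by (simp flip: mult.assoc)
  finally show ?thesis
    using r l unfolding inv_op_def by metis
qed

lemma inv_op_scale: "inv_op A \<Longrightarrow> r \<noteq> 0 \<Longrightarrow> inv_op (r *\<^sub>R A)"
  unfolding inv_op_def
proof (elim exE conjE)
  fix S assume "S * A = 1" "A * S = 1" "r \<noteq> 0"
  then show "\<exists>S. S * r *\<^sub>R A = 1 \<and> r *\<^sub>R A * S = 1"
    by (intro exI[of _ "inverse r *\<^sub>R S"]) simp
qed

lemma norm_cop_power: "norm (B ^ Suc n) \<le> norm (B :: 'h::complex_hilbert_space cop) ^ Suc n"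
proof (induction n)
  case (Suc n)
  have "norm (B ^ Suc (Suc n)) \<le> norm B * norm (B ^ Suc n)"
    using norm_mult_ineq[of B "B ^ Suc n"] by simp
  also have "\<dots> \<le> norm B * norm B ^ Suc n"
    by (intro mult_left_mono Suc.IH) simp
  finally show ?case by simp
qed simp

lemma neumann:
  fixes B :: "'h::complex_hilbert_space cop"
  assumes "norm B < 1"
  shows "inv_op (1 - B)"
proof -
  have "summable (\<lambda>n. B ^ Suc n)"
  proof (rule summable_comparison_test')
    show "summable (\<lambda>n. norm B ^ Suc n)"
      using assms by (subst summable_Suc_iff) (simp add: summable_geometric)
    show "norm (B ^ Suc n) \<le> norm B ^ Suc n" for n
      by (rule norm_cop_power)
  qed
  then have sm: "summable (\<lambda>n. B ^ n)"
    by (subst (asm) summable_Suc_iff)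
  have S: "(\<Sum>n. B ^ n) = 1 + (\<Sum>n. B ^ Suc n)"
    using suminf_split_head[OF sm] by (simp add: algebra_simps)
  have "B * (\<Sum>n. B ^ n) = (\<Sum>n. B ^ Suc n)"
    using suminf_mult[OF sm, of B] by simp
  moreover have "(\<Sum>n. B ^ n) * B = (\<Sum>n. B ^ Suc n)"
    using suminf_mult2[OF sm, of B] by (simp add: power_commutes)
  ultimately show ?thesis
    unfolding inv_op_def using S
    by (intro exI[of _ "\<Sum>n. B ^ n"]) (simp add: algebra_simps)
qed

lemma inv_op_shift:
  fixes B :: "'h::complex_hilbert_space cop"
  assumes "norm B < \<bar>r\<bar>"
  shows "inv_op (B - r *\<^sub>R 1)"
proof -
  have "r \<noteq> 0" using assms by auto
  have "inv_op (1 - (1 / r) *\<^sub>R B)"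
    using assms by (intro neumann) (simp add: divide_simps)
  then have "inv_op ((- r) *\<^sub>R (1 - (1 / r) *\<^sub>R B))"
    by (rule inv_op_scale) (use \<open>r \<noteq> 0\<close> in simp)
  then show ?thesis
    using \<open>r \<noteq> 0\<close> by (simp add: algebra_simps)
qed

text \<open>If \<open>K = norm T\<close> and \<open>- K\<close> both had invertible shifts,
  \<open>T * T - (K * K) *\<^sub>R 1\<close> would be bounded below. Expanding the square of its
  norm at \<open>x\<close> turns this into \<open>(norm (app T x))\<^sup>2 \<le> (K\<^sup>2 - d) *
  (norm x)\<^sup>2\<close> with a fixed \<open>d > 0\<close>, which contradicts the choice of
  \<open>K\<close>.\<close>

lemma norm_in_spectrum:
  fixes T :: "'h::complex_hilbert_space cop"
  assumes T: "star T = T" and "(1 :: 'h cop) \<noteq> 0"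
  shows "\<exists>r. \<bar>r\<bar> = norm T \<and> \<not> inv_op (T - r *\<^sub>R 1)"
proof (rule ccontr)
  assume contra: "\<not> ?thesis"
  define K where "K = norm T"
  have "K \<ge> 0" by (simp add: K_def)
  then have "inv_op ((T - K *\<^sub>R 1) * (T - (- K) *\<^sub>R 1))"
    using contra[simplified, rule_format, of K] contra[simplified, rule_format, of "- K"]
    by (intro inv_op_mult) (auto simp: K_def)
  then have "inv_op (T * T - (K * K) *\<^sub>R 1)"
    by (simp add: algebra_simps)
  then obtain S where S: "S * (T * T - (K * K) *\<^sub>R 1) = 1"
    unfolding inv_op_def by blast
  define s where "s = norm S"
  have "S \<noteq> 0" using S assms(2) by auto
  then have "s > 0" by (simp add: s_def)
  have bound: "(norm (x::'h))\<^sup>2 \<le> s\<^sup>2 * (2 * K ^ 4 * (norm x)\<^sup>2 - 2 * K\<^sup>2 * (norm (app T x))\<^sup>2)" for x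
  proof -
    have "norm x = norm (app S (app T (app T x) - (K * K) *\<^sub>R x))"
      using arg_cong[OF S, of "\<lambda>A. app A x"] by simp
    also have "\<dots> \<le> s * norm (app T (app T x) - (K * K) *\<^sub>R x)"
      unfolding s_def by (rule norm_app)
    finally have "(norm x)\<^sup>2 \<le> s\<^sup>2 * (norm (app T (app T x) - (K * K) *\<^sub>R x))\<^sup>2"
      by (metis norm_ge_zero power_mono power_mult_distrib)
    also have "(norm (app T (app T x) - (K * K) *\<^sub>R x))\<^sup>2
        = (norm (app T (app T x)))\<^sup>2 - 2 * K\<^sup>2 * (norm (app T x))\<^sup>2 + K ^ 4 * (norm x)\<^sup>2"
    proof -
      have "cinner (app T (app T x)) x = cinner (app T x) (app T x)"
        by (metis T cinner_star)
      then have "Re (cinner (app T (app T x)) x) = (norm (app T x))\<^sup>2"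
        by simp
      then show ?thesis
        unfolding norm_diff_sq cinner_scaleR_right norm_scaleR power_mult_distrib
        by (simp add: power2_eq_square power4_eq_xxxx)
    qed
    also have "(norm (app T (app T x)))\<^sup>2 \<le> K ^ 4 * (norm x)\<^sup>2"
    proof -
      have "norm (app T (app T x)) \<le> K * (K * norm x)"
        unfolding K_def by (rule order.trans[OF norm_app mult_left_mono[OF norm_app]]) simp
      then have "(norm (app T (app T x)))\<^sup>2 \<le> (K * (K * norm x))\<^sup>2"
        by (intro power_mono) auto
      then show ?thesis by (simp add: power_mult_distrib power2_eq_square power4_eq_xxxx algebra_simps)
    qed
    finally have "(norm x)\<^sup>2 \<le> s\<^sup>2 * (K ^ 4 * (norm x)\<^sup>2 - 2 * K\<^sup>2 * (norm (app T x))\<^sup>2 + K ^ 4 * (norm x)\<^sup>2)"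
      by (simp add: mult_left_mono)
    then show ?thesis
      by (simp add: algebra_simps)
  qed
  have "K > 0"
  proof (rule ccontr)
    assume "\<not> K > 0"
    then have "K = 0" using \<open>K \<ge> 0\<close> by simp
    then have "x = 0" for x :: 'h using bound[of x] by simp
    then have "(1 :: 'h cop) = 0" by (intro cop_eqI) auto
    then show False using assms(2) by simp
  qed
  define d where "d = 1 / (2 * K\<^sup>2 * s\<^sup>2)"
  have "d > 0" using \<open>K > 0\<close> \<open>s > 0\<close> by (simp add: d_def)
  have le: "(norm (app T x))\<^sup>2 \<le> (K\<^sup>2 - d) * (norm x)\<^sup>2" for x
  proof -
    have "2 * K\<^sup>2 * s\<^sup>2 * (norm (app T x))\<^sup>2 \<le> 2 * K\<^sup>2 * s\<^sup>2 * (K\<^sup>2 * (norm x)\<^sup>2) - (norm x)\<^sup>2"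
      using bound[of x] by (simp add: algebra_simps power2_eq_square power4_eq_xxxx)
    then show ?thesis
      using \<open>K > 0\<close> \<open>s > 0\<close> by (simp add: d_def field_simps)
  qed
  have "K\<^sup>2 - d \<ge> 0"
  proof (rule ccontr)
    assume "\<not> K\<^sup>2 - d \<ge> 0"
    then have "(K\<^sup>2 - d) * (norm x)\<^sup>2 \<ge> 0 \<Longrightarrow> x = 0" for x :: 'h
      by (auto simp: zero_le_mult_iff)
    then have "x = 0" for x :: 'h using le[of x] by (meson order.trans zero_le_power2)
    then have "(1 :: 'h cop) = 0" by (intro cop_eqI) auto
    then show False using assms(2) by simp
  qed
  have "norm T \<le> sqrt (K\<^sup>2 - d)"
  proof (rule cop_bound)
    show "norm (app T x) \<le> sqrt (K\<^sup>2 - d) * norm x" for x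
      using real_sqrt_le_mono[OF le[of x]] by (simp add: real_sqrt_mult)
  qed (use \<open>K\<^sup>2 - d \<ge> 0\<close> in simp)
  then have "K\<^sup>2 \<le> K\<^sup>2 - d"
    using \<open>K > 0\<close> \<open>K\<^sup>2 - d \<ge> 0\<close> unfolding K_def[symmetric] by (metis less_eq_real_def power_mono real_sqrt_pow2)
  then show False using \<open>d > 0\<close> by simp
qed

text \<open>With \<open>Y = A - Re z *\<^sub>R 1\<close>, the product of \<open>A - z\<close> and
  \<open>A - cnj z\<close> is \<open>Y * Y\<close> plus the square of \<open>Im z\<close>. As
  \<open>Y * Y\<close> is positive, it differs from \<open>K / 2\<close> by at most
  \<open>K / 2\<close> in norm, so adding a positive scalar makes it invertible, and commuting
  factors of an invertible element are invertible.\<close>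

lemma sa_spectrum_real:
  fixes A :: "'h::complex_hilbert_space cop"
  assumes A: "star A = A" and ni: "\<not> inv_op (A - cscale z 1)"
  shows "Im z = 0"
proof (rule ccontr)
  assume b: "Im z \<noteq> 0"
  define Y where "Y = A - Re z *\<^sub>R 1"
  define K where "K = norm (Y * Y)"
  have Y: "star Y = Y" by (simp add: Y_def A)
  have qY: "0 \<le> quad_form (Y * Y) x" "quad_form (Y * Y) x \<le> K * (norm x)\<^sup>2" for x
  proof -
    show "0 \<le> quad_form (Y * Y) x"
      using quad_form_star_mult[of Y x] Y by simp
    have "quad_form (Y * Y) x \<le> norm x * norm (app (Y * Y) x)"
      unfolding quad_form_def by (rule Re_cinner_le)
    also have "\<dots> \<le> norm x * (K * norm x)"
      unfolding K_def by (intro mult_left_mono norm_app) simp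
    finally show "quad_form (Y * Y) x \<le> K * (norm x)\<^sup>2" by (simp add: power2_eq_square algebra_simps)
  qed
  have "K \<ge> 0" by (simp add: K_def)
  have "norm (Y * Y - (K / 2) *\<^sub>R 1) \<le> K / 2"
  proof (rule sa_norm_le)
    show "\<bar>quad_form (Y * Y - (K / 2) *\<^sub>R 1) x\<bar> \<le> K / 2 * (norm x)\<^sup>2" for x
      using qY[of x] by (simp add: abs_if)
  qed (use Y \<open>K \<ge> 0\<close> in auto)
  also have "\<dots> < \<bar>- (K / 2 + (Im z)\<^sup>2)\<bar>"
    using \<open>K \<ge> 0\<close> zero_less_power2[of "Im z"] b by linarith
  finally have "inv_op (Y * Y - (K / 2) *\<^sub>R 1 - (- (K / 2 + (Im z)\<^sup>2)) *\<^sub>R 1)"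
    by (rule inv_op_shift)
  moreover have "Y * Y - (K / 2) *\<^sub>R 1 - (- (K / 2 + (Im z)\<^sup>2)) *\<^sub>R 1
      = (A - cscale z 1) * (A - cscale (cnj z) 1)"
  proof -
    have "cscale (of_real (Re z) + \<i> * Im z) (1 :: 'h cop) = Re z *\<^sub>R 1 + cscale (\<i> * Im z) 1"
      unfolding cscale_add_left cscale_of_real ..
    then have 1: "A - cscale z 1 = Y - cscale (\<i> * Im z) 1"
      unfolding Y_def complex_eq[symmetric] by simp
    have "cscale (of_real (Re z) + - (\<i> * Im z)) (1 :: 'h cop) = Re z *\<^sub>R 1 - cscale (\<i> * Im z) 1"
      unfolding cscale_add_left cscale_of_real cscale_uminus by simp
    moreover have "of_real (Re z) + - (\<i> * Im z) = cnj z"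
      by (simp add: complex_eq_iff)
    ultimately have 2: "A - cscale (cnj z) 1 = Y + cscale (\<i> * Im z) 1"
      unfolding Y_def by simp
    have "\<i> * Im z * (\<i> * Im z) = of_real (- (Im z)\<^sup>2)"
      by (simp add: power2_eq_square complex_eq_iff)
    then have 3: "cscale (\<i> * Im z) 1 * cscale (\<i> * Im z) (1 :: 'h cop) = (- (Im z)\<^sup>2) *\<^sub>R 1"
      using cscale_of_real[of "- (Im z)\<^sup>2" "1 :: 'h cop"] by simp
    have "(Y - cscale (\<i> * Im z) 1) * (Y + cscale (\<i> * Im z) 1) = Y * Y - (- (Im z)\<^sup>2) *\<^sub>R 1"
      unfolding 3[symmetric] by (simp add: left_diff_distrib right_diff_distrib distrib_left distrib_right cscale_diff)
    then show ?thesis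
      unfolding 1 2 by (simp add: algebra_simps flip: scaleR_add_left)
  qed
  ultimately have "inv_op ((A - cscale z 1) * (A - cscale (cnj z) 1))"
    by simp
  then have "inv_op (A - cscale z 1)"
    by (rule inv_op_factor) (simp add: algebra_simps cscale_diff)
  with ni show False by simp
qed

definition cpe :: "complex poly \<Rightarrow> 'h::complex_hilbert_space cop \<Rightarrow> 'h cop" where
  "cpe p A = (\<Sum>i\<le>degree p. cscale (coeff p i) (A ^ i))"

definition rpe :: "real poly \<Rightarrow> 'h::complex_hilbert_space cop \<Rightarrow> 'h cop" where
  "rpe p A = (\<Sum>i\<le>degree p. coeff p i *\<^sub>R A ^ i)"

lemma cscale_sum: "cscale c (sum f S) = (\<Sum>i\<in>S. cscale c (f i))"
  by (induction S rule: infinite_finite_induct) (simp_all add: cscale_add)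

lemma cpe_altdef: "degree p \<le> n \<Longrightarrow> cpe p A = (\<Sum>i\<le>n. cscale (coeff p i) (A ^ i))"
  unfolding cpe_def by (intro sum.mono_neutral_left) (auto simp: coeff_eq_0)

lemma rpe_altdef: "degree p \<le> n \<Longrightarrow> rpe p A = (\<Sum>i\<le>n. coeff p i *\<^sub>R A ^ i)"
  unfolding rpe_def by (intro sum.mono_neutral_left) (auto simp: coeff_eq_0)

lemma cpe_0 [simp]: "cpe 0 A = 0"
  by (simp add: cpe_def)

lemma cpe_pCons [simp]: "cpe (pCons a p) A = cscale a 1 + A * cpe p A"
proof -
  have "cpe (pCons a p) A = (\<Sum>i\<le>Suc (degree p). cscale (coeff (pCons a p) i) (A ^ i))"
    by (rule cpe_altdef) (simp add: degree_pCons_le)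
  also have "\<dots> = cscale a 1 + (\<Sum>i\<le>degree p. cscale (coeff p i) (A ^ Suc i))"
    by (subst sum.atMost_Suc_shift) simp
  also have "\<dots> = cscale a 1 + A * cpe p A"
    by (simp add: cpe_def sum_distrib_left)
  finally show ?thesis .
qed

lemma cpe_add: "cpe (p + q) A = cpe p A + cpe q A"
proof -
  define n where "n = max (degree p) (degree q)"
  have "degree (p + q) \<le> n" by (simp add: n_def degree_add_le)
  then show ?thesis
    by (simp add: cpe_altdef[where n = n] n_def cscale_add_left sum.distrib)
qed

lemma cpe_smult: "cpe (smult c p) A = cscale c (cpe p A)"
  by (simp add: cpe_altdef[OF degree_smult_le] cpe_def cscale_sum)

lemma cpe_mult: "cpe (p * q) A = cpe p A * cpe q A"
  by (induction p) (simp_all add: cpe_add cpe_smult distrib_right mult.assoc)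

lemma cpe_of_real: "cpe (map_poly of_real p) A = rpe p A"
  by (simp add: cpe_def rpe_def coeff_map_poly cscale_of_real degree_map_poly)

lemma poly_map_poly_of_real: "poly (map_poly of_real p) (complex_of_real x) = complex_of_real (poly p x)"
  by (induction p) (simp_all add: map_poly_pCons)

lemma rpe_0 [simp]: "rpe 0 A = 0"
  by (simp add: rpe_def)

lemma rpe_pCons [simp]: "rpe (pCons a p) A = a *\<^sub>R 1 + A * rpe p A"
  by (simp add: map_poly_pCons cscale_of_real flip: cpe_of_real)

lemma rpe_add: "rpe (p + q) A = rpe p A + rpe q A"
proof -
  define n where "n = max (degree p) (degree q)"
  have "degree (p + q) \<le> n" by (simp add: n_def degree_add_le)
  then show ?thesis
    by (simp add: rpe_altdef[where n = n] n_def scaleR_add_left sum.distrib)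
qed

lemma rpe_smult: "rpe (smult c p) A = c *\<^sub>R rpe p A"
  by (simp add: rpe_altdef[OF degree_smult_le] rpe_def scaleR_sum_right)

lemma rpe_diff: "rpe (p - q) A = rpe p A - rpe q A"
  using rpe_add[of p "smult (-1) q" A] rpe_smult[of "-1" q A] by simp

lemma rpe_mult: "rpe (p * q) A = rpe p A * rpe q A"
  by (induction p) (simp_all add: rpe_add rpe_smult distrib_right mult.assoc)

lemma rpe_commute: "X * A = B * X \<Longrightarrow> X * rpe p A = rpe p B * X"
proof (induction p)
  case (pCons a p)
  have "X * (A * rpe p A) = B * (X * rpe p A)"
    using pCons.prems by (simp flip: mult.assoc)
  then show ?case
    using pCons by (simp add: distrib_left distrib_right mult.assoc)
qed simp

lemma star_rpe: "star A = A \<Longrightarrow> star (rpe p A) = rpe p A"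
  by (induction p) (simp_all add: rpe_commute[of A A A])

text \<open>A product of invertible factors is invertible, so some linear factor of \<open>p\<close>
  must fail to be; roots are split off one at a time.\<close>

lemma spectral_mapping:
  assumes "p \<noteq> 0" "\<not> inv_op (cpe p A)"
  shows "\<exists>z. poly p z = 0 \<and> \<not> inv_op (A - cscale z 1)"
  using assms
proof (induction "degree p" arbitrary: p)
  case 0
  then obtain c where c: "p = [:c:]"
    by (metis degree_eq_zeroE)
  with \<open>p \<noteq> 0\<close> have "inv_op (cpe p A)"
    unfolding inv_op_def by (intro exI[of _ "cscale (inverse c) 1"]) simp
  with 0 show ?case by simp
next
  case (Suc n)
  then have "\<not> constant (poly p)"
    by (simp add: constant_degree)
  then obtain z where z: "poly p z = 0"
    using fundamental_theorem_of_algebra by blast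
  then obtain r where r: "p = [:-z, 1:] * r"
    using poly_eq_0_iff_dvd dvdE by metis
  have "r \<noteq> 0" using r Suc.prems by auto
  then have "degree p = degree [:-z, 1:] + degree r"
    unfolding r by (intro degree_mult_eq) auto
  then have "degree r = n"
    using Suc.hyps(2) by simp
  have eq: "cpe p A = (A - cscale z 1) * cpe r A"
    unfolding r cpe_mult by (simp add: cscale_uminus)
  show ?case
  proof (cases "inv_op (A - cscale z 1)")
    case True
    then have "\<not> inv_op (cpe r A)"
      using Suc.prems inv_op_mult unfolding eq by blast
    then obtain w where "poly r w = 0" "\<not> inv_op (A - cscale w 1)"
      using Suc.hyps(1)[of r] \<open>degree r = n\<close> \<open>r \<noteq> 0\<close> by blast
    then show ?thesis using r by (metis mult_zero_right poly_mult)
  qed (use z in blast)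
qed

definition rspec :: "'h::complex_hilbert_space cop \<Rightarrow> real set" where
  "rspec A = {s. \<not> inv_op (A - s *\<^sub>R 1)}"

text \<open>The norm of the self-adjoint \<open>rpe q A\<close> is, up to sign, a spectral value
  \<open>r\<close> of it. Spectral mapping for \<open>q - [:r:]\<close> finds \<open>s\<close> in
  the spectrum of \<open>A\<close> with \<open>poly q s = r\<close>, and this \<open>s\<close> is
  real because \<open>A\<close> is self-adjoint.\<close>

lemma norm_rpe_le:
  fixes A :: "'h::complex_hilbert_space cop"
  assumes A: "star A = A" and e: "\<And>s. s \<in> rspec A \<Longrightarrow> \<bar>poly q s\<bar> \<le> e" and "0 \<le> e"
  shows "norm (rpe q A) \<le> e"
proof (cases "(1 :: 'h cop) = 0")
  case True
  then have "rpe q A = 0"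
    by (metis mult_1 mult_zero_left)
  then show ?thesis using \<open>0 \<le> e\<close> by simp
next
  case False
  obtain r where r: "\<bar>r\<bar> = norm (rpe q A)" "\<not> inv_op (rpe q A - r *\<^sub>R 1)"
    using norm_in_spectrum[OF star_rpe[OF A] False] by blast
  define p where "p = map_poly complex_of_real (q - [:r:])"
  have p: "cpe p A = rpe q A - r *\<^sub>R 1"
    unfolding p_def cpe_of_real by (simp add: rpe_diff)
  have "\<exists>s \<in> rspec A. poly q s = r"
  proof (cases "p = 0")
    case True
    then have "q = [:r:]"
      unfolding p_def by (simp add: map_poly_eq_0_iff)
    \<comment> \<open>A constant \<open>q\<close> takes the value \<open>r\<close> everywhere, so it
      only remains to see that the spectrum is not empty.\<close>
    moreover obtain s where "s \<in> rspec A"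
      using norm_in_spectrum[OF A False] unfolding rspec_def by blast
    ultimately show ?thesis by auto
  next
    case False
    then obtain z where z: "poly p z = 0" "\<not> inv_op (A - cscale z 1)"
      using spectral_mapping[of p A] r(2) p by auto
    then have zz: "z = complex_of_real (Re z)"
      using sa_spectrum_real[OF A] by (simp add: complex_eq_iff)
    have "Re z \<in> rspec A"
      unfolding rspec_def using z(2) cscale_of_real[of "Re z" 1] zz by (metis mem_Collect_eq)
    moreover have "poly (q - [:r:]) (Re z) = 0"
    proof -
      have "poly p (complex_of_real (Re z)) = complex_of_real (poly (q - [:r:]) (Re z))"
        unfolding p_def by (rule poly_map_poly_of_real)
      then show ?thesis using z(1) zz by (metis of_real_eq_0_iff)
    qed
    ultimately show ?thesis by auto
  qed
  then show ?thesis using e r(1) by fastforce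
qed

text \<open>After a shift to the midpoint of the interval the form bounds become a norm bound by
  half its length.\<close>

lemma rspec_interval:
  fixes A :: "'h::complex_hilbert_space cop"
  assumes A: "star A = A" and "\<And>x. a * (norm x)\<^sup>2 \<le> quad_form A x" "\<And>x. quad_form A x \<le> b * (norm x)\<^sup>2" and "a \<le> b"
  shows "rspec A \<subseteq> {a..b}"
proof
  fix s assume s: "s \<in> rspec A"
  have "norm (A - ((a + b) / 2) *\<^sub>R 1) \<le> (b - a) / 2"
  proof (rule sa_norm_le)
    fix x :: 'h
    define u v where "u = a * (norm x)\<^sup>2" and "v = b * (norm x)\<^sup>2"
    have "quad_form (A - ((a + b) / 2) *\<^sub>R 1) x = quad_form A x - (u + v) / 2"
      by (simp add: u_def v_def algebra_simps add_divide_distrib)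
    moreover have "(b - a) / 2 * (norm x)\<^sup>2 = (v - u) / 2"
      by (simp add: u_def v_def algebra_simps diff_divide_distrib)
    ultimately show "\<bar>quad_form (A - ((a + b) / 2) *\<^sub>R 1) x\<bar> \<le> (b - a) / 2 * (norm x)\<^sup>2"
      using assms(2)[of x] assms(3)[of x] by (intro abs_leI) (simp_all add: u_def[symmetric] v_def[symmetric] field_simps)
  qed (use A \<open>a \<le> b\<close> in auto)
  then have "\<bar>s - (a + b) / 2\<bar> \<le> (b - a) / 2"
    using s inv_op_shift[of "A - ((a + b) / 2) *\<^sub>R 1" "s - (a + b) / 2"]
    by (fastforce simp: rspec_def algebra_simps)
  then show "s \<in> {a..b}"
    by (auto simp: abs_le_iff field_simps)
qed

lemma rspec_norm: 
  assumes "s \<in> rspec A" shows "\<bar>s\<bar> \<le> norm A"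
  using assms inv_op_shift[of A s] by (force simp: rspec_def)

text \<open>\<open>op_spectrum\<close> admits real-linear inverses; but the inverse of a
  complex-linear operator is complex-linear, so both notions of invertibility agree.\<close>

lemma op_spectrum_rspec: "{s. complex_of_real s \<in> op_spectrum (Rep_cop A)} = rspec A"
proof (intro Collect_cong[of _ "\<lambda>s. s \<in> rspec A", simplified])
  fix s
  have Rep: "Rep_cop A - scaleC_op (complex_of_real s) id_blinfun = Rep_cop (A - s *\<^sub>R 1)"
    by (simp add: minus_cop.rep_eq one_cop.rep_eq scaleR_cop.rep_eq cscale.rep_eq flip: cscale_of_real)
  show "complex_of_real s \<in> op_spectrum (Rep_cop A) \<longleftrightarrow> s \<in> rspec A"
  proof -
    define B where "B = A - s *\<^sub>R 1"
    have "(\<exists>S. S o\<^sub>L Rep_cop B = id_blinfun \<and> Rep_cop B o\<^sub>L S = id_blinfun) \<longleftrightarrow> inv_op B"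
    proof
      assume "inv_op B"
      then obtain S where "S * B = 1" "B * S = 1"
        unfolding inv_op_def by blast
      then show "\<exists>S. S o\<^sub>L Rep_cop B = id_blinfun \<and> Rep_cop B o\<^sub>L S = id_blinfun"
        by (intro exI[of _ "Rep_cop S"]) (metis times_cop.rep_eq one_cop.rep_eq)
    next
      assume "\<exists>S. S o\<^sub>L Rep_cop B = id_blinfun \<and> Rep_cop B o\<^sub>L S = id_blinfun"
      then obtain S where S: "S o\<^sub>L Rep_cop B = id_blinfun" "Rep_cop B o\<^sub>L S = id_blinfun"
        by blast
      have 1: "blinfun_apply S (app B x) = x" and 2: "app B (blinfun_apply S x) = x" for x
        using S[THEN arg_cong[of _ _ "\<lambda>T. blinfun_apply T x"]] by (simp_all add: app.rep_eq)
      have "S \<in> bounded_ops"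
        unfolding bounded_ops_def by (auto, metis 1 2 app_scaleC)
      then have "Abs_cop S * B = 1" "B * Abs_cop S = 1"
        by (auto intro!: cop_eqI simp: 1 2 app.rep_eq[of "Abs_cop S"] Abs_cop_inverse)
      then show "inv_op B"
        unfolding inv_op_def by blast
    qed
    then show ?thesis
      unfolding op_spectrum_def rspec_def mem_Collect_eq Rep B_def by blast
  qed
qed

lemma poly_op_rpe: "poly_op q (Rep_cop A) = Rep_cop (rpe q A)"
proof -
  have "((\<lambda>B. Rep_cop A o\<^sub>L B) ^^ i) id_blinfun = Rep_cop (A ^ i)" for i
    by (induction i) (simp_all add: one_cop.rep_eq times_cop.rep_eq)
  moreover have "Rep_cop (sum f S) = (\<Sum>i\<in>S. Rep_cop (f i))" for f :: "nat \<Rightarrow> 'a cop" and S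
    by (induction S rule: infinite_finite_induct) (simp_all add: zero_cop.rep_eq plus_cop.rep_eq)
  ultimately show ?thesis
    by (simp add: poly_op_def rpe_def scaleR_cop.rep_eq)
qed

lemma poly_approx:
  fixes f :: "real \<Rightarrow> real"
  assumes "continuous_on {a..b} f"
  shows "\<exists>q. uniform_limit {a..b} (\<lambda>n. poly (q n)) f sequentially"
proof -
  have "\<exists>q. \<forall>x\<in>{a..b}. \<bar>f x - poly q x\<bar> < 1 / Suc n" for n
  proof -
    obtain g where g: "real_polynomial_function g" "\<And>x. x \<in> {a..b} \<Longrightarrow> \<bar>f x - g x\<bar> < 1 / Suc n"
      using Stone_Weierstrass_real_polynomial_function[OF compact_Icc assms, of "1 / Suc n"] by auto
    obtain c m where "g = (\<lambda>x. \<Sum>i\<le>m. c i * x ^ i)"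
      using g(1) unfolding real_polynomial_function_iff_sum by blast
    then have "g = poly (\<Sum>i\<le>m. monom (c i) i)"
      by (simp add: fun_eq_iff poly_sum poly_monom)
    then show ?thesis using g(2) by blast
  qed
  then obtain q where q: "\<And>n x. x \<in> {a..b} \<Longrightarrow> \<bar>f x - poly (q n) x\<bar> < 1 / Suc n"
    by metis
  have "uniform_limit {a..b} (\<lambda>n. poly (q n)) f sequentially"
  proof (rule uniform_limitI)
    fix e :: real assume "e > 0"
    then obtain N where N: "1 / Suc N < e"
      using nat_approx_posE by blast
    show "\<forall>\<^sub>F n in sequentially. \<forall>x\<in>{a..b}. dist (poly (q n) x) (f x) < e"
    proof (rule eventually_sequentiallyI[of N], intro ballI)
      fix n x assume "N \<le> n" "x \<in> {a..b}"
      then have "\<bar>f x - poly (q n) x\<bar> < 1 / Suc n" and "1 / Suc n \<le> 1 / real (Suc N)"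
        using q[of x n] by (auto simp: divide_simps)
      with N show "dist (poly (q n) x) (f x) < e"
        by (simp add: dist_real_def abs_minus_commute)
    qed
  qed
  then show ?thesis by blast
qed

lemma rspec_subset: "rspec A \<subseteq> {- norm A..norm A}"
  using rspec_norm[of _ A] by (force simp: abs_le_iff)

text \<open>Two approximating sequences differ by polynomials that are uniformly small on the
  spectrum. Together with \<open>rpe_Cauchy\<close> this justifies the definite description in
  \<open>cont_fun_calc\<close>.\<close>

lemma rpe_diff_limit:
  assumes A: "star A = A"
    and p: "uniform_limit (rspec A) (\<lambda>n. poly (p n)) f sequentially"
    and q: "uniform_limit (rspec A) (\<lambda>n. poly (q n)) f sequentially"
    and pl: "(\<lambda>n. rpe (p n) A) \<longlonglongrightarrow> B"
  shows "(\<lambda>n. rpe (q n) A) \<longlonglongrightarrow> B"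
proof -
  have "(\<lambda>n. rpe (p n) A - rpe (q n) A) \<longlonglongrightarrow> 0"
  proof (rule tendstoI)
    fix e :: real assume "e > 0"
    then have "e / 3 > 0" by simp
    show "\<forall>\<^sub>F n in sequentially. dist (rpe (p n) A - rpe (q n) A) 0 < e"
      using uniform_limitD[OF p \<open>e / 3 > 0\<close>] uniform_limitD[OF q \<open>e / 3 > 0\<close>]
    proof eventually_elim
      case (elim n)
      have "norm (rpe (p n - q n) A) \<le> 2 * e / 3"
      proof (rule norm_rpe_le[OF A])
        fix s assume "s \<in> rspec A"
        then have "\<bar>poly (p n) s - f s\<bar> < e / 3" "\<bar>poly (q n) s - f s\<bar> < e / 3"
          using elim by (auto simp: dist_real_def)
        then show "\<bar>poly (p n - q n) s\<bar> \<le> 2 * e / 3"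
          unfolding poly_diff by linarith
      qed (use \<open>e > 0\<close> in simp)
      then show ?case using \<open>e > 0\<close> by (simp add: rpe_diff)
    qed
  qed
  then have "(\<lambda>n. rpe (p n) A - (rpe (p n) A - rpe (q n) A)) \<longlonglongrightarrow> B - 0"
    by (intro tendsto_diff pl)
  then show ?thesis by simp
qed

lemma rpe_Cauchy:
  assumes A: "star A = A"
    and p: "uniform_limit (rspec A) (\<lambda>n. poly (p n)) f sequentially"
  shows "convergent (\<lambda>n. rpe (p n) A)"
proof -
  have "Cauchy (\<lambda>n. rpe (p n) A)"
  proof (rule metric_CauchyI)
    fix e :: real assume "e > 0"
    then have "e / 3 > 0" by simp
    obtain N where N: "\<And>n s. n \<ge> N \<Longrightarrow> s \<in> rspec A \<Longrightarrow> \<bar>poly (p n) s - f s\<bar> < e / 3"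
      using uniform_limitD[OF p \<open>e / 3 > 0\<close>] unfolding eventually_sequentially by (auto simp: dist_real_def)
    have "dist (rpe (p m) A) (rpe (p n) A) < e" if "m \<ge> N" "n \<ge> N" for m n
    proof -
      have "norm (rpe (p m - p n) A) \<le> 2 * e / 3"
      proof (rule norm_rpe_le[OF A])
        fix s assume s: "s \<in> rspec A"
        show "\<bar>poly (p m - p n) s\<bar> \<le> 2 * e / 3"
          using N[OF that(1) s] N[OF that(2) s] unfolding poly_diff by linarith
      qed (use \<open>e > 0\<close> in simp)
      then show ?thesis using \<open>e > 0\<close> by (simp add: rpe_diff dist_norm)
    qed
    then show "\<exists>M. \<forall>m\<ge>M. \<forall>n\<ge>M. dist (rpe (p m) A) (rpe (p n) A) < e" by blast
  qed
  then show ?thesis by (simp add: Cauchy_convergent_iff)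
qed

text \<open>The default \<open>0\<close> does not occur for self-adjoint \<open>A\<close> and
  \<open>f\<close> continuous on the line, as the next lemma shows.\<close>

lift_definition cfc :: "(real \<Rightarrow> real) \<Rightarrow> 'h::complex_hilbert_space cop \<Rightarrow> 'h cop"
  is "\<lambda>f A. if cont_fun_calc f A \<in> bounded_ops then cont_fun_calc f A else 0"
  by (auto simp: zero_cop.rep_eq[symmetric] Rep_cop)

text \<open>Continuity is asked on the whole line so that polynomials can be chosen on any interval
  around the spectrum. This is why \<open>max 0\<close> and absolute values appear in the functions
  to which the calculus is applied.\<close>

lemma cfc_limit_cfc:
  assumes A: "star A = A" and f: "continuous_on UNIV f"
  shows "(\<forall>q. uniform_limit (rspec A) (\<lambda>n. poly (q n)) f sequentially \<longrightarrow> (\<lambda>n. rpe (q n) A) \<longlonglongrightarrow> cfc f A)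
    \<and> Rep_cop (cfc f A) = cont_fun_calc f (Rep_cop A)"
proof -
  have lim: "(\<lambda>n. Rep_cop (X n)) \<longlonglongrightarrow> Rep_cop B \<longleftrightarrow> X \<longlonglongrightarrow> B" for X :: "nat \<Rightarrow> 'a cop" and B
    by (simp add: tendsto_iff dist_cop.rep_eq)
  have "continuous_on {- norm A..norm A} f"
    using f continuous_on_subset by blast
  then obtain p where "uniform_limit {- norm A..norm A} (\<lambda>n. poly (p n)) f sequentially"
    using poly_approx by blast
  then have p: "uniform_limit (rspec A) (\<lambda>n. poly (p n)) f sequentially"
    by (rule uniform_limit_on_subset) (rule rspec_subset)
  then obtain B where B: "(\<lambda>n. rpe (p n) A) \<longlonglongrightarrow> B"
    using rpe_Cauchy[OF A] unfolding convergent_def by blast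
  have all: "(\<lambda>n. rpe (q n) A) \<longlonglongrightarrow> B" if "uniform_limit (rspec A) (\<lambda>n. poly (q n)) f sequentially" for q
    using rpe_diff_limit[OF A p that B] .
  have "cont_fun_calc f (Rep_cop A) = Rep_cop B"
    unfolding cont_fun_calc_def op_spectrum_rspec poly_op_rpe
  proof (rule the_equality)
    show "\<forall>q. uniform_limit (rspec A) (\<lambda>n. poly (q n)) f sequentially \<longrightarrow> (\<lambda>n. Rep_cop (rpe (q n) A)) \<longlonglongrightarrow> Rep_cop B"
      by (simp add: lim all)
    fix C assume "\<forall>q. uniform_limit (rspec A) (\<lambda>n. poly (q n)) f sequentially \<longrightarrow> (\<lambda>n. Rep_cop (rpe (q n) A)) \<longlonglongrightarrow> C"
    then have "(\<lambda>n. Rep_cop (rpe (p n) A)) \<longlonglongrightarrow> C"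
      using p by blast
    then show "C = Rep_cop B"
      using B lim LIMSEQ_unique by metis
  qed
  moreover from this have "cfc f A = B"
    by (metis Rep_cop Rep_cop_inject cfc.rep_eq)
  ultimately show ?thesis
    using all by simp
qed

lemmas cfc_limit = cfc_limit_cfc[THEN conjunct1, rule_format]
lemmas Rep_cfc = cfc_limit_cfc[THEN conjunct2]

lemma cfc_approx:
  assumes A: "star A = A" and f: "continuous_on UNIV f" and "0 \<le> K" "rspec A \<subseteq> {-K..K}"
  obtains q where "uniform_limit {-K..K} (\<lambda>n. poly (q n)) f sequentially" "(\<lambda>n. rpe (q n) A) \<longlonglongrightarrow> cfc f A"
proof -
  have "continuous_on {-K..K} f"
    using f continuous_on_subset by blast
  then obtain q where q: "uniform_limit {-K..K} (\<lambda>n. poly (q n)) f sequentially"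
    using poly_approx by blast
  then show ?thesis
    using that cfc_limit[OF A f uniform_limit_on_subset[OF q assms(4)]] by blast
qed

lemma cfc_norm_le:
  assumes A: "star A = A" and f: "continuous_on UNIV f" and e: "\<And>s. s \<in> rspec A \<Longrightarrow> \<bar>f s\<bar> \<le> e" and "0 \<le> e"
  shows "norm (cfc f A) \<le> e"
proof (rule field_le_epsilon)
  fix d :: real assume "d > 0"
  obtain q where q: "uniform_limit {- norm A..norm A} (\<lambda>n. poly (q n)) f sequentially"
    and l: "(\<lambda>n. rpe (q n) A) \<longlonglongrightarrow> cfc f A"
    using cfc_approx[OF A f norm_ge_zero rspec_subset] by blast
  have "\<forall>\<^sub>F n in sequentially. norm (rpe (q n) A) \<le> e + d"
    using uniform_limitD[OF q \<open>d > 0\<close>]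
  proof eventually_elim
    case (elim n)
    show ?case
    proof (rule norm_rpe_le[OF A])
      fix s assume s: "s \<in> rspec A"
      then have "\<bar>poly (q n) s - f s\<bar> < d"
        using elim rspec_subset[of A] by (auto simp: dist_real_def)
      then show "\<bar>poly (q n) s\<bar> \<le> e + d"
        using e[OF s] by linarith
    qed (use \<open>0 \<le> e\<close> \<open>d > 0\<close> in simp)
  qed
  then show "norm (cfc f A) \<le> e + d"
    by (intro Lim_norm_ubound[OF _ l]) auto
qed

lemma cfc_poly:
  assumes A: "star A = A"
  shows "cfc (poly q) A = rpe q A"
proof -
  have "continuous_on UNIV (poly q)"
    by (intro continuous_intros)
  moreover have "uniform_limit (rspec A) (\<lambda>n. poly q) (poly q) sequentially"
    by (rule uniform_limit_const)
  ultimately have "(\<lambda>n. rpe q A) \<longlonglongrightarrow> cfc (poly q) A"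
    using cfc_limit[OF A, of "poly q" "\<lambda>_. q"] by blast
  then show ?thesis by (simp add: LIMSEQ_const_iff)
qed

lemma cfc_add:
  assumes A: "star A = A" and f: "continuous_on UNIV f" and g: "continuous_on UNIV g"
  shows "cfc (\<lambda>s. f s + g s) A = cfc f A + cfc g A"
proof -
  obtain p where p: "uniform_limit {- norm A..norm A} (\<lambda>n. poly (p n)) f sequentially" "(\<lambda>n. rpe (p n) A) \<longlonglongrightarrow> cfc f A"
    using cfc_approx[OF A f norm_ge_zero rspec_subset] by blast
  obtain q where q: "uniform_limit {- norm A..norm A} (\<lambda>n. poly (q n)) g sequentially" "(\<lambda>n. rpe (q n) A) \<longlonglongrightarrow> cfc g A"
    using cfc_approx[OF A g norm_ge_zero rspec_subset] by blast
  have "uniform_limit {- norm A..norm A} (\<lambda>n. poly (p n + q n)) (\<lambda>s. f s + g s) sequentially"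
    unfolding poly_add by (intro uniform_limit_intros p q)
  then have "uniform_limit (rspec A) (\<lambda>n. poly (p n + q n)) (\<lambda>s. f s + g s) sequentially"
    by (rule uniform_limit_on_subset) (rule rspec_subset)
  then have "(\<lambda>n. rpe (p n + q n) A) \<longlonglongrightarrow> cfc (\<lambda>s. f s + g s) A"
    by (intro cfc_limit[OF A] continuous_intros f g)
  moreover have "(\<lambda>n. rpe (p n + q n) A) \<longlonglongrightarrow> cfc f A + cfc g A"
    unfolding rpe_add by (intro tendsto_intros p q)
  ultimately show ?thesis
    using LIMSEQ_unique by blast
qed

lemma cfc_mult:
  assumes A: "star A = A" and f: "continuous_on UNIV f" and g: "continuous_on UNIV g"
  shows "cfc (\<lambda>s. f s * g s) A = cfc f A * cfc g A"
proof -
  obtain p where p: "uniform_limit {- norm A..norm A} (\<lambda>n. poly (p n)) f sequentially" "(\<lambda>n. rpe (p n) A) \<longlonglongrightarrow> cfc f A"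
    using cfc_approx[OF A f norm_ge_zero rspec_subset] by blast
  obtain q where q: "uniform_limit {- norm A..norm A} (\<lambda>n. poly (q n)) g sequentially" "(\<lambda>n. rpe (q n) A) \<longlonglongrightarrow> cfc g A"
    using cfc_approx[OF A g norm_ge_zero rspec_subset] by blast
  have bdd: "bounded (h ` {- norm A..norm A})" if "continuous_on UNIV h" for h :: "real \<Rightarrow> real"
    by (rule compact_imp_bounded[OF compact_continuous_image]) (use that continuous_on_subset in auto)
  have "uniform_limit {- norm A..norm A} (\<lambda>n. poly (p n * q n)) (\<lambda>s. f s * g s) sequentially"
    unfolding poly_mult
    by (rule bounded_bilinear.bounded_uniform_limit[OF bounded_bilinear_mult p(1) q(1) bdd[OF g] bdd[OF f]])
  then have "uniform_limit (rspec A) (\<lambda>n. poly (p n * q n)) (\<lambda>s. f s * g s) sequentially"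
    by (rule uniform_limit_on_subset) (rule rspec_subset)
  then have "(\<lambda>n. rpe (p n * q n) A) \<longlonglongrightarrow> cfc (\<lambda>s. f s * g s) A"
    by (intro cfc_limit[OF A] continuous_intros f g)
  moreover have "(\<lambda>n. rpe (p n * q n) A) \<longlonglongrightarrow> cfc f A * cfc g A"
    unfolding rpe_mult by (intro tendsto_intros p q)
  ultimately show ?thesis
    using LIMSEQ_unique by blast
qed

lemma cfc_const: "star A = A \<Longrightarrow> cfc (\<lambda>_. c) A = c *\<^sub>R 1"
proof -
  have "poly [:c:] = (\<lambda>_. c)" by (simp add: fun_eq_iff)
  then show "star A = A \<Longrightarrow> ?thesis"
    using cfc_poly[of A "[:c:]"] by simp
qed

lemma cfc_id: "star A = A \<Longrightarrow> cfc (\<lambda>s. s) A = A"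
proof -
  have "poly [:0, 1:] = (\<lambda>s :: real. s)" by (simp add: fun_eq_iff)
  then show "star A = A \<Longrightarrow> ?thesis"
    using cfc_poly[of A "[:0, 1:]"] by simp
qed

lemma cfc_scale:
  assumes "star A = A" "continuous_on UNIV f"
  shows "cfc (\<lambda>s. c * f s) A = c *\<^sub>R cfc f A"
  using cfc_mult[of A "\<lambda>_. c" f] cfc_const[of A c] assms by (simp add: continuous_on_const)

lemma cfc_diff:
  assumes A: "star A = A" and f: "continuous_on UNIV f" and g: "continuous_on UNIV g"
  shows "cfc (\<lambda>s. f s - g s) A = cfc f A - cfc g A"
  using cfc_add[OF A f, of "\<lambda>s. - 1 * g s"] cfc_scale[OF A g, of "-1"] g
  by (simp add: continuous_on_minus)

lemma cfc_cong:
  assumes A: "star A = A" and "continuous_on UNIV f" "continuous_on UNIV g" and "\<And>s. s \<in> rspec A \<Longrightarrow> f s = g s"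
  shows "cfc f A = cfc g A"
proof -
  have "norm (cfc (\<lambda>s. f s - g s) A) \<le> 0"
    using assms by (intro cfc_norm_le continuous_intros) auto
  then show ?thesis using assms by (simp add: cfc_diff)
qed

lemma tendsto_star:
  fixes X :: "'a \<Rightarrow> 'h::complex_hilbert_space cop"
  assumes "(X \<longlongrightarrow> B) F" shows "((\<lambda>n. star (X n)) \<longlongrightarrow> star B) F"
proof -
  have "norm (star A) \<le> norm A" for A :: "'h cop"
  proof (rule cop_bound)
    fix x
    have "norm (app (star A) x) * norm (app (star A) x) = Re (cinner (app A (app (star A) x)) x)"
      by (subst cinner_star) (simp add: power2_eq_square)
    also have "\<dots> \<le> norm (app A (app (star A) x)) * norm x"
      by (rule Re_cinner_le)
    also have "\<dots> \<le> norm A * norm (app (star A) x) * norm x"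
      by (intro mult_right_mono norm_app) simp
    finally show "norm (app (star A) x) \<le> norm A * norm x"
      by (cases "norm (app (star A) x) = 0") (auto simp: algebra_simps)
  qed simp
  then have "bounded_linear (star :: 'h cop \<Rightarrow> 'h cop)"
    by (intro bounded_linear_intro[where K = 1]) auto
  then show ?thesis
    by (rule bounded_linear.tendsto) fact
qed

lemma star_cfc:
  assumes A: "star A = A" and f: "continuous_on UNIV f"
  shows "star (cfc f A) = cfc f A"
proof -
  obtain p where "(\<lambda>n. rpe (p n) A) \<longlonglongrightarrow> cfc f A"
    using cfc_approx[OF A f norm_ge_zero rspec_subset] by blast
  from tendsto_star[OF this] this show ?thesis
    unfolding star_rpe[OF A] by (rule LIMSEQ_unique)
qed

lemma cfc_commute:
  assumes A: "star A = A" and f: "continuous_on UNIV f" and X: "X * A = A * X"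
  shows "X * cfc f A = cfc f A * X"
proof -
  obtain p where p: "(\<lambda>n. rpe (p n) A) \<longlonglongrightarrow> cfc f A"
    using cfc_approx[OF A f norm_ge_zero rspec_subset] by blast
  have "(\<lambda>n. X * rpe (p n) A) \<longlonglongrightarrow> X * cfc f A"
    by (intro tendsto_intros p)
  moreover have "(\<lambda>n. rpe (p n) A * X) \<longlonglongrightarrow> cfc f A * X"
    by (intro tendsto_intros p)
  ultimately show ?thesis
    unfolding rpe_commute[OF X] by (rule LIMSEQ_unique)
qed

text \<open>A continuous square root of \<open>f\<close> on the spectrum exhibits
  \<open>cfc f A\<close> as the square of a self-adjoint operator.\<close>

lemma quad_form_cfc_nonneg:
  assumes A: "star A = A" and f: "continuous_on UNIV f" and pos: "\<And>s. s \<in> rspec A \<Longrightarrow> 0 \<le> f s"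
  shows "0 \<le> quad_form (cfc f A) x"
proof -
  define g where "g = (\<lambda>s. sqrt (max 0 (f s)))"
  have g: "continuous_on UNIV g"
    unfolding g_def by (intro continuous_intros f)
  have "cfc f A = cfc g A * cfc g A"
    unfolding cfc_mult[OF A g g, symmetric]
    by (rule cfc_cong) (use A f g pos in \<open>auto simp: g_def intro!: continuous_intros\<close>)
  then have "quad_form (cfc f A) x = quad_form (star (cfc g A) * cfc g A) x"
    by (simp add: star_cfc[OF A g])
  then show ?thesis unfolding quad_form_star_mult by simp
qed

section \<open>Strong limits\<close>

text \<open>Strong operator convergence, for sequences only: every strong limit formed below is one
  of a sequence.\<close>

definition slim :: "(nat \<Rightarrow> 'h::complex_hilbert_space cop) \<Rightarrow> 'h cop \<Rightarrow> bool" where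
  "slim X A \<longleftrightarrow> (\<forall>x. (\<lambda>n. app (X n) x) \<longlonglongrightarrow> app A x)"

lemma slim_unique: "slim X A \<Longrightarrow> slim X B \<Longrightarrow> A = B"
  unfolding slim_def by (intro cop_eqI) (metis LIMSEQ_unique)

lemma slim_const: "slim (\<lambda>n. A) A"
  by (simp add: slim_def)

lemma slim_norm: "X \<longlonglongrightarrow> A \<Longrightarrow> slim X A"
  unfolding slim_def by (auto intro!: tendsto_app)

lemma slim_mult_left: "slim X A \<Longrightarrow> slim (\<lambda>n. B * X n) (B * A)"
  unfolding slim_def by (auto intro!: bounded_linear.tendsto[OF bounded_linear_app])

lemma slim_mult_right: "slim X A \<Longrightarrow> slim (\<lambda>n. X n * B) (A * B)"
  unfolding slim_def by auto

lemma slim_minus: "slim X A \<Longrightarrow> slim (\<lambda>n. - X n) (- A)"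
  unfolding slim_def by (auto intro!: tendsto_intros)

text \<open>The bound on the left factors controls their effect on
  \<open>app (Y n) x - app B x\<close>, which tends to 0.\<close>

lemma slim_mult:
  assumes "slim X A" "slim Y B" and K: "\<And>n. norm (X n) \<le> K"
  shows "slim (\<lambda>n. X n * Y n) (A * B)"
  unfolding slim_def
proof
  fix x
  have Y0: "(\<lambda>n. app (Y n) x - app B x) \<longlonglongrightarrow> 0"
    using assms(2) unfolding slim_def by (simp add: LIM_zero)
  have "(\<lambda>n. app (X n) (app (Y n) x - app B x)) \<longlonglongrightarrow> 0"
  proof (rule Lim_null_comparison)
    show "\<forall>\<^sub>F n in sequentially. norm (app (X n) (app (Y n) x - app B x)) \<le> K * norm (app (Y n) x - app B x)"
      using K by (intro always_eventually allI order.trans[OF norm_app mult_right_mono]) auto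
    show "(\<lambda>n. K * norm (app (Y n) x - app B x)) \<longlonglongrightarrow> 0"
      using tendsto_mult_right_zero[OF tendsto_norm_zero[OF Y0]] .
  qed
  moreover have "(\<lambda>n. app (X n) (app B x)) \<longlonglongrightarrow> app A (app B x)"
    using assms(1) unfolding slim_def by blast
  ultimately have "(\<lambda>n. app (X n) (app (Y n) x - app B x) + app (X n) (app B x)) \<longlonglongrightarrow> 0 + app A (app B x)"
    by (rule tendsto_add)
  then show "(\<lambda>n. app (X n * Y n) x) \<longlonglongrightarrow> app (A * B) x"
    by (simp add: app_arg_simps)
qed

lemma slim_star_self:
  assumes "slim X A" "\<And>n. star (X n) = X n"
  shows "star A = A"
proof (rule star_eqI)
  fix x y
  have "(\<lambda>n. cinner (app (X n) x) y) \<longlonglongrightarrow> cinner (app A x) y"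
    using assms(1) unfolding slim_def by (intro tendsto_intros) auto
  moreover have "(\<lambda>n. cinner x (app (X n) y)) \<longlonglongrightarrow> cinner x (app A y)"
    using assms(1) unfolding slim_def by (intro tendsto_intros) auto
  ultimately show "cinner (app A x) y = cinner x (app A y)"
    unfolding cinner_star assms(2) by (rule LIMSEQ_unique)
qed

lemma slim_exists:
  fixes X :: "nat \<Rightarrow> 'h::complex_hilbert_space cop"
  assumes C: "\<And>x. Cauchy (\<lambda>n. app (X n) x)" and K: "\<And>n. norm (X n) \<le> K"
  shows "\<exists>A. slim X A"
proof -
  have "\<exists>y. (\<lambda>n. app (X n) x) \<longlonglongrightarrow> y" for x
    using C[of x] by (metis Cauchy_convergent_iff convergent_def)
  then obtain a where a: "\<And>x. (\<lambda>n. app (X n) x) \<longlonglongrightarrow> a x"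
    by metis
  have "bounded_linear a"
  proof (rule bounded_linear_intro[where K = K])
    show "a (x + y) = a x + a y" for x y
      using LIMSEQ_unique[OF a[of "x + y"]] tendsto_add[OF a a] by (simp add: app_arg_simps)
    show "a (r *\<^sub>R x) = r *\<^sub>R a x" for r x
      using LIMSEQ_unique[OF a[of "r *\<^sub>R x"]] tendsto_scaleR[OF tendsto_const a] by (simp add: app_arg_simps)
    show "norm (a x) \<le> norm x * K" for x
    proof (rule Lim_norm_ubound[OF _ a[of x]])
      show "\<forall>\<^sub>F n in sequentially. norm (app (X n) x) \<le> norm x * K"
        using K by (intro always_eventually allI) (metis mult.commute mult_right_mono norm_app norm_ge_zero order.trans)
    qed simp
  qed
  moreover have "a (scaleC c x) = scaleC c (a x)" for c x
    using LIMSEQ_unique[OF a[of "scaleC c x"]] bounded_linear.tendsto[OF bounded_linear_scaleC a]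
    by (simp add: app_scaleC)
  ultimately have "Blinfun a \<in> bounded_ops"
    by (simp add: bounded_ops_def bounded_linear_Blinfun_apply)
  then have "app (Abs_cop (Blinfun a)) = a"
    by (simp add: app.rep_eq Abs_cop_inverse bounded_linear_Blinfun_apply[OF \<open>bounded_linear a\<close>])
  then show ?thesis
    using a unfolding slim_def by (intro exI[of _ "Abs_cop (Blinfun a)"]) simp
qed

lemma quad_form_cfc_mono:
  assumes A: "star A = A" and f: "continuous_on UNIV f" and g: "continuous_on UNIV g"
    and le: "\<And>s. s \<in> rspec A \<Longrightarrow> f s \<le> g s"
  shows "quad_form (cfc f A) x \<le> quad_form (cfc g A) x"
proof -
  have "0 \<le> quad_form (cfc (\<lambda>s. g s - f s) A) x"
    using A f g le by (intro quad_form_cfc_nonneg continuous_intros) auto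
  then show ?thesis by (simp add: cfc_diff[OF A g f])
qed

lemma rspec_square:
  assumes A: "star A = A" and s: "s \<in> rspec (A * A)"
  shows "0 \<le> s"
proof -
  have "rspec (A * A) \<subseteq> {0..norm (A * A)}"
  proof (rule rspec_interval)
    fix x
    show "0 * (norm x)\<^sup>2 \<le> quad_form (A * A) x"
      using quad_form_star_mult[of A x] A by simp
    have "quad_form (A * A) x \<le> norm x * norm (app (A * A) x)"
      unfolding quad_form_def by (rule Re_cinner_le)
    also have "\<dots> \<le> norm x * (norm (A * A) * norm x)"
      by (intro mult_left_mono norm_app) simp
    finally show "quad_form (A * A) x \<le> norm (A * A) * (norm x)\<^sup>2"
      by (simp add: power2_eq_square algebra_simps)
  qed (use A in auto)
  then show ?thesis using s by auto
qed

lemma Cauchy_telescope: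
  fixes v :: "nat \<Rightarrow> 'h::real_normed_vector"
  assumes a: "convergent a" and le: "\<And>m n. m \<le> n \<Longrightarrow> (norm (v n - v m))\<^sup>2 \<le> a n - a m"
  shows "Cauchy v"
proof (rule metric_CauchyI)
  fix e :: real assume "e > 0"
  then have "e\<^sup>2 > 0" by simp
  with a obtain N where N: "\<And>m n. m \<ge> N \<Longrightarrow> n \<ge> N \<Longrightarrow> \<bar>a m - a n\<bar> < e\<^sup>2"
    using metric_CauchyD[OF convergent_Cauchy[OF a]] by (metis dist_real_def)
  have *: "dist (v n) (v m) < e" if "m \<le> n" "m \<ge> N" for m n
  proof -
    have "(dist (v n) (v m))\<^sup>2 < e\<^sup>2"
      using le[OF that(1)] N[of n m] that unfolding dist_norm by linarith
    then show ?thesis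
      using \<open>e > 0\<close> by (intro power_less_imp_less_base[of _ 2 e]) auto
  qed
  show "\<exists>M. \<forall>m\<ge>M. \<forall>n\<ge>M. dist (v m) (v n) < e"
    using * by (intro exI[of _ N]) (metis dist_commute nle_le)
qed

text \<open>A form of monotone convergence: the squares of \<open>norm (app (X n) x)\<close>
  increase and are bounded, and their increments dominate the squared distances of the vectors. It
  serves for sign functions and for chains of partial symmetries.\<close>

lemma Cauchy_sa_increasing:
  fixes X :: "nat \<Rightarrow> 'h::complex_hilbert_space cop"
  assumes sa: "\<And>n. star (X n) = X n" and K: "\<And>n. norm (X n) \<le> K"
    and le: "\<And>m n x. m \<le> n \<Longrightarrow> quad_form ((X n - X m) * (X n - X m)) x \<le> quad_form (X n * X n) x - quad_form (X m * X m) x"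
  shows "\<exists>A. slim X A"
proof (rule slim_exists[OF _ K])
  fix x
  define a where "a n = quad_form (X n * X n) x" for n
  have a: "a n = (norm (app (X n) x))\<^sup>2" for n
    using quad_form_star_mult[of "X n" x] by (simp add: a_def sa)
  have diff: "(norm (app (X n) x - app (X m) x))\<^sup>2 \<le> a n - a m" if "m \<le> n" for m n
    using le[OF that, of x] quad_form_star_mult[of "X n - X m" x] by (simp add: a_def sa)
  have "incseq a"
    using diff by (intro incseq_SucI) (smt (verit) le_SucI order_refl zero_le_power2)
  moreover have "a n \<le> (K * norm x)\<^sup>2" for n
    unfolding a by (intro power_mono order.trans[OF norm_app] mult_right_mono K) auto
  ultimately have "convergent a"
    using incseq_convergent[of a "(K * norm x)\<^sup>2"] unfolding convergent_def by blast
  then show "Cauchy (\<lambda>n. app (X n) x)"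
    by (rule Cauchy_telescope) (rule diff)
qed

text \<open>The polar decomposition of a self-adjoint \<open>D\<close>: \<open>J\<close> is the strong limit of
  \<open>D (D\<^sup>2 + 1/n)\<^sup>-\<^sup>1\<^sup>/\<^sup>2\<close>, and \<open>J\<^sup>2\<close> is the support projection of \<open>D\<close>.\<close>

lemma sign_exists:
  fixes D :: "'h::complex_hilbert_space cop"
  assumes D: "star D = D"
  shows "\<exists>J X. slim (\<lambda>n. D * cfc (X n) (D * D)) J \<and> (\<forall>n. continuous_on UNIV (X n)) \<and> star J = J \<and> J * J * D = D \<and> J * J * J = J"
proof -
  define T where "T = D * D"
  define \<epsilon> where "\<epsilon> n = 1 / real (Suc n)" for n
  \<comment> \<open>The functions increase to \<open>1 / sqrt s\<close>; the absolute value makes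
    them continuous on the whole line.\<close>
  define h where "h n s = 1 / sqrt (\<bar>s\<bar> + \<epsilon> n)" for n s
  define C where "C n = cfc (h n) T" for n
  define X where "X n = D * C n" for n
  have eps: "\<epsilon> n > 0" for n by (simp add: \<epsilon>_def)
  have eps': "s + \<epsilon> n \<noteq> 0" "\<bar>s\<bar> + \<epsilon> n \<noteq> 0" if "s \<ge> 0" for s n
    using that eps[of n] by auto
  have T: "star T = T" by (simp add: T_def D)
  have spec: "0 \<le> s" if "s \<in> rspec T" for s
    using rspec_square[OF D] that by (simp add: T_def)
  have h: "continuous_on UNIV (h n)" for n
    unfolding h_def by (intro continuous_intros) (use eps[of n] in \<open>auto simp: add_nonneg_pos less_imp_neq[THEN not_sym]\<close>)
  have h2: "h n s * h n s = 1 / (s + \<epsilon> n)" if "0 \<le> s" for n s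
    using that eps[of n] by (simp add: h_def)
  have DC: "D * C n = C n * D" for n
    unfolding C_def by (rule cfc_commute[OF T h]) (simp add: T_def mult.assoc)
  have sC: "star (C n) = C n" for n
    unfolding C_def by (rule star_cfc[OF T h])
  have sX: "star (X n) = X n" for n
    by (simp add: X_def D sC DC)
  have XX: "X m * X n = cfc (\<lambda>s. s * (h m s * h n s)) T" for m n
  proof -
    have "X m * X n = D * (C m * D) * C n"
      by (simp add: X_def mult.assoc)
    also have "\<dots> = T * (C m * C n)"
      unfolding T_def DC[symmetric] by (simp add: mult.assoc)
    also have "\<dots> = cfc (\<lambda>s. s * (h m s * h n s)) T"
      by (simp add: C_def cfc_mult[OF T] cfc_id[OF T] h continuous_intros)
    finally show ?thesis .
  qed
  have hh: "continuous_on UNIV (\<lambda>s. s * (h m s * h n s))" for m n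
    by (intro continuous_intros h)
  have nX: "norm (X n) \<le> 1" for n
  proof (rule cop_bound)
    fix x
    have "(norm (app (X n) x))\<^sup>2 = quad_form (X n * X n) x"
      using quad_form_star_mult[of "X n" x] by (simp add: sX)
    also have "\<dots> \<le> quad_form (cfc (\<lambda>_. 1) T) x"
      unfolding XX
    proof (rule quad_form_cfc_mono[OF T])
      show "s * (h n s * h n s) \<le> 1" if "s \<in> rspec T" for s
        using spec[OF that] eps[of n] by (simp add: h2)
    qed (intro continuous_intros h)+
    also have "\<dots> = (norm x)\<^sup>2"
      by (simp add: cfc_const[OF T])
    finally show "norm (app (X n) x) \<le> 1 * norm x"
      by (auto intro: power2_le_imp_le)
  qed simp
  have "\<exists>J. slim X J"
  proof (rule Cauchy_sa_increasing[OF sX nX])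
    fix m n :: nat and x :: 'h assume "m \<le> n"
    then have "\<epsilon> n \<le> \<epsilon> m"
      by (simp add: \<epsilon>_def divide_simps)
    then have hle: "h m s \<le> h n s" "0 \<le> h m s" if "0 \<le> s" for s
      using that eps[of n] eps[of m] unfolding h_def by (auto intro!: divide_left_mono mult_pos_pos)
    have "(X n - X m) * (X n - X m) = X n * X n - X m * X n - X n * X m + X m * X m"
      by (simp add: left_diff_distrib right_diff_distrib)
    then have eq: "(X n - X m) * (X n - X m) = cfc (\<lambda>s. s * (h n s * h n s) - s * (h m s * h n s) - s * (h n s * h m s) + s * (h m s * h m s)) T"
      unfolding XX by (simp only: cfc_add[OF T] cfc_diff[OF T] hh continuous_on_diff)
    have "quad_form ((X n - X m) * (X n - X m)) x \<le> quad_form (cfc (\<lambda>s. s * (h n s * h n s) - s * (h m s * h m s)) T) x"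
      unfolding eq
    proof (rule quad_form_cfc_mono[OF T])
      fix s assume "s \<in> rspec T"
      then have s: "0 \<le> s" by (rule spec)
      \<comment> \<open>Since \<open>0 \<le> h m \<le> h n\<close>, the square of
        \<open>h n - h m\<close> is at most the difference of the squares; the gap is twice this
        product.\<close>
      have "0 \<le> 2 * (s * (h m s * (h n s - h m s)))"
        using s hle[OF s] by (intro mult_nonneg_nonneg) auto
      then show "s * (h n s * h n s) - s * (h m s * h n s) - s * (h n s * h m s) + s * (h m s * h m s)
          \<le> s * (h n s * h n s) - s * (h m s * h m s)"
        by (simp add: algebra_simps)
    qed (intro continuous_intros h)+
    also have "\<dots> = quad_form (X n * X n) x - quad_form (X m * X m) x"
      unfolding XX by (simp add: cfc_diff[OF T] h continuous_intros)
    finally show "quad_form ((X n - X m) * (X n - X m)) x \<le> quad_form (X n * X n) x - quad_form (X m * X m) x" .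
  qed
  then obtain J where J: "slim X J" by blast
  have sJ: "star J = J" by (rule slim_star_self[OF J sX])
  have "slim (\<lambda>n. X n * X n * D) (J * J * D)"
    by (intro slim_mult_right slim_mult[OF J J nX])
  moreover have "slim (\<lambda>n. X n * X n * D) D"
  proof (rule slim_norm)
    \<comment> \<open>The square of the norm is governed by \<open>s * (e / (s + e))\<^sup>2\<close>
      on the spectrum of \<open>D * D\<close>, with \<open>e = \<epsilon> n\<close>, and this is at
      most \<open>e\<close>.\<close>
    have close: "norm (D - X n * X n * D) \<le> sqrt (\<epsilon> n)" for n
    proof (rule cop_bound)
      fix x
      define G where "G = 1 - X n * X n"
      have G: "G = cfc (\<lambda>s. 1 - s * (h n s * h n s)) T"
        unfolding G_def XX by (simp add: cfc_diff[OF T] cfc_const[OF T] h continuous_intros)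
      have sG: "star G = G" by (simp add: G_def sX)
      have "(D - X n * X n * D) = G * D" by (simp add: G_def left_diff_distrib)
      moreover have "(norm (app (G * D) x))\<^sup>2 = quad_form (D * (G * (G * D))) x"
        using quad_form_star_mult[of "G * D" x] by (simp add: sG D mult.assoc)
      moreover have "D * (G * (G * D)) = cfc (\<lambda>s. s * ((1 - s * (h n s * h n s)) * (1 - s * (h n s * h n s)))) T"
      proof -
        have "D * G = G * D" 
          unfolding G by (rule cfc_commute[OF T]) (auto intro!: continuous_intros h simp: T_def mult.assoc)
        then have "D * (G * (G * D)) = T * (G * G)"
          unfolding T_def by (metis mult.assoc)
        then show ?thesis
          unfolding G by (simp add: cfc_mult[OF T] cfc_id[OF T] h continuous_intros)
      qed
      moreover have "quad_form (cfc (\<lambda>s. s * ((1 - s * (h n s * h n s)) * (1 - s * (h n s * h n s)))) T) x \<le> quad_form (cfc (\<lambda>_. \<epsilon> n) T) x"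
      proof (rule quad_form_cfc_mono[OF T])
        fix s assume "s \<in> rspec T"
        then have s: "0 \<le> s" by (rule spec)
        define e where "e = \<epsilon> n"
        have e: "e > 0" by (simp add: e_def eps)
        have "1 - s * (h n s * h n s) = e / (s + e)"
          using s e by (simp add: h2 e_def[symmetric] field_simps)
        moreover have "s * (e / (s + e) * (e / (s + e))) \<le> e"
        proof -
          have "s * (e / (s + e) * (e / (s + e))) = e * ((s / (s + e)) * (e / (s + e)))"
            by simp
          also have "\<dots> \<le> e * (1 * 1)"
            using s e by (intro mult_left_mono mult_mono) auto
          finally show ?thesis by simp
        qed
        ultimately show "s * ((1 - s * (h n s * h n s)) * (1 - s * (h n s * h n s))) \<le> \<epsilon> n"
          by (simp add: e_def)
      qed (intro continuous_intros h)+
      ultimately have "(norm (app (D - X n * X n * D) x))\<^sup>2 \<le> \<epsilon> n * (norm x)\<^sup>2"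
        by (simp add: cfc_const[OF T])
      then show "norm (app (D - X n * X n * D) x) \<le> sqrt (\<epsilon> n) * norm x"
        using real_le_rsqrt[of "norm (app (D - X n * X n * D) x)" "\<epsilon> n * (norm x)\<^sup>2"] by (simp add: real_sqrt_mult)
    qed (simp add: \<epsilon>_def)
    have "(\<lambda>n. sqrt (\<epsilon> n)) \<longlonglongrightarrow> sqrt 0"
      unfolding \<epsilon>_def by (intro tendsto_real_sqrt LIMSEQ_Suc lim_1_over_n)
    then have "(\<lambda>n. D - X n * X n * D) \<longlonglongrightarrow> 0"
      using Lim_null_comparison[OF always_eventually, of "\<lambda>n. D - X n * X n * D" "\<lambda>n. sqrt (\<epsilon> n)"] close
      by simp
    then have "(\<lambda>n. D - (D - X n * X n * D)) \<longlonglongrightarrow> D - 0"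
      by (intro tendsto_intros)
    then show "(\<lambda>n. X n * X n * D) \<longlonglongrightarrow> D" by simp
  qed
  ultimately have JJD: "J * J * D = D" by (rule slim_unique)
  have "slim (\<lambda>n. J * J * X n) (J * J * J)"
    by (intro slim_mult_left J)
  moreover have "J * J * X n = X n" for n
    unfolding X_def using JJD by (metis mult.assoc)
  ultimately have "J * J * J = J"
    using J slim_unique by auto
  then show ?thesis
    using J sJ JJD h unfolding X_def C_def T_def by (intro exI[of _ J] exI[of _ h]) auto
qed

section \<open>Finite factors\<close>

text \<open>\<open>tr\<close> plays the real part of the trace; \<open>tr_imag\<close> records that
  the trace is real on self-adjoint elements. The algebra is assumed closed under strong limits of
  sequences, and \<open>center\<close> says that its center is scalar.\<close>

locale factor =
  fixes M :: "'h::complex_hilbert_space cop set" and tr :: "'h cop \<Rightarrow> real"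
  assumes one_M [simp, intro]: "1 \<in> M"
    and add_M [simp, intro]: "A \<in> M \<Longrightarrow> B \<in> M \<Longrightarrow> A + B \<in> M"
    and mult_M [simp, intro]: "A \<in> M \<Longrightarrow> B \<in> M \<Longrightarrow> A * B \<in> M"
    and cscale_M [simp, intro]: "A \<in> M \<Longrightarrow> cscale c A \<in> M"
    and star_M [simp, intro]: "A \<in> M \<Longrightarrow> star A \<in> M"
    and slim_M: "(\<And>n. X n \<in> M) \<Longrightarrow> slim X A \<Longrightarrow> A \<in> M"
    and center: "A \<in> M \<Longrightarrow> (\<And>B. B \<in> M \<Longrightarrow> A * B = B * A) \<Longrightarrow> \<exists>c. A = cscale c 1"
    and tr_add: "A \<in> M \<Longrightarrow> B \<in> M \<Longrightarrow> tr (A + B) = tr A + tr B"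
    and tr_scaleR: "A \<in> M \<Longrightarrow> tr (r *\<^sub>R A) = r * tr A"
    and tr_imag: "A \<in> M \<Longrightarrow> star A = A \<Longrightarrow> tr (cscale \<i> A) = 0"
    and tr_commute: "A \<in> M \<Longrightarrow> B \<in> M \<Longrightarrow> tr (A * B) = tr (B * A)"
    and tr_nonneg: "A \<in> M \<Longrightarrow> 0 \<le> tr (star A * A)"
    and tr_faithful: "A \<in> M \<Longrightarrow> tr (star A * A) = 0 \<Longrightarrow> A = 0"
    and tr_one [simp]: "tr 1 = 1"
begin

lemma scaleR_M [simp, intro]: "A \<in> M \<Longrightarrow> r *\<^sub>R A \<in> M"
  using cscale_M[of A "of_real r"] by (simp add: cscale_of_real)

lemma zero_M [simp, intro]: "0 \<in> M"
  using scaleR_M[OF one_M, of 0] by simp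

lemma uminus_M [simp, intro]: "A \<in> M \<Longrightarrow> - A \<in> M"
  using scaleR_M[of A "-1"] by simp

lemma diff_M [simp, intro]: "A \<in> M \<Longrightarrow> B \<in> M \<Longrightarrow> A - B \<in> M"
  using add_M[of A "- B"] by simp

lemma rpe_M [simp, intro]: "A \<in> M \<Longrightarrow> rpe q A \<in> M"
  by (induction q) auto

lemma limit_M: "(\<And>n. X n \<in> M) \<Longrightarrow> X \<longlonglongrightarrow> A \<Longrightarrow> A \<in> M"
  using slim_M slim_norm by blast

lemma cfc_M: 
  assumes "A \<in> M" "star A = A" "continuous_on UNIV f" shows "cfc f A \<in> M"
  using cfc_approx[OF assms(2,3) norm_ge_zero rspec_subset] limit_M rpe_M assms(1) by metis

lemma tr_zero [simp]: "tr 0 = 0"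
  using tr_scaleR[OF one_M, of 0] by simp

lemma tr_minus: "A \<in> M \<Longrightarrow> tr (- A) = - tr A"
  using tr_scaleR[of A "-1"] by simp

lemma tr_diff: "A \<in> M \<Longrightarrow> B \<in> M \<Longrightarrow> tr (A - B) = tr A - tr B"
  using tr_add[of A "- B"] by (simp add: tr_minus)

lemmas tr_simps = tr_add tr_diff tr_minus tr_scaleR

lemma tr_square_nonneg: "A \<in> M \<Longrightarrow> star A = A \<Longrightarrow> 0 \<le> tr (A * A)"
  using tr_nonneg[of A] by simp

lemma tr_square_eq_0: "A \<in> M \<Longrightarrow> star A = A \<Longrightarrow> tr (A * A) = 0 \<Longrightarrow> A = 0"
  using tr_faithful[of A] by simp

text \<open>All relations pass from \<open>D\<close> to \<open>J\<close> because \<open>J\<close> is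
  a strong limit of \<open>D * C n\<close> with \<open>C n\<close> a function of
  \<open>D * D\<close>: what commutes or anticommutes with \<open>D\<close> commutes with
  \<open>D * D\<close>, hence with \<open>C n\<close>.\<close>

lemma sign_M:
  assumes D: "D \<in> M" "star D = D"
  obtains J where "J \<in> M" "star J = J" "J * J * D = D" "J * J * J = J"
    "\<And>X. X * D = D * X \<Longrightarrow> X * J = J * X" "\<And>X. X * D = - (D * X) \<Longrightarrow> X * J = - (J * X)"
    "\<And>B. B * D = 0 \<Longrightarrow> B * J = 0" "\<And>B. D * B = 0 \<Longrightarrow> J * B = 0"
proof -
  obtain J X where J: "slim (\<lambda>n. D * cfc (X n) (D * D)) J" and X: "\<And>n. continuous_on UNIV (X n)"
    and Js: "star J = J" "J * J * D = D" "J * J * J = J"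
    using sign_exists[OF D(2)] by blast
  have DD: "star (D * D) = D * D" by (simp add: D)
  define C where "C n = cfc (X n) (D * D)" for n
  have J: "slim (\<lambda>n. D * C n) J" using J unfolding C_def .
  have comm: "Y * C n = C n * Y" if "Y * (D * D) = D * D * Y" for Y n
    unfolding C_def by (rule cfc_commute[OF DD X that])
  have JM: "J \<in> M"
    by (rule slim_M[OF _ J]) (simp add: C_def cfc_M D DD X)
  have 1: "Y * J = J * Y" if Y: "Y * D = D * Y" for Y
  proof -
    have YD: "Y * (D * D) = D * D * Y"
      by (metis Y mult.assoc)
    have "Y * (D * C n) = D * C n * Y" for n
      using comm[OF YD, of n] Y by (metis mult.assoc)
    then show ?thesis
      using slim_unique[OF slim_mult_left[OF J, of Y]] slim_mult_right[OF J, of Y] by simp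
  qed
  have 2: "Y * J = - (J * Y)" if Y: "Y * D = - (D * Y)" for Y
  proof -
    have "Y * (D * D) = - (D * (Y * D))"
      using arg_cong[OF Y, of "\<lambda>Z. Z * D"] by (simp add: mult.assoc)
    then have YD: "Y * (D * D) = D * D * Y"
      by (simp add: Y mult.assoc)
    have "Y * (D * C n) = - (D * C n * Y)" for n
    proof -
      have "Y * (D * C n) = - (D * (Y * C n))"
        using arg_cong[OF Y, of "\<lambda>Z. Z * C n"] by (simp add: mult.assoc)
      then show ?thesis by (simp add: comm[OF YD] mult.assoc)
    qed
    then show ?thesis
      using slim_unique[OF slim_mult_left[OF J, of Y]] slim_minus[OF slim_mult_right[OF J, of Y]] by simp
  qed
  have 3: "B * J = 0" if "B * D = 0" for B
    using slim_unique[OF slim_mult_left[OF J, of B], of 0] slim_const[of 0] that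
    by (simp flip: mult.assoc)
  have 4: "J * B = 0" if B: "D * B = 0" for B
  proof -
    have "D * C n * B = C n * (D * B)" for n
      using comm[of D n] by (simp add: mult.assoc)
    then show ?thesis
      using slim_unique[OF slim_mult_right[OF J, of B], of 0] slim_const[of 0] B by simp
  qed
  show ?thesis
    by (rule that[OF JM Js 1 2 3 4])
qed

end

lemma mult_left_assoc: "a * b = c \<Longrightarrow> a * (b * x) = c * (x :: 'a::semigroup_mult)"
  by (simp flip: mult.assoc)

lemma slim_shift: "slim X A \<Longrightarrow> slim (\<lambda>n. X (n + k)) A"
  unfolding slim_def by (auto intro: LIMSEQ_ignore_initial_segment)

lemma cscale_two: "A + A = 2 *\<^sub>R A" for A :: "'h::complex_hilbert_space cop"
  by (simp add: scaleR_2)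

section \<open>Partial symmetries, primeness of a factor and comparison of projections\<close>

context factor
begin

text \<open>A self-adjoint partial isometry, that is, a difference of two orthogonal projections;
  \<open>j * j\<close> is its support projection.\<close>

definition psym :: "'h cop \<Rightarrow> bool" where
  "psym j \<longleftrightarrow> j \<in> M \<and> star j = j \<and> j * j * j = j"

text \<open>The order of partial symmetries: \<open>k\<close> agrees with \<open>j\<close> on the
  support of \<open>j\<close>.\<close>

definition ext :: "'h cop \<Rightarrow> 'h cop \<Rightarrow> bool" where
  "ext j k \<longleftrightarrow> k * j * j = j"

lemma ext_mult:
  assumes "psym j" "psym k" "ext j k"
  shows "j * k = j * j" "k * j = j * j"
proof -
  have "star (k * j * j) = star j"
    using assms by (simp add: ext_def)
  then have "j * j * k = j"
    using assms by (simp add: psym_def mult.assoc)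
  then have "j * j * j * k = j * j"
    by (simp add: mult.assoc)
  then show jk: "j * k = j * j"
    using assms by (simp add: psym_def)
  from arg_cong[OF this, of star] show "k * j = j * j"
    using assms by (simp add: psym_def)
qed

lemma ext_trans:
  assumes "psym j" "psym k" "psym l" "ext j k" "ext k l"
  shows "ext j l"
proof -
  have "k * k * j = k * (k * j)" by (simp add: mult.assoc)
  also have "\<dots> = k * j * j"
    by (simp add: ext_mult(2)[OF assms(1,2,4)] mult.assoc mult_left_assoc[OF ext_mult(2)[OF assms(1,2,4)]])
  finally have kkj: "k * k * j = j"
    using assms by (simp add: ext_def)
  have "l * j * j = l * (k * k * j) * j" by (simp add: kkj)
  also have "\<dots> = (l * k * k) * j * j" by (simp add: mult.assoc)
  also have "\<dots> = j" using assms by (simp add: ext_def)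
  finally show ?thesis by (simp add: ext_def)
qed

lemma ext_diff:
  assumes "psym j" "psym k" "ext j k"
  shows "(k - j) * (k - j) = k * k - j * j"
  using ext_mult[OF assms] by (simp add: left_diff_distrib right_diff_distrib)

lemma psym_proj: "psym j \<Longrightarrow> j * j * (j * j) = j * j"
  by (simp add: psym_def mult.assoc[symmetric])

lemma norm_psym:
  assumes "psym j" shows "norm j \<le> 1"
proof (rule cop_bound)
  fix x
  have j: "star j = j" "j * j * j = j" using assms by (auto simp: psym_def)
  have "(norm (app (j * j) x))\<^sup>2 = quad_form (j * j * (j * j)) x"
    using quad_form_star_mult[of "j * j" x] by (simp add: j)
  also have "\<dots> = quad_form (j * j) x"
    by (simp add: psym_proj[OF assms])
  finally have 1: "(norm (app (j * j) x))\<^sup>2 = quad_form (j * j) x" .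
  have "quad_form (j * j) x \<le> norm x * norm (app (j * j) x)"
    unfolding quad_form_def by (rule Re_cinner_le)
  then have "norm (app (j * j) x) \<le> norm x"
    using 1 mult_right_le_imp_le[of "norm (app (j * j) x)" "norm (app (j * j) x)" "norm x"]
    by (cases "norm (app (j * j) x) = 0") (auto simp: power2_eq_square)
  then have "norm x * norm (app (j * j) x) \<le> norm x * norm x"
    by (intro mult_left_mono) auto
  with \<open>quad_form (j * j) x \<le> _\<close> have "(norm (app j x))\<^sup>2 \<le> (norm x)\<^sup>2"
    using quad_form_star_mult[of j x] by (simp add: j power2_eq_square)
  then show "norm (app j x) \<le> 1 * norm x"
    by (auto intro: power2_le_imp_le)
qed simp

lemma tr_psym_le:
  assumes "psym j" shows "tr (j * j) \<le> 1"
proof -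
  have j: "j \<in> M" "star j = j" using assms by (auto simp: psym_def)
  have "0 \<le> tr ((1 - j * j) * (1 - j * j))"
    using j by (intro tr_square_nonneg) auto
  also have "(1 - j * j) * (1 - j * j) = 1 - j * j"
    using psym_proj[OF assms] by (simp add: left_diff_distrib right_diff_distrib)
  finally show ?thesis
    using j by (simp add: tr_simps)
qed

text \<open>The n-th step picks an extension whose support has trace within \<open>1 / Suc n\<close>
  of the supremum over all extensions. The strong limit extends every step, so a further extension
  of it has a support of the same trace, and by \<open>ext_diff\<close> and faithfulness it is equal
  to the limit.\<close>

lemma exhaustion:
  assumes G: "\<And>j. j \<in> G \<Longrightarrow> psym j" and "j0 \<in> G"
    and closed: "\<And>X J. (\<And>n. X n \<in> G) \<Longrightarrow> psym J \<Longrightarrow> slim X J \<Longrightarrow> J \<in> G"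
  shows "\<exists>j\<in>G. \<forall>k\<in>G. ext j k \<longrightarrow> k = j"
proof -
  have step: "\<exists>k. k \<in> G \<and> ext j k \<and> (\<forall>l\<in>G. ext j l \<longrightarrow> tr (l * l) \<le> tr (k * k) + 1 / Suc n)" if "j \<in> G" for j n
  proof -
    define S where "S = {tr (k * k) | k. k \<in> G \<and> ext j k}"
    have ne: "S \<noteq> {}"
      using that G[OF that] unfolding S_def ext_def psym_def by blast
    have bdd: "bdd_above S"
      unfolding S_def using tr_psym_le G by (intro bdd_aboveI[of _ 1]) auto
    obtain k where k: "k \<in> G" "ext j k" "Sup S - 1 / Suc n < tr (k * k)"
      using less_cSupD[OF ne, of "Sup S - 1 / Suc n"] unfolding S_def by auto
    have "tr (l * l) \<le> tr (k * k) + 1 / Suc n" if "l \<in> G" "ext j l" for l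
    proof -
      have "tr (l * l) \<le> Sup S"
        using that by (intro cSup_upper bdd) (auto simp: S_def)
      then show ?thesis using k(3) by linarith
    qed
    with k show ?thesis by blast
  qed
  obtain X where X: "\<And>n. X n \<in> G" "\<And>n. ext (X n) (X (Suc n))"
    "\<And>n l. l \<in> G \<Longrightarrow> ext (X n) l \<Longrightarrow> tr (l * l) \<le> tr (X (Suc n) * X (Suc n)) + 1 / Suc n"
    using dependent_nat_choice[of "\<lambda>_ j. j \<in> G"
        "\<lambda>n j k. ext j k \<and> (\<forall>l\<in>G. ext j l \<longrightarrow> tr (l * l) \<le> tr (k * k) + 1 / Suc n)"] step \<open>j0 \<in> G\<close>
    by metis
  have P: "psym (X n)" for n using G X(1) by blast
  have sX: "star (X n) = X n" "X n \<in> M" for n using P[of n] by (auto simp: psym_def)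
  have chain: "ext (X m) (X n)" if "m \<le> n" for m n
    using that
  proof (induction n rule: dec_induct)
    case base
    show ?case using P[of m] by (simp add: ext_def psym_def)
  next
    case (step n)
    then show ?case using ext_trans[OF P P P] X(2) by blast
  qed
  have "\<exists>J. slim X J"
  proof (rule Cauchy_sa_increasing)
    show "quad_form ((X n - X m) * (X n - X m)) x \<le> quad_form (X n * X n) x - quad_form (X m * X m) x" if "m \<le> n" for m n x
      using ext_diff[OF P P chain[OF that]] by simp
  qed (use sX norm_psym[OF P] in auto)
  then obtain J where J: "slim X J" by blast
  have JM: "J \<in> M" by (rule slim_M[OF _ J]) (rule sX)
  have sJ: "star J = J" by (rule slim_star_self[OF J sX(1)])
  have "slim (\<lambda>n. X n * X n * X n) (J * J * J)"
  proof (rule slim_mult[OF slim_mult[OF J J] J])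
    show "norm (X n) \<le> 1" for n by (rule norm_psym[OF P])
    show "norm (X n * X n) \<le> 1 * 1" for n
      using norm_psym[OF P] by (intro order.trans[OF norm_mult_ineq] mult_mono) auto
  qed
  moreover have "X n * X n * X n = X n" for n
    using P by (simp add: psym_def)
  ultimately have "J = J * J * J"
    using slim_unique[OF J, of "J * J * J"] by simp
  then have PJ: "psym J"
    using sJ JM unfolding psym_def by metis
  have JG: "J \<in> G"
    using closed[OF X(1) PJ J] .
  have XJ: "ext (X m) J" for m
  proof -
    have "slim (\<lambda>n. X (n + m) * (X m * X m)) (J * (X m * X m))"
      by (rule slim_mult_right[OF slim_shift[OF J]])
    moreover have "X (n + m) * (X m * X m) = X m" for n
      using chain[of m "n + m"] by (simp add: ext_def mult.assoc)
    ultimately have "slim (\<lambda>n. X m) (J * (X m * X m))"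
      by simp
    then show ?thesis
      using slim_unique[OF _ slim_const] by (simp add: ext_def mult.assoc)
  qed
  have "k = J" if k: "k \<in> G" "ext J k" for k
  proof -
    have Pk: "psym k" using G k by blast
    then have kM: "k \<in> M" "star k = k" by (auto simp: psym_def)
    have "tr (k * k) \<le> tr (J * J) + 1 / Suc n" for n
    proof -
      have "tr (k * k) \<le> tr (X (Suc n) * X (Suc n)) + 1 / Suc n"
        using X(3) k ext_trans[OF P PJ Pk XJ k(2)] by blast
      moreover have "0 \<le> tr ((J - X (Suc n)) * (J - X (Suc n)))"
        using JM sJ sX by (intro tr_square_nonneg) auto
      ultimately show ?thesis
        unfolding ext_diff[OF P PJ XJ] using JM sX by (simp add: tr_simps)
    qed
    moreover have "(\<lambda>n. tr (J * J) + 1 / Suc n) \<longlonglongrightarrow> tr (J * J) + 0"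
      by (intro tendsto_intros LIMSEQ_Suc lim_1_over_n)
    ultimately have "tr (k * k) \<le> tr (J * J)"
      by (intro LIMSEQ_le_const) auto
    moreover have "tr ((k - J) * (k - J)) = tr (k * k) - tr (J * J)"
      unfolding ext_diff[OF PJ Pk k(2)] using JM kM by (simp add: tr_simps)
    moreover have "0 \<le> tr ((k - J) * (k - J))"
      using JM sJ kM by (intro tr_square_nonneg) auto
    ultimately have "k - J = 0"
      using JM sJ kM by (intro tr_square_eq_0) auto
    then show ?thesis by simp
  qed
  with JG show ?thesis by blast
qed

text \<open>The elements \<open>x\<close> with \<open>x * m * b = 0\<close> for all \<open>m\<close>
  form a two-sided ideal. A maximal projection \<open>E\<close> in it is a left unit of the ideal,
  hence central, hence 0 or 1. In the first case the ideal vanishes and with it \<open>a\<close>, in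
  the second \<open>b = 0\<close>.\<close>

lemma prime:
  assumes a: "a \<in> M" and b: "b \<in> M" and ab: "\<And>m. m \<in> M \<Longrightarrow> a * m * b = 0"
  shows "a = 0 \<or> b = 0"
proof -
  define I where "I = {x \<in> M. \<forall>m\<in>M. x * m * b = 0}"
  define G where "G = {j. psym j \<and> j * j = j \<and> j \<in> I}"
  have "\<exists>j\<in>G. \<forall>k\<in>G. ext j k \<longrightarrow> k = j"
  proof (rule exhaustion)
    show "0 \<in> G" by (simp add: G_def I_def psym_def)
    fix X J assume X: "\<And>n. X n \<in> G" and J: "psym J" "slim X J"
    have "J * J = J"
    proof -
      have "slim (\<lambda>n. X n * X n) (J * J)"
        by (rule slim_mult[OF J(2,2)]) (use X norm_psym in \<open>auto simp: G_def\<close>)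
      moreover have "X n * X n = X n" for n using X by (simp add: G_def)
      ultimately show ?thesis using J(2) slim_unique by simp
    qed
    moreover have "J * m * b = 0" if "m \<in> M" for m
    proof -
      have "slim (\<lambda>n. X n * (m * b)) (J * (m * b))"
        by (rule slim_mult_right[OF J(2)])
      moreover have "X n * (m * b) = 0" for n
        using X[of n] that by (simp add: G_def I_def mult.assoc)
      ultimately have "slim (\<lambda>n. 0) (J * (m * b))"
        by simp
      then show ?thesis
        using slim_unique[OF _ slim_const] by (simp add: mult.assoc)
    qed
    ultimately show "J \<in> G"
      using J by (auto simp: G_def I_def psym_def)
  qed (simp add: G_def)
  then obtain E where "E \<in> G" and maxE: "\<And>k. k \<in> G \<Longrightarrow> ext E k \<Longrightarrow> k = E"
    by blast
  then have E: "E \<in> M" "star E = E" "E * E = E" "E \<in> I"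
    by (auto simp: G_def psym_def)
  \<comment> \<open>If \<open>(1 - E) * x\<close> were nonzero, the support of
    \<open>(1 - E) x x* (1 - E)\<close> would be a projection in the ideal orthogonal to
    \<open>E\<close>, and \<open>E\<close> could be enlarged.\<close>
  have IE: "E * x = x" if x: "x \<in> I" for x
  proof -
    have xM: "x \<in> M" using x by (simp add: I_def)
    define y where "y = star x * (1 - E)"
    define D where "D = star y * y"
    have yM: "y \<in> M" using xM E by (auto simp: y_def)
    have D: "D \<in> M" "star D = D" using yM by (auto simp: D_def)
    have Deq: "D = (1 - E) * (x * (star x * (1 - E)))"
      by (simp add: D_def y_def E mult.assoc)
    have DE: "D * E = 0" "E * D = 0"
      unfolding Deq by (simp_all add: mult.assoc left_diff_distrib right_diff_distrib E(3) mult_left_assoc[OF E(3)])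
    obtain J where J: "J \<in> M" "star J = J" "J * J * D = D" "J * J * J = J"
      and JB: "\<And>B. B * D = 0 \<Longrightarrow> B * J = 0" "\<And>B. D * B = 0 \<Longrightarrow> J * B = 0"
      using sign_M[OF D] by metis
    define F where "F = J * J"
    have EF: "E * F = 0" "F * E = 0"
      unfolding F_def using JB(1)[OF DE(2)] JB(2)[OF DE(1)] by (simp_all add: mult_left_assoc[OF JB(1)[OF DE(2)]] mult.assoc)
    have FF: "F * F = F" "star F = F" "F \<in> M"
      using J by (auto simp: F_def mult_left_assoc[OF J(4)] simp flip: mult.assoc)
    have "F * m * b = 0" if "m \<in> M" for m
    proof -
      have "D * (m * b) = 0"
      proof -
        have "D * (m * b) = (1 - E) * (x * (star x * (1 - E) * m) * b)"
          by (simp add: Deq mult.assoc)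
        also have "x * (star x * (1 - E) * m) * b = 0"
          using x that xM E unfolding I_def by blast
        finally show ?thesis by simp
      qed
      then have "J * (m * b) = 0" by (rule JB(2))
      then show ?thesis by (simp add: F_def mult.assoc)
    qed
    then have "E + F \<in> G"
      using E FF EF unfolding G_def I_def psym_def by (simp add: distrib_left distrib_right)
    moreover have "ext E (E + F)"
      using E EF by (simp add: ext_def distrib_right)
    ultimately have "E + F = E" by (rule maxE)
    then have "D = 0" using J(3) by (simp add: F_def)
    then have "y = 0" using tr_faithful[OF yM] by (simp add: D_def)
    then have "star y = 0" by simp
    then show ?thesis by (simp add: y_def E left_diff_distrib)
  qed
  \<comment> \<open>As \<open>m * E\<close> lies in the ideal, \<open>E\<close> is a left unit for
    it; the adjoint of the same identity for \<open>star m\<close> gives the other order.\<close>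
  have "E * m = m * E" if m: "m \<in> M" for m
  proof -
    have 1: "E * (m * E) = m * E" if "m \<in> M" for m
    proof (rule IE)
      show "m * E \<in> I"
        using E that unfolding I_def by (auto simp: mult.assoc)
    qed
    have "star (E * (star m * E)) = star (star m * E)"
      using 1[of "star m"] m by simp
    then show ?thesis
      using 1[OF m] by (simp add: E mult.assoc)
  qed
  then obtain c where c: "E = cscale c 1"
    using center[OF E(1)] by blast
  have "a \<in> I" using a ab by (simp add: I_def)
  show ?thesis
  proof (cases "c = 0")
    case True
    then show ?thesis using IE[OF \<open>a \<in> I\<close>] c by simp
  next
    case False
    have "cscale (inverse c) (E * E) = cscale (inverse c) E"
      using E(3) by simp
    moreover have "inverse c * (c * c) = c"
      using False by simp
    ultimately have "E = 1" using False by (simp add: c)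
    then have "1 * 1 * b = 0"
      using E(4) unfolding I_def by blast
    then show ?thesis by simp
  qed
qed

text \<open>Take a maximal partial symmetry that exchanges parts of \<open>e\<close> and
  \<open>f\<close>. If remainders were left over, primeness would connect them by a nonzero element,
  whose sign would extend the maximal one.\<close>

lemma compare:
  assumes e: "e \<in> M" "star e = e" "e * e = e" and f: "f \<in> M" "star f = f" "f * f = f"
    and ef: "e * f = 0" and tr: "tr e = tr f"
  shows "\<exists>j\<in>M. star j = j \<and> j * j = e + f \<and> j * e = f * j"
proof -
  have fe: "f * e = 0"
    using arg_cong[OF ef, of star] by (simp add: e f)
  define G where "G = {j. psym j \<and> j * e = f * j \<and> j * (e + f) = j}"
  have "\<exists>j\<in>G. \<forall>k\<in>G. ext j k \<longrightarrow> k = j"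
  proof (rule exhaustion)
    show "0 \<in> G" by (simp add: G_def psym_def)
    fix X J assume X: "\<And>n. X n \<in> G" and J: "psym J" "slim X J"
    have "J * e = f * J"
      using slim_unique[OF slim_mult_right[OF J(2), of e], of "f * J"] slim_mult_left[OF J(2), of f] X
      by (simp add: G_def)
    moreover have "J * (e + f) = J"
      using slim_unique[OF slim_mult_right[OF J(2), of "e + f"], of J] J(2) X
      by (simp add: G_def)
    ultimately show "J \<in> G" using J by (simp add: G_def)
  qed (simp add: G_def)
  then obtain j where "j \<in> G" and maxj: "\<And>k. k \<in> G \<Longrightarrow> ext j k \<Longrightarrow> k = j"
    by blast
  then have j: "j \<in> M" "star j = j" "j * j * j = j" "j * e = f * j" "j * (e + f) = j" and Pj: "psym j"
    by (auto simp: G_def psym_def)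
  have j': "e * j = j * f" "(e + f) * j = j"
    using arg_cong[OF j(4), of star] arg_cong[OF j(5), of star]
    by (simp_all only: star_simps e(2) f(2) j(2))
  have jj: "j * (j * j) = j" using j(3) by (simp add: mult.assoc)
  note rw = mult.assoc e(3) f(3) ef fe jj j'(1) j(4)[symmetric]
    e(3)[THEN mult_left_assoc] f(3)[THEN mult_left_assoc] ef[THEN mult_left_assoc] fe[THEN mult_left_assoc]
    jj[THEN mult_left_assoc, unfolded mult.assoc] j'(1)[THEN mult_left_assoc, unfolded mult.assoc] j(4)[symmetric, THEN mult_left_assoc, unfolded mult.assoc]
  \<comment> \<open>These are the parts of \<open>e\<close> and \<open>f\<close> that
    \<open>j\<close> does not reach. Their traces agree, so one vanishes only together with the
    other.\<close>
  define e' where "e' = e - j * (j * e)"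
  define f' where "f' = f - j * (j * f)"
  have M': "e' \<in> M" "f' \<in> M" using e f j by (auto simp: e'_def f'_def)
  have e': "star e' = e'" "e' * e' = e'" "e * e' = e'" "e' * e = e'" "f * e' = 0" "e' * f = 0" "e' * j = 0"
    by (simp_all add: e'_def e(2) j(2) left_diff_distrib right_diff_distrib rw)
  have f': "star f' = f'" "f' * f' = f'" "f * f' = f'" "f' * f = f'" "e * f' = 0" "f' * e = 0" "f' * j = 0"
    by (simp_all add: f'_def f(2) j(2) left_diff_distrib right_diff_distrib rw)
  have tr': "tr e' = tr f'"
  proof -
    have "tr (j * (j * e)) = tr (j * f * j)"
      using j(4) j'(1) by (simp add: mult.assoc)
    also have "\<dots> = tr (j * (j * f))"
      using tr_commute[of "j * f" j] j f by simp
    finally show ?thesis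
      using e f j tr by (simp add: e'_def f'_def tr_simps)
  qed
  show ?thesis
  proof (cases "e' = 0 \<or> f' = 0")
    case True
    have "e' = 0" "f' = 0"
      using True tr' tr_square_eq_0[of e'] tr_square_eq_0[of f'] e' f' M' by auto
    then have "j * (j * (e + f)) = e + f"
      by (simp add: e'_def f'_def distrib_left)
    then show ?thesis using j by auto
  next
    case False
    then obtain m where m: "m \<in> M" and nz: "f' * m * e' \<noteq> 0"
      using prime[of f' e'] M' by blast
    define x where "x = f' * m * e'"
    define D where "D = x + star x"
    have xM: "x \<in> M" using m M' by (auto simp: x_def)
    have D: "D \<in> M" "star D = D" using xM by (auto simp: D_def)
    have sx: "star x = e' * (star m * f')" by (simp add: x_def e' f' mult.assoc)
    have x: "x * e = x" "e * x = 0" "f * x = x" "x * f = 0" "star x * e = 0" "e * star x = star x"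
      "f * star x = 0" "star x * f = star x" "x * j = 0" "star x * j = 0"
      unfolding sx by (simp_all add: x_def mult.assoc e' f' e'(2-7)[THEN mult_left_assoc] f'(2-7)[THEN mult_left_assoc])
    obtain k where k: "k \<in> M" "star k = k" "k * k * D = D" "k * k * k = k"
      and k1: "\<And>X. X * D = - (D * X) \<Longrightarrow> X * k = - (k * X)"
      and k2: "\<And>B. B * D = 0 \<Longrightarrow> B * k = 0" "\<And>B. D * B = 0 \<Longrightarrow> k * B = 0"
      using sign_M[OF D] by metis
    \<comment> \<open>\<open>D\<close> anticommutes with \<open>e - f\<close> and lives under
      \<open>e + f\<close>. Its sign inherits both properties, and together they say that
      \<open>k\<close> exchanges \<open>e\<close> and \<open>f\<close>.\<close>
    have "(e - f) * k = - (k * (e - f))"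
      by (rule k1) (simp add: D_def distrib_left distrib_right left_diff_distrib right_diff_distrib x)
    moreover have "(1 - (e + f)) * k = 0" "k * (1 - (e + f)) = 0"
      by (rule k2; simp add: D_def distrib_left distrib_right left_diff_distrib right_diff_distrib x)+
    ultimately have kk: "e * k - f * k = k * f - k * e" "e * k + f * k = k" "k * e + k * f = k"
      by (simp_all add: distrib_left distrib_right left_diff_distrib right_diff_distrib)
    then have "e * k = k - f * k" "k * f = k - k * e"
      by (simp_all add: eq_diff_eq add.commute)
    with kk(1) have "k * e + k * e = f * k + f * k"
      by (simp add: algebra_simps)
    then have ke: "k * e = f * k"
      unfolding cscale_two by simp
    have "k * j = 0"
      by (rule k2) (simp add: D_def distrib_right x)
    moreover from arg_cong[OF this, of star] have "j * k = 0"
      by (simp add: j k)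
    ultimately have kj: "k * j = 0" "j * k = 0" "k * (j * y) = 0" "j * (k * y) = 0" for y
      by (simp_all add: mult_left_assoc[of k j] mult_left_assoc[of j k])
    have "k * (k * k) = k" using k(4) by (simp add: mult.assoc)
    then have "j + k \<in> G"
    proof -
      have "(j + k) * (e + f) = j + k"
        unfolding distrib_right[of j k "e + f"] j(5) using kk(3) by (simp add: distrib_left)
      then show ?thesis
        unfolding G_def psym_def using j(1,2,4) k(1,2) ke kj jj \<open>k * (k * k) = k\<close>
        by (simp add: distrib_left[of f] distrib_right[of _ _ e] distrib_left[of "_ * _"] distrib_left[of j] distrib_left[of k]
            distrib_right[of j k] mult.assoc)
    qed
    moreover have "ext j (j + k)"
      using kj jj by (simp add: ext_def distrib_right mult.assoc)
    ultimately have "j + k = j" by (rule maxj)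
    then have "x + star x = 0" using k(3) by (simp add: D_def)
    then have "f * (x + star x) = 0" by simp
    then have "x = 0" by (simp add: x distrib_left)
    then show ?thesis using nz by (simp add: x_def)
  qed
qed

section \<open>Symmetries of trace zero\<close>

definition S0 :: "'h cop set" where
  "S0 = {U \<in> M. star U = U \<and> U * U = 1 \<and> tr U = 0}"

lemma S0D: "U \<in> S0 \<Longrightarrow> U \<in> M" "U \<in> S0 \<Longrightarrow> star U = U" "U \<in> S0 \<Longrightarrow> U * U = 1" "U \<in> S0 \<Longrightarrow> tr U = 0"
  "U \<in> S0 \<Longrightarrow> U * (U * A) = A"
  by (auto simp: S0_def simp flip: mult.assoc)

text \<open>Conjugation by \<open>Z\<close> preserves the trace and sends \<open>U\<close> to
  \<open>- U\<close>, so the trace of \<open>U\<close> is its own negative.\<close>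

lemma S0_I:
  assumes "U \<in> M" "star U = U" "U * U = 1" "Z \<in> M" "Z * Z = 1" "U * Z = - (Z * U)"
  shows "U \<in> S0"
proof -
  have "tr U = tr (U * Z * Z)"
    by (simp add: mult.assoc assms(5))
  also have "\<dots> = tr (Z * (U * Z))"
    using assms by (intro tr_commute) auto
  also have "\<dots> = tr (- U)"
    by (simp add: assms(6)) (simp add: assms(5) flip: mult.assoc)
  finally show ?thesis using assms by (simp add: S0_def tr_minus)
qed

text \<open>\<open>Z\<close> is the sign of \<open>\<i>[U, W]\<close> where that commutator lives; on the complement \<open>U\<close> and \<open>W\<close> commute,
  and comparison of projections exchanges their joint eigenspaces.\<close>

lemma common_anticommuting:
  assumes U: "U \<in> S0" and W: "W \<in> S0"
  shows "\<exists>Z\<in>S0. Z * U = - (U * Z) \<and> Z * W = - (W * Z)"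
proof -
  note UW = S0D[OF U] S0D[OF W]
  define D where "D = cscale \<i> (U * W - W * U)"
  have D: "D \<in> M" "star D = D"
    using UW by (auto simp: D_def cscale_uminus cscale_diff)
  have UD: "U * D = - (D * U)" "W * D = - (D * W)"
    using UW by (simp_all add: D_def cscale_diff left_diff_distrib right_diff_distrib mult.assoc)
  obtain J where J: "J \<in> M" "star J = J" "J * J * D = D" "J * J * J = J"
    and anti: "\<And>X. X * D = - (D * X) \<Longrightarrow> X * J = - (J * X)"
    using sign_M[OF D] by metis
  have UJ: "U * J = - (J * U)" "W * J = - (J * W)"
    by (rule anti[OF UD(1)] anti[OF UD(2)])+
  have UJ': "U * (J * A) = - (J * (U * A))" "W * (J * A) = - (J * (W * A))" for A
    using arg_cong[OF UJ(1), of "\<lambda>Z. Z * A"] arg_cong[OF UJ(2), of "\<lambda>Z. Z * A"] by (simp_all add: mult.assoc)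
  have JJ: "J * (J * J) = J" "J * (J * (J * A)) = J * A" for A
    using J(4) by (simp_all add: mult.assoc) (metis J(4) mult.assoc)
  \<comment> \<open>The complement of the support of the commutator; \<open>F\<close> commutes with
    \<open>U\<close> and \<open>W\<close>, and under \<open>F\<close> these commute with each
    other.\<close>
  define F where "F = 1 - J * J"
  have F: "F \<in> M" "star F = F" "F * F = F" "F * J = 0" "J * F = 0"
    using J by (auto simp: F_def left_diff_distrib right_diff_distrib mult.assoc JJ)
  have FU: "U * F = F * U" "W * F = F * W" "U * (F * A) = F * (U * A)" "W * (F * A) = F * (W * A)" for A
    by (simp_all add: F_def left_diff_distrib right_diff_distrib mult.assoc UJ UJ')
  have FD: "F * D = 0"
    using J(3) by (simp add: F_def left_diff_distrib)
  have "cscale (- \<i>) (F * D) = F * (U * W) - F * (W * U)"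
    by (simp add: D_def cscale_diff right_diff_distrib)
  then have FUW: "F * (W * U) = F * (U * W)"
    by (simp add: FD)
  have FUW': "F * (W * (U * A)) = F * (U * (W * A))" for A
    using arg_cong[OF FUW, of "\<lambda>Z. Z * A"] by (simp add: mult.assoc)
  \<comment> \<open>Moving one \<open>J\<close> around the trace and the other through
    \<open>X\<close> gives opposite signs, so \<open>J * J * X\<close> has trace 0; \<open>X\<close>
    has trace 0 as well.\<close>
  have trF: "tr (F * X) = 0" if "X \<in> S0" "X * J = - (J * X)" for X
  proof -
    have "tr (J * J * X) = - tr (J * X * J)"
      using that J S0D[OF that(1)] tr_minus[of "J * (J * X)"] by (simp add: mult.assoc)
    also have "tr (J * X * J) = tr (J * (J * X))"
      using J S0D[OF that(1)] by (intro tr_commute) auto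
    finally have "tr (J * J * X) = 0" by (simp add: mult.assoc)
    then show ?thesis
      using S0D[OF that(1)] J by (simp add: F_def left_diff_distrib tr_simps)
  qed
  \<comment> \<open>For signs \<open>s\<close> and \<open>t\<close> this is the joint
    eigenprojection under \<open>F\<close> with \<open>U = s\<close> and
    \<open>W = t\<close>.\<close>
  define p where "p s t = (1/4) *\<^sub>R (F * ((1 + s *\<^sub>R U) * (1 + t *\<^sub>R W)))" for s t :: real
  have pM: "p s t \<in> M" for s t
    using F UW by (auto simp: p_def)
  have pe: "p s t = (1/4) *\<^sub>R F + (s/4) *\<^sub>R (F * U) + (t/4) *\<^sub>R (F * W) + (s*t/4) *\<^sub>R (F * (U * W))" for s t
    by (simp add: p_def distrib_left distrib_right scaleR_add_right)
  have sp: "star (p s t) = p s t" for s t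
    by (simp add: pe F UW FU mult.assoc FUW)
  have FF: "F * (F * A) = F * A" for A
    using F(3) by (rule mult_left_assoc)
  have FUWU: "F * (U * (W * U)) = F * W"
  proof -
    have "F * (U * (W * U)) = U * (F * (W * U))" by (simp add: FU)
    also have "\<dots> = F * W" unfolding FUW by (simp add: FU UW)
    finally show ?thesis .
  qed
  note FR = FUWU FU FUW FUW' F FF UW mult.assoc
  have UP: "U * p s t = s *\<^sub>R p s t" "p s t * U = s *\<^sub>R p s t" if "s * s = 1" for s t
  proof -
    have "s * (s * t) = t" using that by (simp flip: mult.assoc)
    then show "U * p s t = s *\<^sub>R p s t" "p s t * U = s *\<^sub>R p s t"
      using that by (simp_all add: pe FR distrib_left distrib_right scaleR_add_right)
  qed
  have WP: "W * p s t = t *\<^sub>R p s t" "p s t * W = t *\<^sub>R p s t" if "t * t = 1" for s t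
  proof -
    have "t * (s * t) = s" using that by (simp add: mult.left_commute)
    then show "W * p s t = t *\<^sub>R p s t" "p s t * W = t *\<^sub>R p s t"
      using that by (simp_all only: pe FR distrib_left distrib_right scaleR_add_right mult_scaleR_left mult_scaleR_right
          scaleR_scaleR times_divide_eq_right mult.commute[of t s] mult_1_right)
        (simp_all add: algebra_simps)
  qed
  have pp: "p s t * p s t = p s t" if "s * s = 1" "t * t = 1" for s t
  proof -
    have Fp: "F * p s t = p s t"
      by (simp add: pe FR distrib_left)
    have "p s t * p s t = (1/4) *\<^sub>R (F * (p s t + s *\<^sub>R (U * p s t) + t *\<^sub>R (W * p s t) + (s * t) *\<^sub>R (U * (W * p s t))))"
      by (subst (1) pe) (simp add: distrib_left distrib_right scaleR_add_right mult.assoc)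
    also have "\<dots> = F * p s t"
    proof -
      have four: "A + A + A + A = 4 *\<^sub>R A" for A :: "'h cop"
        using scaleR_add_left[of 2 2 A] by (simp add: scaleR_2 add.assoc)
      have "s * (t * (s * t)) = 1" using that by (simp add: mult_ac)
      then show ?thesis
        using that by (simp add: UP(1) WP(1) mult_ac four)
    qed
    finally show ?thesis using Fp by simp
  qed
  have p0: "p s t * p s' t' = 0" if "s * s = 1" "t * t = 1" "s' * s' = 1" "t' * t' = 1" "s' = - s \<or> t' = - t" for s t s' t'
  proof -
    have "s *\<^sub>R (p s t * p s' t') = s' *\<^sub>R (p s t * p s' t')"
      using arg_cong[OF UP(2)[OF that(1), of t], of "\<lambda>A. A * p s' t'"] UP(1)[OF that(3), of t']
      by (auto simp: mult.assoc)
    moreover have "t *\<^sub>R (p s t * p s' t') = t' *\<^sub>R (p s t * p s' t')"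
      using arg_cong[OF WP(2)[OF that(2), of s], of "\<lambda>A. A * p s' t'"] WP(1)[OF that(4), of s']
      by (auto simp: mult.assoc)
    moreover have "s \<noteq> 0" "t \<noteq> 0" using that by auto
    ultimately show ?thesis using that(5) by auto
  qed
  \<comment> \<open>The linear terms vanish by \<open>trF\<close>, so the trace depends on
    \<open>s * t\<close> only. Opposite eigenprojections therefore have equal trace and can be
    exchanged.\<close>
  have ptr: "tr (p s t) = tr F / 4 + s * t / 4 * tr (F * (U * W))" for s t
    using F UW trF[OF U] trF[OF W] UJ by (simp add: pe tr_simps)
  have ex: "\<exists>j\<in>M. star j = j \<and> j * j = p s t + p (- s) (- t) \<and> j * p s t = p (- s) (- t) * j"
    if "s * s = 1" "t * t = 1" for s t
    using that pM sp pp p0 by (intro compare) (auto simp: ptr)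
  obtain j where j: "j \<in> M" "star j = j" "j * j = p 1 1 + p (-1) (-1)" "j * p 1 1 = p (-1) (-1) * j"
    using ex[of 1 1] by auto
  obtain k where k: "k \<in> M" "star k = k" "k * k = p 1 (-1) + p (-1) 1" "k * p 1 (-1) = p (-1) 1 * k"
    using ex[of 1 "-1"] by auto
  define P Q where "P = p 1 1 + p (-1) (-1)" and "Q = p 1 (-1) + p (-1) 1"
  have PQ: "P \<in> M" "Q \<in> M" "star P = P" "star Q = Q" "P * Q = 0" "Q * P = 0" "P * P = P" "Q * Q = Q" "P + Q = F"
    using pM sp by (auto simp: P_def Q_def distrib_left distrib_right p0 pp) (simp add: pe flip: scaleR_add_left)
  have jP: "P * j = j" "j * P = j" and kQ: "Q * k = k" "k * Q = k"
  proof -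
    \<comment> \<open>A self-adjoint \<open>x\<close> lies under its own square \<open>E\<close>:
      the defect \<open>x - E * x\<close> vanishes by faithfulness.\<close>
    have *: "E * x = x \<and> x * E = x" if "E * E = E" "x * x = E" "star x = x" "star E = E" "x \<in> M" "E \<in> M" for E x
    proof -
      have "star (x - E * x) * (x - E * x) = x * x - x * (E * x)"
        using that(3,4) by (simp add: left_diff_distrib right_diff_distrib mult.assoc mult_left_assoc[OF that(1)])
      also have "x * (E * x) = (x * x) * (x * x)"
        using that(2) by (simp add: mult.assoc flip: that(2))
      finally have "star (x - E * x) * (x - E * x) = 0"
        using that(1,2) by simp
      then have "x - E * x = 0"
        using tr_faithful[of "x - E * x"] that by auto
      then have 1: "E * x = x" by simp
      have "star (E * x) = x * E" using that by simp
      with 1 show ?thesis using that(3) by simp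
    qed
    show "P * j = j" "j * P = j" "Q * k = k" "k * Q = k"
      using *[OF PQ(7), of j] *[OF PQ(8), of k] j k PQ by (auto simp: P_def Q_def)
  qed
  have Uj: "U * j = - (j * U)" "W * j = - (j * W)"
  proof -
    have a: "j * p (-1) (-1) = p 1 1 * j"
      using arg_cong[OF j(4), of star] by (simp only: star_simps j(2) sp)
    have "U * P = p 1 1 - p (-1) (-1)" "P * U = p 1 1 - p (-1) (-1)" "W * P = p 1 1 - p (-1) (-1)" "P * W = p 1 1 - p (-1) (-1)"
      by (simp_all add: P_def distrib_left distrib_right UP WP)
    note * = this
    have "U * j = U * P * j" "j * U = j * (P * U)" "W * j = W * P * j" "j * W = j * (P * W)"
      using jP by (simp_all add: mult.assoc flip: mult.assoc[of j])
    then show "U * j = - (j * U)" "W * j = - (j * W)"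
      unfolding * by (simp_all add: left_diff_distrib right_diff_distrib a j(4))
  qed
  have Uk: "U * k = - (k * U)" "W * k = - (k * W)"
  proof -
    have a: "k * p (-1) 1 = p 1 (-1) * k"
      using arg_cong[OF k(4), of star] by (simp only: star_simps k(2) sp)
    have "U * Q = p 1 (-1) - p (-1) 1" "Q * U = p 1 (-1) - p (-1) 1" "W * Q = p (-1) 1 - p 1 (-1)" "Q * W = p (-1) 1 - p 1 (-1)"
      by (simp_all add: Q_def distrib_left distrib_right UP WP)
    note * = this
    have "U * k = U * Q * k" "k * U = k * (Q * U)" "W * k = W * Q * k" "k * W = k * (Q * W)"
      using kQ by (simp_all add: mult.assoc flip: mult.assoc[of k])
    then show "U * k = - (k * U)" "W * k = - (k * W)"
      unfolding * by (simp_all add: left_diff_distrib right_diff_distrib a k(4))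
  qed
  have FP: "F * P = P" "F * Q = Q"
    using PQ by (auto simp: PQ(9)[symmetric] distrib_right)
  have orth: "J * j = 0" "j * J = 0" "J * k = 0" "k * J = 0" "j * k = 0" "k * j = 0"
  proof -
    have "J * j = J * (F * P * j)" using FP jP by simp
    then show 1: "J * j = 0" using F(5) by (simp flip: mult.assoc)
    have "J * k = J * (F * Q * k)" using FP kQ by simp
    then show 2: "J * k = 0" using F(5) by (simp flip: mult.assoc)
    have "j * k = (j * P) * (Q * k)" using jP kQ by simp
    also have "\<dots> = j * (P * Q) * k" by (simp only: mult.assoc)
    finally show 3: "j * k = 0" by (simp add: PQ)
    show "j * J = 0" "k * J = 0" "k * j = 0"
      using arg_cong[OF 1, of star] arg_cong[OF 2, of star] arg_cong[OF 3, of star] j(2) k(2) J(2) by simp_all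
  qed
  \<comment> \<open>The three summands have orthogonal supports \<open>J * J\<close>,
    \<open>P\<close> and \<open>Q\<close>, which add up to 1, and each anticommutes with
    \<open>U\<close> and \<open>W\<close>.\<close>
  define Z where "Z = J + j + k"
  have Z: "Z \<in> M" "star Z = Z" using J j k by (auto simp: Z_def)
  have "Z * Z = J * J + j * j + k * k"
    by (simp add: Z_def distrib_left distrib_right orth)
  also have "\<dots> = J * J + (P + Q)"
    using j(3) k(3) by (simp add: P_def Q_def)
  finally have ZZ: "Z * Z = 1"
    unfolding PQ(9) by (simp add: F_def)
  have ZU: "Z * U = - (U * Z)" "Z * W = - (W * Z)"
    by (simp_all add: Z_def distrib_left distrib_right UJ Uj Uk)
  have "Z \<in> S0"
    by (rule S0_I[OF Z ZZ, of U]) (use UW ZU in auto)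
  with ZU show ?thesis by blast
qed

end

section \<open>Elements that anticommute with a symmetry, and the symmetries that span them\<close>

context factor
begin

definition AC :: "'h cop \<Rightarrow> 'h cop set" where
  "AC Z = {x \<in> M. star x = x \<and> x * Z = - (Z * x)}"

definition N0 :: "'h cop \<Rightarrow> 'h cop \<Rightarrow> 'h cop set" where
  "N0 U V = {x \<in> M. x * U = U * x \<and> x * V = V * x}"

lemma norm_S0: "U \<in> S0 \<Longrightarrow> norm U \<le> 1"
  by (rule norm_psym) (simp add: psym_def S0_def)

text \<open>The square root of \<open>1 - x * x\<close>, which completes \<open>x\<close> to a point
  of a circle. The norm bound, from \<open>1 - s \<le> sqrt (1 - s)\<close> on
  \<open>[0, 1]\<close>, is quadratic in \<open>x\<close>; this order of smallness drives the limit
  in \<open>frame_map_square\<close>.\<close>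

lemma sqrt_complement:
  assumes x: "x \<in> M" "star x = x" "norm x \<le> 1"
  shows "\<exists>c\<in>M. star c = c \<and> c * c = 1 - x * x \<and> norm (c - 1) \<le> (norm x)\<^sup>2
    \<and> (\<forall>y. y * (x * x) = x * x * y \<longrightarrow> y * c = c * y)"
proof -
  define T where "T = x * x"
  define g where "g s = sqrt (max 0 (1 - s))" for s :: real
  define c where "c = cfc g T"
  have T: "T \<in> M" "star T = T" using x by (auto simp: T_def)
  have g: "continuous_on UNIV g"
    unfolding g_def by (intro continuous_intros)
  have nT: "norm T \<le> (norm x)\<^sup>2"
    unfolding T_def power2_eq_square by (rule norm_mult_ineq)
  also have "\<dots> \<le> 1" using x(3) by (simp add: power_le_one)
  finally have spec: "0 \<le> s" "s \<le> 1" "s \<le> (norm x)\<^sup>2" if "s \<in> rspec T" for s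
    using rspec_square[OF x(2)] rspec_norm[OF that] that nT unfolding T_def by (auto simp: abs_le_iff)
  have "c * c = cfc (\<lambda>s. 1 - s) T"
    unfolding c_def cfc_mult[OF T(2) g g, symmetric]
    by (rule cfc_cong[OF T(2)]) (use spec g in \<open>auto simp: g_def intro!: continuous_intros\<close>)
  also have "\<dots> = 1 - T"
    by (simp add: cfc_diff[OF T(2)] cfc_const[OF T(2)] cfc_id[OF T(2)] continuous_intros)
  finally have cc: "c * c = 1 - T" .
  have "c - 1 = cfc (\<lambda>s. g s - 1) T"
    by (simp add: c_def cfc_diff[OF T(2)] cfc_const[OF T(2)] g)
  also have "norm \<dots> \<le> (norm x)\<^sup>2"
  proof (rule cfc_norm_le[OF T(2)])
    fix s assume s: "s \<in> rspec T"
    have "1 - s \<le> sqrt (1 - s)"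
      using spec[OF s] by (intro real_le_rsqrt) (simp add: power2_eq_square mult_left_le_one_le)
    moreover have "sqrt (1 - s) \<le> 1"
      using spec[OF s] by simp
    ultimately show "\<bar>g s - 1\<bar> \<le> (norm x)\<^sup>2"
      using spec[OF s] by (simp add: g_def)
  qed (auto intro!: continuous_intros g)
  finally have 1: "norm (c - 1) \<le> (norm x)\<^sup>2" .
  have 2: "y * c = c * y" if "y * T = T * y" for y
    unfolding c_def by (rule cfc_commute[OF T(2) g that])
  have 3: "star c = c" "c \<in> M"
    unfolding c_def by (rule star_cfc[OF T(2) g] cfc_M[OF T g])+
  show ?thesis
    using 1 2 3 cc unfolding T_def by blast
qed

abbreviation SV :: "'h cop set" where "SV \<equiv> span S0"

lemma span_M: "x \<in> SV \<Longrightarrow> x \<in> M \<and> star x = x"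
  by (induction rule: span_induct_alt) (auto dest: S0D)

lemma span_AC: "x \<in> span (S0 \<inter> AC Z) \<Longrightarrow> Z \<in> M \<Longrightarrow> x \<in> AC Z"
  by (induction rule: span_induct_alt) (auto simp: AC_def distrib_left distrib_right)

text \<open>Scaled to norm at most 1, \<open>y\<close> is the mean of the symmetries
  \<open>w + c * Y\<close> and \<open>w - c * Y\<close> with \<open>c\<close> the square root of
  \<open>1 - w * w\<close>: \<open>Y\<close> anticommutes with \<open>w\<close> and therefore
  commutes with \<open>c\<close>.\<close>

lemma AC_span_aux:
  assumes Z: "Z \<in> S0" and Y: "Y \<in> S0" "Y * Z = - (Z * Y)" and y: "y \<in> AC Z" "y * Y = - (Y * y)"
  shows "y \<in> span (S0 \<inter> AC Z)"
proof (cases "y = 0")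
  case False
  define t where "t = norm y"
  define w where "w = (1 / t) *\<^sub>R y"
  have t: "t > 0" "norm w \<le> 1" "y = t *\<^sub>R w" using False by (auto simp: t_def w_def)
  have w: "w \<in> M" "star w = w" "w * Z = - (Z * w)" "w * Y = - (Y * w)"
    using y by (auto simp: w_def AC_def)
  note SD = S0D[OF Z] S0D[OF Y(1)]
  obtain c where c: "c \<in> M" "star c = c" "c * c = 1 - w * w"
    and comm: "\<And>y. y * (w * w) = w * w * y \<Longrightarrow> y * c = c * y"
    using sqrt_complement[OF w(1,2) t(2)] by blast
  have wr: "w * Z = - (Z * w)" "w * (Z * A) = - (Z * (w * A))" "w * Y = - (Y * w)" "w * (Y * A) = - (Y * (w * A))" for A
    using w mult_left_assoc[OF w(3)] mult_left_assoc[OF w(4)] by (auto simp: mult.assoc)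
  have cr: "w * c = c * w" "Z * c = c * Z" "Y * c = c * Y"
    by (rule comm; simp add: mult.assoc wr)+
  have cr': "w * (c * A) = c * (w * A)" "Z * (c * A) = c * (Z * A)" "Y * (c * A) = c * (Y * A)" for A
    using cr[THEN mult_left_assoc] by (simp_all add: mult.assoc)
  have cc: "c * (c * A) = A - w * (w * A)" for A
    using mult_left_assoc[OF c(3)] by (simp add: left_diff_distrib mult.assoc)
  have S: "w + e *\<^sub>R (c * Y) \<in> S0 \<inter> AC Z" if "e * e = 1" for e :: real
  proof -
    have 1: "w + e *\<^sub>R (c * Y) \<in> M" "star (w + e *\<^sub>R (c * Y)) = w + e *\<^sub>R (c * Y)"
      using c w SD cr by auto
    define B where "B = e *\<^sub>R (c * Y)"
    have "B * B = 1 - w * w" "w * B = - (B * w)"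
      using that by (simp_all add: B_def mult.assoc cr' SD c(3) cr wr)
    then have 2: "(w + e *\<^sub>R (c * Y)) * (w + e *\<^sub>R (c * Y)) = 1"
      unfolding B_def[symmetric] by (simp add: distrib_left distrib_right)
    have 3: "(w + e *\<^sub>R (c * Y)) * Z = - (Z * (w + e *\<^sub>R (c * Y)))"
      by (simp add: distrib_left distrib_right mult.assoc wr cr cr' Y(2))
    show ?thesis
      using S0_I[OF 1 2 SD(1,3) 3] 1 3 by (simp add: AC_def)
  qed
  have "y = (t / 2) *\<^sub>R ((w + 1 *\<^sub>R (c * Y)) + (w + (-1) *\<^sub>R (c * Y)))"
    using t by (simp add: scaleR_2[symmetric])
  also have "\<dots> \<in> span (S0 \<inter> AC Z)"
    by (intro span_scale span_add span_base S) auto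
  finally show ?thesis .
qed (simp add: span_zero)

text \<open>Conjugation by some \<open>V\<close> anticommuting with \<open>Z\<close> splits
  \<open>x\<close> into two parts. One anticommutes with \<open>V\<close>; the other commutes with
  \<open>V\<close> and therefore anticommutes with \<open>\<i> Z V\<close>. Each part thus has a
  partner for \<open>AC_span_aux\<close>.\<close>

lemma AC_span:
  assumes Z: "Z \<in> S0" and x: "x \<in> AC Z"
  shows "x \<in> span (S0 \<inter> AC Z)"
proof -
  obtain V where V: "V \<in> S0" "V * Z = - (Z * V)"
    using common_anticommuting[OF Z Z] by blast
  note SD = S0D[OF Z] S0D[OF V(1)]
  have xM: "x \<in> M" "star x = x" "x * Z = - (Z * x)" using x by (auto simp: AC_def)
  define Y where "Y = cscale \<i> (Z * V)"
  have r: "V * Z = - (Z * V)" "V * (Z * A) = - (Z * (V * A))" "x * Z = - (Z * x)" "x * (Z * A) = - (Z * (x * A))" for A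
    using V(2) xM(3) mult_left_assoc[OF V(2)] mult_left_assoc[OF xM(3)] by (auto simp: mult.assoc)
  have Y: "Y \<in> M" "star Y = Y" "Y * Y = 1" "Y * Z = - (Z * Y)"
    using SD by (auto simp: Y_def r mult.assoc cscale_uminus)
  have Y0: "Y \<in> S0"
    using S0_I[OF Y(1-3) SD(1,3) Y(4)] .
  define x1 where "x1 = (1/2) *\<^sub>R (x + V * (x * V))"
  define x2 where "x2 = (1/2) *\<^sub>R (x - V * (x * V))"
  have "x1 \<in> span (S0 \<inter> AC Z)"
  proof (rule AC_span_aux[OF Z Y0 Y(4)])
    show "x1 \<in> AC Z"
      using SD xM by (simp add: AC_def x1_def r distrib_left distrib_right mult.assoc scaleR_add_right scaleR_diff_right)
    show "x1 * Y = - (Y * x1)"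
      using SD by (simp add: x1_def Y_def r distrib_left distrib_right mult.assoc cscale_add cscale_diff scaleR_add_right scaleR_diff_right)
  qed
  moreover have "x2 \<in> span (S0 \<inter> AC Z)"
  proof (rule AC_span_aux[OF Z V])
    show "x2 \<in> AC Z"
      using SD xM by (simp add: AC_def x2_def r left_diff_distrib right_diff_distrib mult.assoc scaleR_add_right scaleR_diff_right)
    show "x2 * V = - (V * x2)"
      using SD by (simp add: x2_def r left_diff_distrib right_diff_distrib mult.assoc flip: scaleR_minus_right)
  qed
  moreover have "x = x1 + x2"
    by (simp add: x1_def x2_def scaleR_2[symmetric] flip: scaleR_add_right)
  ultimately show ?thesis by (metis span_add)
qed

lemma AC_SV: "Z \<in> S0 \<Longrightarrow> x \<in> AC Z \<Longrightarrow> x \<in> SV"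
  using AC_span span_mono[of "S0 \<inter> AC Z" S0] by blast

lemma S0_uminus: "U \<in> S0 \<Longrightarrow> - U \<in> S0"
  by (simp add: S0_def tr_minus)

text \<open>The third member of a Pauli triple.\<close>

lemma S0_third:
  assumes U: "U \<in> S0" and V: "V \<in> S0" and UV: "U * V = - (V * U)"
  shows "cscale \<i> (U * V) \<in> S0" "U * cscale \<i> (U * V) = - (cscale \<i> (U * V) * U)"
    "V * cscale \<i> (U * V) = - (cscale \<i> (U * V) * V)"
proof -
  note SD = S0D[OF U] S0D[OF V]
  have VU: "V * U = - (U * V)" using UV by simp
  have r: "V * U = - (U * V)" "V * (U * A) = - (U * (V * A))" for A
    using VU mult_left_assoc[OF VU] by (auto simp: mult.assoc)
  show 1: "U * cscale \<i> (U * V) = - (cscale \<i> (U * V) * U)"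
    "V * cscale \<i> (U * V) = - (cscale \<i> (U * V) * V)"
    using SD by (auto simp: r mult.assoc)
  show "cscale \<i> (U * V) \<in> S0"
  proof (rule S0_I)
    show "cscale \<i> (U * V) * U = - (U * cscale \<i> (U * V))" using 1(1) by simp
  qed (use SD in \<open>auto simp: r mult.assoc cscale_uminus\<close>)
qed

lemma S0_half:
  assumes U: "U \<in> S0" and V: "V \<in> S0" and UV: "U * V = - (V * U)"
  shows "(1 / sqrt 2) *\<^sub>R (U + V) \<in> S0"
proof -
  note SD = S0D[OF U] S0D[OF V]
  have "(U + V) * (U + V) = 2 *\<^sub>R 1"
    using SD UV by (simp add: distrib_left distrib_right scaleR_2)
  then show ?thesis
    using SD by (simp add: S0_def tr_simps)
qed

end

section \<open>Linear extension of a bijection of symmetries that preserves traces of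
  products\<close>

locale sym_iso = factor M tr for M :: "'h::complex_hilbert_space cop set" and tr +
  fixes \<phi> :: "'h cop \<Rightarrow> 'h cop"
  assumes surj: "\<phi> ` S0 = S0"
    and pres: "U \<in> S0 \<Longrightarrow> V \<in> S0 \<Longrightarrow> tr (\<phi> U * \<phi> V) = tr (U * V)"
begin

lemma phi_S0: "U \<in> S0 \<Longrightarrow> \<phi> U \<in> S0"
  using surj by blast

lemma inj: "inj_on \<phi> S0"
proof
  fix U V assume UV: "U \<in> S0" "V \<in> S0" "\<phi> U = \<phi> V"
  note SD = S0D[OF UV(1)] S0D[OF UV(2)]
  have "tr (U * V) = 1" "tr (V * U) = 1"
    using pres[OF UV(1,2)] pres[OF UV(2,1)] UV(3) S0D[OF phi_S0[OF UV(1)]] by auto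
  then have "tr ((U - V) * (U - V)) = 0"
    using SD by (simp add: left_diff_distrib right_diff_distrib tr_simps)
  then have "U - V = 0"
    using SD by (intro tr_square_eq_0) auto
  then show "U = V" by simp
qed

lemma inverse_iso: "sym_iso M tr (inv_into S0 \<phi>)"
proof
  show "inv_into S0 \<phi> ` S0 = S0"
    using inj surj by (metis image_inv_into_cancel inv_into_image_cancel order_refl)
  show "tr (inv_into S0 \<phi> U * inv_into S0 \<phi> V) = tr (U * V)" if "U \<in> S0" "V \<in> S0" for U V
    using pres[of "inv_into S0 \<phi> U" "inv_into S0 \<phi> V"] that surj
      f_inv_into_f[of U \<phi> S0] f_inv_into_f[of V \<phi> S0] inv_into_into[of U \<phi> S0] inv_into_into[of V \<phi> S0]
    by simp
qed

text \<open>Defined by duality with respect to the trace form, so that independence of the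
  representation as a linear combination is automatic. Uniqueness comes from
  \<open>orth_zero\<close>, existence from \<open>L_char\<close>.\<close>

definition L :: "'h cop \<Rightarrow> 'h cop" where
  "L x = (THE y. y \<in> SV \<and> (\<forall>U\<in>S0. tr (y * \<phi> U) = tr (x * U)))"

lemma orth_zero:
  assumes y: "y \<in> SV" and 0: "\<And>U. U \<in> S0 \<Longrightarrow> tr (y * \<phi> U) = 0"
  shows "y = 0"
proof -
  have y': "y \<in> M" "star y = y" using span_M[OF y] by auto
  have W: "tr (y * W) = 0" if "W \<in> S0" for W
  proof -
    have "W \<in> \<phi> ` S0" using that surj by simp
    then show ?thesis using 0 by auto
  qed
  have "tr (y * w) = 0 \<and> w \<in> M" if "w \<in> SV" for w
    using that
  proof (induction rule: span_induct_alt)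
    case (step c w x')
    then show ?case
      using W[OF step(1)] S0D(1)[OF step(1)] y'(1) by (simp add: distrib_left tr_simps)
  qed simp
  then show ?thesis using y y' tr_square_eq_0 by blast
qed

lemma L_eqI:
  assumes y: "y \<in> SV" "\<And>U. U \<in> S0 \<Longrightarrow> tr (y * \<phi> U) = tr (x * U)"
  shows "L x = y"
  unfolding L_def
proof (rule the_equality)
  fix z assume z: "z \<in> SV \<and> (\<forall>U\<in>S0. tr (z * \<phi> U) = tr (x * U))"
  have "z - y = 0"
  proof (rule orth_zero)
    show "z - y \<in> SV" using z y by (simp add: span_diff)
    show "tr ((z - y) * \<phi> U) = 0" if "U \<in> S0" for U
      using that z y span_M[of z] span_M[of y] S0D[OF phi_S0[OF that]]
      by (simp add: left_diff_distrib tr_simps)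
  qed
  then show "z = y" by simp
qed (use y in auto)

text \<open>The subset \<open>A\<close> is kept variable in order to follow the span of the
  symmetries that anticommute with a given one.\<close>

lemma L_char:
  assumes "A \<subseteq> S0" "x \<in> span A"
  shows "L x \<in> span (\<phi> ` A) \<and> (\<forall>U\<in>S0. tr (L x * \<phi> U) = tr (x * U))"
proof -
  have sub: "span (\<phi> ` A) \<subseteq> SV" "span A \<subseteq> SV"
    using assms(1) phi_S0 by (auto intro!: span_mono)
  have "x \<in> M \<and> (\<exists>y \<in> span (\<phi> ` A). \<forall>U\<in>S0. tr (y * \<phi> U) = tr (x * U))"
    using assms(2)
  proof (induction rule: span_induct_alt)
    case base
    show ?case by (auto intro!: bexI[of _ 0] simp: span_zero)
  next
    case (step c w x')
    then obtain y where y: "y \<in> span (\<phi> ` A)" "\<And>U. U \<in> S0 \<Longrightarrow> tr (y * \<phi> U) = tr (x' * U)" and x': "x' \<in> M"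
      by blast
    have w: "w \<in> S0" using step assms by blast
    have yM: "y \<in> M" using y sub span_M by blast
    have "tr ((c *\<^sub>R \<phi> w + y) * \<phi> U) = tr ((c *\<^sub>R w + x') * U)" if U: "U \<in> S0" for U
      using pres[OF w U] y(2)[OF U] S0D(1)[OF U] S0D(1)[OF phi_S0[OF U]] S0D(1)[OF w] S0D(1)[OF phi_S0[OF w]] x' yM
      by (simp add: distrib_right tr_simps)
    moreover have "c *\<^sub>R \<phi> w + y \<in> span (\<phi> ` A)"
      by (intro span_add span_scale y(1) span_base imageI step(1))
    ultimately show ?case
      using x' S0D(1)[OF w] by auto
  qed
  then obtain y where "y \<in> span (\<phi> ` A)" "\<And>U. U \<in> S0 \<Longrightarrow> tr (y * \<phi> U) = tr (x * U)"
    by blast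
  moreover from this have "L x = y" using L_eqI sub by blast
  ultimately show ?thesis by simp
qed

lemma L_SV: "x \<in> SV \<Longrightarrow> L x \<in> SV"
  using L_char[of S0 x] surj by simp

lemma L_tr: "x \<in> SV \<Longrightarrow> U \<in> S0 \<Longrightarrow> tr (L x * \<phi> U) = tr (x * U)"
  using L_char[of S0 x] by simp

lemma L_M: "x \<in> SV \<Longrightarrow> L x \<in> M" "x \<in> SV \<Longrightarrow> star (L x) = L x"
  using span_M[OF L_SV] by auto

lemma L_phi: "U \<in> S0 \<Longrightarrow> L U = \<phi> U"
  by (intro L_eqI span_base phi_S0 pres)

lemma L_add:
  assumes "x \<in> SV" "y \<in> SV" shows "L (x + y) = L x + L y"
proof (rule L_eqI)
  show "L x + L y \<in> SV" using assms by (intro span_add L_SV)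
  show "tr ((L x + L y) * \<phi> U) = tr ((x + y) * U)" if U: "U \<in> S0" for U
    using L_tr[OF assms(1) U] L_tr[OF assms(2) U] L_M assms span_M S0D(1)[OF U] S0D(1)[OF phi_S0[OF U]]
    by (simp add: distrib_right tr_simps)
qed

lemma L_scale:
  assumes "x \<in> SV" shows "L (r *\<^sub>R x) = r *\<^sub>R L x"
proof (rule L_eqI)
  show "r *\<^sub>R L x \<in> SV" using assms by (intro span_scale L_SV)
  show "tr ((r *\<^sub>R L x) * \<phi> U) = tr ((r *\<^sub>R x) * U)" if U: "U \<in> S0" for U
    using L_tr[OF assms U] L_M assms span_M S0D(1)[OF U] S0D(1)[OF phi_S0[OF U]]
    by (simp add: tr_simps)
qed

lemma L_diff: "x \<in> SV \<Longrightarrow> y \<in> SV \<Longrightarrow> L (x - y) = L x - L y"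
  using L_add[of x "(-1) *\<^sub>R y"] L_scale[of y "-1"] by (simp add: span_neg)

lemma L_inner:
  assumes x: "x \<in> SV" and y: "y \<in> SV" shows "tr (L x * L y) = tr (x * y)"
proof -
  have "y \<in> SV \<and> tr (L x * L y) = tr (x * y)"
    using y
  proof (induction rule: span_induct_alt)
    case base
    have "L 0 = 0" using L_scale[OF x, of 0] by simp
    then show ?case by (simp add: span_zero)
  next
    case (step c w y)
    then have w: "w \<in> SV" and y: "y \<in> SV" by (auto intro: span_base)
    have cw: "c *\<^sub>R w \<in> SV" using w by (rule span_scale)
    have "L (c *\<^sub>R w + y) = c *\<^sub>R \<phi> w + L y"
      unfolding L_add[OF cw y] L_scale[OF w] L_phi[OF step(1)] ..
    moreover have "c *\<^sub>R w + y \<in> SV"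
      using cw y by (rule span_add)
    ultimately show ?case
      using step(2) L_tr[OF x step(1)] L_M(1)[OF x] L_M(1)[OF y] span_M[OF x] span_M[OF y]
        S0D(1)[OF step(1)] S0D(1)[OF phi_S0[OF step(1)]] 
      by (simp add: distrib_left tr_simps)
  qed
  then show ?thesis by blast
qed

text \<open>The normalized sum of \<open>U\<close> and \<open>V\<close> is again a symmetry; its
  image is the normalized sum of the images, and its square is 1 only if the mixed terms
  cancel.\<close>

lemma anticomm:
  assumes U: "U \<in> S0" and V: "V \<in> S0" and UV: "U * V = - (V * U)"
  shows "\<phi> U * \<phi> V = - (\<phi> V * \<phi> U)"
proof -
  define W where "W = (1 / sqrt 2) *\<^sub>R (U + V)"
  note P = S0D[OF phi_S0[OF U]] S0D[OF phi_S0[OF V]]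
  have W: "W \<in> S0" unfolding W_def by (rule S0_half[OF U V UV])
  have "L W = (1 / sqrt 2) *\<^sub>R (\<phi> U + \<phi> V)"
    unfolding W_def using L_scale[OF span_add[OF span_base[OF U] span_base[OF V]]] L_add[OF span_base[OF U] span_base[OF V]]
    by (simp add: L_phi U V)
  then have "(1 / sqrt 2) *\<^sub>R (\<phi> U + \<phi> V) * ((1 / sqrt 2) *\<^sub>R (\<phi> U + \<phi> V)) = 1"
    using S0D[OF phi_S0[OF W]] L_phi[OF W] by simp
  then have "2 *\<^sub>R ((1/2) *\<^sub>R ((\<phi> U + \<phi> V) * (\<phi> U + \<phi> V))) = 2 *\<^sub>R 1"
    by simp
  then have "(\<phi> U + \<phi> V) * (\<phi> U + \<phi> V) = 1 + 1"
    by (simp add: scaleR_2)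
  then have "\<phi> U * \<phi> V + \<phi> V * \<phi> U = 0"
    using P by (simp add: distrib_left distrib_right algebra_simps)
  then show ?thesis by (simp add: eq_neg_iff_add_eq_0)
qed

lemma L_AC:
  assumes Z: "Z \<in> S0" and x: "x \<in> AC Z"
  shows "L x \<in> AC (\<phi> Z)"
proof -
  have "L x \<in> span (\<phi> ` (S0 \<inter> AC Z))"
    using L_char[of "S0 \<inter> AC Z" x] AC_span[OF Z x] by blast
  moreover have "\<phi> ` (S0 \<inter> AC Z) \<subseteq> S0 \<inter> AC (\<phi> Z)"
  proof
    fix y assume "y \<in> \<phi> ` (S0 \<inter> AC Z)"
    then obtain W where "W \<in> S0" "W * Z = - (Z * W)" "y = \<phi> W"
      by (auto simp: AC_def)
    then show "y \<in> S0 \<inter> AC (\<phi> Z)"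
      using anticomm[OF _ Z, of W] phi_S0[of W] S0D[OF phi_S0[of W]] by (simp add: AC_def)
  qed
  ultimately have "L x \<in> span (S0 \<inter> AC (\<phi> Z))"
    using span_mono by blast
  then show ?thesis
    using span_AC S0D(1)[OF phi_S0[OF Z]] by blast
qed

text \<open>The extension of the inverse bijection has the property of \<open>L_AC\<close> too, and
  it supplies the preimage.\<close>

lemma L_onto_AC:
  assumes U: "U \<in> S0" and V: "V \<in> S0" and r: "r \<in> AC (\<phi> U)" "r \<in> AC (\<phi> V)"
  shows "\<exists>g. g \<in> AC U \<and> g \<in> AC V \<and> L g = r"
proof -
  interpret i: sym_iso M tr "inv_into S0 \<phi>" by (rule inverse_iso)
  have inv: "inv_into S0 \<phi> (\<phi> W) = W" if "W \<in> S0" for W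
    using inj that by (simp add: inv_into_f_f)
  define g where "g = i.L r"
  have "g \<in> AC U" "g \<in> AC V"
    using i.L_AC[OF phi_S0[OF U] r(1)] i.L_AC[OF phi_S0[OF V] r(2)] inv U V by (auto simp: g_def)
  moreover have "L g = r"
  proof -
    have rS: "r \<in> SV" using AC_SV[OF phi_S0[OF U] r(1)] .
    have "inv_into S0 (inv_into S0 \<phi>) W = \<phi> W" if "W \<in> S0" for W
      using inv_into_f_f[OF i.inj phi_S0[OF that]] inv[OF that] by simp
    then show ?thesis
    proof -
      have "L g = r"
      proof (rule L_eqI[OF rS])
        fix W assume W: "W \<in> S0"
        show "tr (r * \<phi> W) = tr (g * W)"
          using i.L_tr[OF rS phi_S0[OF W]] inv[OF W] by (simp add: g_def)
      qed
      then show ?thesis .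
    qed
  qed
  ultimately show ?thesis by blast
qed

end

lemma mult_left_commute': "a * b = b * a \<Longrightarrow> a * (b * x) = b * (a * (x :: 'a::semigroup_mult))"
  by (metis mult.assoc)

context factor
begin

text \<open>Conjugation by \<open>z\<close> fixes \<open>a\<close>, negates \<open>b\<close> and
  preserves the trace.\<close>

lemma tr_anti:
  assumes "a \<in> M" "b \<in> M" "z \<in> M" "z * z = 1" "a * z = z * a" "b * z = - (z * b)"
  shows "tr (a * b) = 0"
proof -
  have "z * (a * z * b) = z * z * a * b"
    by (simp add: assms(5) mult.assoc)
  then have "tr (a * b) = tr (z * (a * z * b))"
    by (simp add: assms(4))
  also have "\<dots> = tr (a * z * b * z)"
    using assms(1-3) by (intro tr_commute) auto
  also have "a * z * b * z = - (a * (z * z) * b)"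
    by (simp add: assms(6) mult.assoc)
  finally show ?thesis
    using assms(1-4) by (simp add: tr_minus)
qed

lemma N0_AC:
  assumes "h \<in> N0 U V" "star h = h" "U \<in> S0" "V \<in> S0" "U * V = - (V * U)"
  shows "h * V \<in> AC U"
proof -
  have h: "h \<in> M" "h * U = U * h" "h * V = V * h" using assms(1) by (auto simp: N0_def)
  have "h * V * U = - (h * U * V)"
    by (simp add: mult.assoc assms(5))
  also have "\<dots> = - (U * (h * V))"
    by (simp add: h(2) mult.assoc)
  finally show ?thesis
    using h(1,3) assms(2) S0D[OF assms(3)] S0D[OF assms(4)] by (simp add: AC_def)
qed

lemma N0_scaleR: "h \<in> N0 U V \<Longrightarrow> r *\<^sub>R h \<in> N0 U V"
  and N0_add: "h \<in> N0 U V \<Longrightarrow> k \<in> N0 U V \<Longrightarrow> h + k \<in> N0 U V"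
  and N0_diff: "h \<in> N0 U V \<Longrightarrow> k \<in> N0 U V \<Longrightarrow> h - k \<in> N0 U V"
  and N0_mult: "h \<in> N0 U V \<Longrightarrow> k \<in> N0 U V \<Longrightarrow> h * k \<in> N0 U V"
  and N0_one: "1 \<in> N0 U V"
  and N0_cscale: "h \<in> N0 U V \<Longrightarrow> cscale c h \<in> N0 U V"
  by (auto simp: N0_def distrib_left distrib_right left_diff_distrib right_diff_distrib mult.assoc)
    (auto simp flip: mult.assoc)

lemma N0_star: "h \<in> N0 U V \<Longrightarrow> star U = U \<Longrightarrow> star V = V \<Longrightarrow> star h \<in> N0 U V"
proof -
  assume h: "h \<in> N0 U V" and sa: "star U = U" "star V = V"
  have "star (h * U) = star (U * h)" "star (h * V) = star (V * h)"
    using h by (auto simp: N0_def)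
  then show ?thesis using h sa by (simp add: N0_def)
qed

end

section \<open>The map induced on the commutant of an anticommuting pair\<close>

context sym_iso
begin

text \<open>Let \<open>r\<close> be the part of \<open>L (h * V)\<close> that anticommutes with
  \<open>\<phi> V\<close>. It anticommutes with \<open>\<phi> U\<close> too, so it is
  \<open>L g\<close> for some \<open>g\<close> anticommuting with \<open>U\<close> and
  \<open>V\<close>. But \<open>h * V\<close> commutes with \<open>V\<close> and is orthogonal to
  \<open>g\<close>; as \<open>L\<close> preserves the trace form, \<open>r\<close> is orthogonal to
  \<open>L (h * V)\<close> and so to itself.\<close>

lemma L_commute:
  assumes U: "U \<in> S0" and V: "V \<in> S0" and UV: "U * V = - (V * U)" and h: "h \<in> N0 U V" "star h = h"
  shows "L (h * V) * \<phi> V = \<phi> V * L (h * V)"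
proof -
  note P = S0D[OF phi_S0[OF U]] S0D[OF phi_S0[OF V]] and SD = S0D[OF U] S0D[OF V]
  define x u v where "x = L (h * V)" and "u = \<phi> U" and "v = \<phi> V"
  have P: "u \<in> M" "v \<in> M" "star u = u" "star v = v" "u * u = 1" "v * v = 1" "\<And>A. v * (v * A) = A"
    using P by (auto simp: u_def v_def)
  have uv: "u * v = - (v * u)" "u * (v * A) = - (v * (u * A))" for A
    using anticomm[OF U V UV] mult_left_assoc[OF anticomm[OF U V UV]] by (auto simp: u_def v_def mult.assoc)
  have hV: "h * V \<in> AC U" "h * V \<in> SV"
    using N0_AC[OF h U V UV] AC_SV[OF U] by auto
  have "x \<in> AC u"
    using L_AC[OF U hV(1)] by (simp add: x_def u_def)
  then have x: "x \<in> M" "star x = x" "x * u = - (u * x)" "x * (u * A) = - (u * (x * A))" for A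
    using mult_left_assoc[of x u "- (u * x)"] by (auto simp: AC_def mult.assoc)
  define r x' where "r = (1/2) *\<^sub>R (x - v * (x * v))" and "x' = (1/2) *\<^sub>R (x + v * (x * v))"
  have xr: "x = x' + r"
    by (simp add: r_def x'_def scaleR_2[symmetric] flip: scaleR_add_right)
  have rM: "r \<in> M" "star r = r" "x' \<in> M" using x P by (auto simp: r_def x'_def mult.assoc)
  have rv: "r * v = - (v * r)"
    using P by (simp add: r_def left_diff_distrib right_diff_distrib mult.assoc flip: scaleR_minus_right)
  have x'v: "x' * v = v * x'"
    using P by (simp add: x'_def distrib_left distrib_right mult.assoc add.commute)
  have vu: "v * u = - (u * v)" "v * (u * A) = - (u * (v * A))" for A
    using uv by simp_all
  have "r * u = - (u * r)"
    by (simp add: r_def left_diff_distrib right_diff_distrib mult.assoc x vu scaleR_diff_right scaleR_minus_right)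
  then obtain g where g: "g \<in> AC U" "g \<in> AC V" "L g = r"
    using L_onto_AC[OF U V, of r] rM rv by (auto simp: AC_def u_def v_def)
  have "tr (x * r) = tr (h * V * g)"
    using L_inner[OF hV(2) AC_SV[OF U g(1)]] by (simp add: x_def g(3))
  also have "\<dots> = 0"
    using h g SD by (intro tr_anti[of _ _ V]) (auto simp: N0_def AC_def mult.assoc simp flip: mult.assoc[of h V])
  finally have "tr (x * r) = 0" .
  moreover have "tr (x' * r) = 0"
    using rM rv x'v P by (intro tr_anti[of _ _ v]) auto
  moreover have "r * r = x * r - x' * r"
    by (simp add: xr distrib_right)
  ultimately have "tr (r * r) = 0"
    using rM x by (simp add: tr_simps)
  then have "r = 0"
    using rM tr_square_eq_0 by blast
  then show ?thesis
    using xr x'v by (simp add: x_def v_def)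
qed

text \<open>\<open>L_commute\<close> also holds for the pair \<open>\<i> U V\<close> and
  \<open>(U + V) / sqrt 2\<close>, where it says that \<open>a + b\<close> commutes with
  \<open>u + v\<close>. The diagonal terms commute already and the mixed terms anticommute, which
  leaves \<open>a * v = - (b * u)\<close>; multiplication by \<open>v * u\<close> gives the
  claim.\<close>

lemma L_third:
  assumes U: "U \<in> S0" and V: "V \<in> S0" and UV: "U * V = - (V * U)" and h: "h \<in> N0 U V" "star h = h"
  shows "L (h * U) * \<phi> U = L (h * V) * \<phi> V"
proof -
  define Y where "Y = cscale \<i> (U * V)"
  define W where "W = (1 / sqrt 2) *\<^sub>R (U + V)"
  note Y = S0_third[OF U V UV, folded Y_def]
  have W: "W \<in> S0" unfolding W_def by (rule S0_half[OF U V UV])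
  have VU: "V * U = - (U * V)" using UV by simp
  have hUV: "h \<in> M" "h * U = U * h" "h * V = V * h" using h by (auto simp: N0_def)
  have YW: "Y * W = - (W * Y)"
    by (simp add: W_def Y distrib_left distrib_right scaleR_add_right scaleR_diff_right)
  have hY: "h \<in> N0 Y W"
    using hUV mult_left_assoc[OF hUV(2)] by (simp add: N0_def W_def Y_def distrib_left distrib_right mult.assoc)
  have hVU: "h \<in> N0 V U" using h by (auto simp: N0_def)
  define a b u v where "a = L (h * U)" and "b = L (h * V)" and "u = \<phi> U" and "v = \<phi> V"
  have UVS: "U \<in> SV" "V \<in> SV" "h * U \<in> SV" "h * V \<in> SV"
    using U V N0_AC[OF h U V UV] N0_AC[OF hVU h(2) V U VU] AC_SV[OF U] AC_SV[OF V] by (auto intro: span_base)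
  have fW: "\<phi> W = (1 / sqrt 2) *\<^sub>R (u + v)"
    using L_phi[OF W] L_scale[OF span_add[OF UVS(1,2)]] L_add[OF UVS(1,2)]
    by (simp add: W_def u_def v_def L_phi U V)
  have "h * W = (1 / sqrt 2) *\<^sub>R (h * U + h * V)"
    by (simp add: W_def distrib_left)
  then have "L (h * W) = (1 / sqrt 2) *\<^sub>R (a + b)"
    using L_scale[OF span_add[OF UVS(3,4)]] L_add[OF UVS(3,4)] by (simp add: a_def b_def)
  then have "(a + b) * (u + v) = (u + v) * (a + b)"
    using L_commute[OF Y(1) W YW hY h(2)] by (simp add: fW)
  moreover have "a * u = u * a" "b * v = v * b"
    using L_commute[OF V U VU hVU h(2)] L_commute[OF U V UV h] by (auto simp: a_def b_def u_def v_def)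
  ultimately have eq: "a * v + b * u = u * b + v * a"
    by (simp add: distrib_left distrib_right algebra_simps)
  have au: "a * v = - (v * a)" "b * u = - (u * b)"
    using L_AC[OF U N0_AC[OF h U V UV]] L_AC[OF V N0_AC[OF hVU h(2) V U VU]] by (auto simp: AC_def a_def b_def u_def v_def)
  have uv: "u * v = - (v * u)"
    using anticomm[OF U V UV] by (simp add: u_def v_def)
  have uu: "u * u = 1" "v * v = 1" "u \<in> M" "v \<in> M" "\<And>A. u * (u * A) = A" "\<And>A. v * (v * A) = A"
    using S0D[OF phi_S0[OF U]] S0D[OF phi_S0[OF V]] by (auto simp: u_def v_def)
  have "- (a * v + b * u) = v * a + u * b"
    by (simp add: au)
  then have "a * v + b * u = - (a * v + b * u)"
    using eq by (simp add: add.commute)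
  then have "2 *\<^sub>R (a * v + b * u) = 0"
    unfolding scaleR_2 by (metis add.left_inverse)
  then have "a * v = - (b * u)"
    by (simp add: eq_neg_iff_add_eq_0)
  then have "a * v * (v * u) = - (b * u) * (v * u)" by simp
  moreover have "u * (v * u) = - v"
  proof -
    have "v * u = - (u * v)" using uv by simp
    then show ?thesis using uu by simp
  qed
  moreover have "a * v * (v * u) = a * u"
    using uu by (simp add: mult.assoc)
  ultimately have "a * u = b * v"
    by (simp add: mult.assoc)
  then show ?thesis by (simp add: a_def b_def u_def v_def)
qed

text \<open>A self-adjoint \<open>h\<close> of the commutant need not have trace 0, so
  \<open>L\<close> cannot be applied to it. The factor \<open>V\<close> moves it into the span of
  \<open>S0\<close>, and \<open>\<phi> V\<close> undoes this on the other side.\<close>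

definition frame_map :: "'h cop \<Rightarrow> 'h cop \<Rightarrow> 'h cop" where
  "frame_map V h = L (h * V) * \<phi> V"

lemma L_frame_map: "V \<in> S0 \<Longrightarrow> L (h * V) = frame_map V h * \<phi> V"
  using S0D[OF phi_S0[of V]] by (simp add: frame_map_def mult.assoc)

lemma frame_map_N0:
  assumes U: "U \<in> S0" and V: "V \<in> S0" and UV: "U * V = - (V * U)" and h: "h \<in> N0 U V" "star h = h"
  shows "frame_map V h \<in> N0 (\<phi> U) (\<phi> V)" "star (frame_map V h) = frame_map V h"
proof -
  note P = S0D[OF phi_S0[OF U]] S0D[OF phi_S0[OF V]]
  have x: "L (h * V) \<in> AC (\<phi> U)"
    by (rule L_AC[OF U N0_AC[OF h U V UV]])
  note c = L_commute[OF U V UV h]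
  have "L (h * V) * \<phi> V * \<phi> U = - (L (h * V) * \<phi> U * \<phi> V)"
    using anticomm[OF U V UV] by (simp add: mult.assoc)
  also have "\<dots> = \<phi> U * (L (h * V) * \<phi> V)"
    using x by (simp add: AC_def mult.assoc)
  finally show "frame_map V h \<in> N0 (\<phi> U) (\<phi> V)"
    using x P c by (auto simp: N0_def frame_map_def AC_def mult.assoc)
  show "star (frame_map V h) = frame_map V h"
    using x P c by (simp add: frame_map_def AC_def)
qed

lemma frame_map_simps:
  assumes U: "U \<in> S0" and V: "V \<in> S0" and UV: "U * V = - (V * U)"
    and h: "h \<in> N0 U V" "star h = h" and k: "k \<in> N0 U V" "star k = k"
  shows "frame_map V (h + k) = frame_map V h + frame_map V k" "frame_map V (h - k) = frame_map V h - frame_map V k" "frame_map V (r *\<^sub>R h) = r *\<^sub>R frame_map V h"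
  using L_add[of "h * V" "k * V"] L_diff[of "h * V" "k * V"] L_scale[of "h * V" r]
    AC_SV[OF U N0_AC[OF h U V UV]] AC_SV[OF U N0_AC[OF k U V UV]]
  by (simp_all add: frame_map_def distrib_right left_diff_distrib)

lemma frame_map_one: "V \<in> S0 \<Longrightarrow> frame_map V 1 = 1"
  using S0D[OF phi_S0[of V]] by (simp add: frame_map_def L_phi)

lemma frame_map_tr:
  assumes "U \<in> S0" "V \<in> S0" "U * V = - (V * U)" "h \<in> N0 U V" "star h = h" 
  shows "tr (frame_map V h) = tr h"
  using L_tr[OF AC_SV[OF assms(1) N0_AC[OF assms(4,5,1-3)]] assms(2)] S0D[OF assms(2)]
  by (simp add: frame_map_def mult.assoc)

lemma N0_third:
  assumes h: "h \<in> N0 U V" 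
  shows "h \<in> N0 U (cscale \<i> (U * V))" "h \<in> N0 V (cscale \<i> (U * V))"
proof -
  have "h * U = U * h" "h * V = V * h" "h \<in> M" using h by (auto simp: N0_def)
  then have "h * (U * V) = U * V * h"
    using mult_left_assoc[OF \<open>h * U = U * h\<close>, of V] by (simp add: mult.assoc)
  with \<open>h * U = _\<close> \<open>h * V = _\<close> \<open>h \<in> M\<close>
  show "h \<in> N0 U (cscale \<i> (U * V))" "h \<in> N0 V (cscale \<i> (U * V))"
    by (simp_all add: N0_def mult.assoc)
qed

text \<open>The elements \<open>a * V \<plusminus> b * Y\<close>, with \<open>Y\<close> the third
  member of the triple, are symmetries. The squares of both images are 1, and averaging over the
  sign removes the commutator of \<open>frame_map V a\<close> and
  \<open>frame_map V b\<close>.\<close>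

lemma frame_map_pyth:
  assumes U: "U \<in> S0" and V: "V \<in> S0" and UV: "U * V = - (V * U)"
    and a: "a \<in> N0 U V" "star a = a" and b: "b \<in> N0 U V" "star b = b"
    and ab: "a * b = b * a" "a * a + b * b = 1"
  shows "frame_map V a * frame_map V a + frame_map V b * frame_map V b = 1"
proof -
  define Y where "Y = cscale \<i> (U * V)"
  note Y = S0_third[OF U V UV, folded Y_def]
  note SD = S0D[OF U] S0D[OF V] S0D[OF Y(1)]
  have VY: "V * Y = - (Y * V)" using Y(3) .
  define s t v y where "s = frame_map V a" and "t = frame_map V b" and "v = \<phi> V" and "y = \<phi> Y"
  have bY: "b \<in> N0 V Y" "b \<in> N0 U Y" and aY: "a \<in> N0 V Y"
    using N0_third[OF b(1)] N0_third[OF a(1)] by (auto simp: Y_def)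
  \<comment> \<open>\<open>L_third\<close> for the pair \<open>V\<close>, \<open>Y\<close> expresses
    the image of \<open>b * Y\<close> through \<open>t\<close>, which was defined with
    \<open>V\<close>.\<close>
  have tY: "t = frame_map Y b"
    using L_third[OF V Y(1) VY bY(1) b(2)] by (simp add: frame_map_def t_def)
  have sY: "s = frame_map Y a"
    using L_third[OF V Y(1) VY aY a(2)] by (simp add: frame_map_def s_def)
  have tN: "t \<in> N0 v y" "s \<in> N0 v y"
    using frame_map_N0(1)[OF V Y(1) VY bY(1) b(2)] frame_map_N0(1)[OF V Y(1) VY aY a(2)] unfolding tY sY v_def y_def .
  then have st: "s * v = v * s" "s * y = y * s" "t * v = v * t" "t * y = y * t" "s \<in> M" "t \<in> M"
    by (auto simp: N0_def)
  have st': "v * s = s * v" "y * s = s * y" "v * t = t * v" "y * t = t * y"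
    "v * (s * A) = s * (v * A)" "y * (s * A) = s * (y * A)" "v * (t * A) = t * (v * A)" "y * (t * A) = t * (y * A)" for A
    using st(1-4)[symmetric] st(1-4)[symmetric, THEN mult_left_commute'] by auto
  have vy: "v * v = 1" "y * y = 1" "v * y = - (y * v)"
    using S0D[OF phi_S0[OF V]] S0D[OF phi_S0[OF Y(1)]] anticomm[OF V Y(1) VY] by (auto simp: v_def y_def)
  have *: "(s * v + e *\<^sub>R (t * y)) * (s * v + e *\<^sub>R (t * y)) = 1" if e: "e * e = 1" for e :: real
  proof -
    define W where "W = a * V + e *\<^sub>R (b * Y)"
    have aV: "a * V \<in> AC U" using N0_AC[OF a U V UV] .
    have bY': "b * Y \<in> AC U" using N0_AC[OF bY(2) b(2) U Y(1,2)] .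
    have abV: "a * V = V * a" "b * Y = Y * b" "a * Y = Y * a" "b * V = V * b"
      using a(1) bY aY b(1) by (auto simp: N0_def)
    have abV': "V * (a * A) = a * (V * A)" "Y * (b * A) = b * (Y * A)" "Y * (a * A) = a * (Y * A)" "V * (b * A) = b * (V * A)"
      "V * a = a * V" "Y * b = b * Y" "Y * a = a * Y" "V * b = b * V"for A
      using abV[symmetric] abV[symmetric, THEN mult_left_commute'] by auto
    have W1: "W \<in> M" "star W = W" "W * U = - (U * W)"
      using aV bY' by (auto simp: W_def AC_def distrib_left distrib_right)
    have "W * W = a * a + (e * e) *\<^sub>R (b * b)"
      using mult_left_assoc[OF ab(1), of "V * Y"] ab(1)
      by (simp add: W_def distrib_left distrib_right mult.assoc abV' SD VY)
        (simp add: mult_left_commute'[OF ab(1)] scaleR_diff_right)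
    then have "W * W = 1" using ab(2) e by simp
    then have W: "W \<in> S0"
      using S0_I[OF W1(1,2) _ SD(1,3) W1(3)] by blast
    have SV: "a * V \<in> SV" "b * Y \<in> SV"
      using AC_SV[OF U] aV bY' by auto
    have "\<phi> W = s * v + e *\<^sub>R (t * y)"
      using L_phi[OF W] L_add[OF SV(1) span_scale[OF SV(2), of e]] L_scale[OF SV(2), of e]
        L_frame_map[OF V, of a] L_frame_map[OF Y(1), of b]
      by (simp add: W_def s_def v_def y_def tY)
    then show ?thesis
      using S0D[OF phi_S0[OF W]] by simp
  qed
  have e1: "s * s + t * t + (s * t - t * s) * (v * y) = 1"
    using *[of 1] by (simp add: distrib_left distrib_right left_diff_distrib mult.assoc st' vy algebra_simps)
  have e2: "s * s + t * t - (s * t - t * s) * (v * y) = 1"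
    using *[of "-1"] by (simp add: distrib_left distrib_right left_diff_distrib right_diff_distrib mult.assoc st' vy algebra_simps)
  have "s * s + t * t + (s * t - t * s) * (v * y) + (s * s + t * t - (s * t - t * s) * (v * y)) = 1 + 1"
    unfolding e1 e2 ..
  then have "2 *\<^sub>R (s * s + t * t) = 2 *\<^sub>R 1"
    by (simp only: scaleR_2 add_diff_eq diff_add_eq) (simp add: algebra_simps)
  then show ?thesis by (simp add: s_def t_def)
qed

text \<open>For \<open>w\<close> of norm at most 1, completing it by \<open>sqrt_complement\<close>
  to a pair with squares adding up to 1 leaves the square of \<open>frame_map V w\<close> below
  1.\<close>

lemma frame_map_norm:
  assumes U: "U \<in> S0" and V: "V \<in> S0" and UV: "U * V = - (V * U)" and a: "a \<in> N0 U V" "star a = a"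
  shows "norm (frame_map V a) \<le> norm a"
proof (cases "a = 0")
  case True
  then show ?thesis using frame_map_simps(3)[OF U V UV a a, of 0] by simp
next
  case False
  define w where "w = (1 / norm a) *\<^sub>R a"
  have w: "w \<in> N0 U V" "star w = w" "norm w \<le> 1" "a = norm a *\<^sub>R w"
    using a False by (auto simp: w_def N0_scaleR)
  have wM: "w \<in> M" "w * U = U * w" "w * V = V * w" using w by (auto simp: N0_def)
  obtain c where c: "c \<in> M" "star c = c" "c * c = 1 - w * w" and comm: "\<And>y. y * (w * w) = w * w * y \<Longrightarrow> y * c = c * y"
    using sqrt_complement[OF wM(1) w(2,3)] by blast
  have "w * c = c * w" by (rule comm) (simp add: mult.assoc)
  moreover have "U * c = c * U" "V * c = c * V"
    by (rule comm; metis wM mult.assoc)+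
  ultimately have "frame_map V w * frame_map V w + frame_map V c * frame_map V c = 1"
    using c w by (intro frame_map_pyth[OF U V UV]) (auto simp: N0_def)
  have ss: "star (frame_map V w) = frame_map V w" "star (frame_map V c) = frame_map V c"
    using frame_map_N0(2)[OF U V UV] w c \<open>U * c = c * U\<close> \<open>V * c = c * V\<close> by (auto simp: N0_def)
  have "norm (frame_map V w) \<le> 1"
  proof (rule cop_bound)
    fix x
    have "(norm (app (frame_map V w) x))\<^sup>2 + (norm (app (frame_map V c) x))\<^sup>2 = quad_form (frame_map V w * frame_map V w + frame_map V c * frame_map V c) x"
      using quad_form_star_mult[of "frame_map V w" x] quad_form_star_mult[of "frame_map V c" x] by (simp add: ss)
    also have "\<dots> = (norm x)\<^sup>2"
      by (simp add: \<open>_ = 1\<close>)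
    finally have "(norm (app (frame_map V w) x))\<^sup>2 \<le> (norm x)\<^sup>2"
      using zero_le_power2[of "norm (app (frame_map V c) x)"] by linarith
    then show "norm (app (frame_map V w) x) \<le> 1 * norm x"
      by (auto intro: power2_le_imp_le)
  qed simp
  then show ?thesis
    using frame_map_simps(3)[OF U V UV w(1,2) w(1,2), of "norm a"] w(4) False
    by (metis abs_norm_cancel mult.right_neutral mult_left_mono norm_ge_zero norm_scaleR)
qed

text \<open>Since \<open>\<delta>(a) = s(a\<^sup>2) - s(a)\<^sup>2\<close> is invariant under adding scalars to \<open>a\<close> and changes sign when \<open>a\<close> is
  replaced by \<open>\<surd>(r\<^sup>2 - a\<^sup>2)\<close>, it equals \<open>- \<delta>(\<surd>(r\<^sup>2 - a\<^sup>2) - r)\<close>, which tends to 0 as \<open>r\<close> grows.\<close>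

lemma frame_map_square:
  assumes U: "U \<in> S0" and V: "V \<in> S0" and UV: "U * V = - (V * U)" and a: "a \<in> N0 U V" "star a = a"
  shows "frame_map V (a * a) = frame_map V a * frame_map V a"
proof -
  define \<delta> where "\<delta> x = frame_map V (x * x) - frame_map V x * frame_map V x" for x
  note sgs = frame_map_simps[OF U V UV]
  have N: "h * k \<in> N0 U V" if "h \<in> N0 U V" "k \<in> N0 U V" for h k
    using that by (rule N0_mult)
  have bound: "norm (\<delta> x) \<le> 2 * (norm x)\<^sup>2" if x: "x \<in> N0 U V" "star x = x" for x
  proof -
    have "norm (\<delta> x) \<le> norm (frame_map V (x * x)) + norm (frame_map V x * frame_map V x)"
      unfolding \<delta>_def by (rule norm_triangle_ineq4)
    also have "norm (frame_map V (x * x)) \<le> norm (x * x)"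
      using x by (intro frame_map_norm[OF U V UV] N) auto
    also have "norm (x * x) \<le> norm x * norm x"
      by (rule norm_mult_ineq)
    also have "norm (frame_map V x * frame_map V x) \<le> norm x * norm x"
      by (rule order.trans[OF norm_mult_ineq mult_mono]) (use frame_map_norm[OF U V UV x] in auto)
    finally show ?thesis by (simp add: power2_eq_square)
  qed
  \<comment> \<open>The exponent 4 arises because \<open>\<delta> w\<close> is the negative of
    \<open>\<delta> (c - 1)\<close>, where \<open>norm (c - 1)\<close> is already of second order in
    \<open>w\<close>.\<close>
  have small: "norm (\<delta> w) \<le> 2 * (norm w) ^ 4" if w: "w \<in> N0 U V" "star w = w" "norm w \<le> 1" for w
  proof -
    have wM: "w \<in> M" "w * U = U * w" "w * V = V * w" using w by (auto simp: N0_def)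
    obtain c where c: "c \<in> M" "star c = c" "c * c = 1 - w * w" "norm (c - 1) \<le> (norm w)\<^sup>2"
      and comm: "\<And>y. y * (w * w) = w * w * y \<Longrightarrow> y * c = c * y"
      using sqrt_complement[OF wM(1) w(2,3)] by blast
    have wc: "w * c = c * w" by (rule comm) (simp add: mult.assoc)
    have "U * c = c * U" "V * c = c * V"
      by (rule comm; metis wM mult.assoc)+
    then have cN: "c \<in> N0 U V" using c by (auto simp: N0_def)
    have py: "frame_map V w * frame_map V w + frame_map V c * frame_map V c = 1"
      using c w wc cN by (intro frame_map_pyth[OF U V UV]) auto
    have ww: "w * w = 1 - c * c" using c(3) by simp
    have cc: "c * c \<in> N0 U V" "star (c * c) = c * c" using N[OF cN cN] c(2) by auto
    have one: "1 \<in> N0 U V" "star 1 = (1 :: 'h cop)" by (auto simp: N0_one)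
    have c1: "c - 1 \<in> N0 U V" "star (c - 1) = c - 1" using cN c one by (auto intro: N0_diff)
    have "\<delta> w = - \<delta> c"
      unfolding \<delta>_def ww using py sgs(2)[OF one cc] frame_map_one[OF V] by (simp add: algebra_simps)
    also have "\<delta> c = \<delta> (c - 1)"
    proof -
      have "(c - 1) * (c - 1) = c * c - c - (c - 1)"
        by (simp add: left_diff_distrib right_diff_distrib)
      then have "frame_map V ((c - 1) * (c - 1)) = frame_map V (c * c) - frame_map V c - (frame_map V c - 1)"
        using cN c cc c1 one sgs(2)[OF _ _ c1] sgs(2)[OF cc cN c(2)] sgs(2)[OF cN c(2) one] frame_map_one[OF V]
        by (simp add: N0_diff)
      moreover have "frame_map V (c - 1) = frame_map V c - 1"
        using sgs(2)[OF cN c(2) one] frame_map_one[OF V] by simp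
      ultimately show ?thesis
        unfolding \<delta>_def by (simp add: left_diff_distrib right_diff_distrib)
    qed
    finally have "norm (\<delta> w) \<le> 2 * (norm (c - 1))\<^sup>2"
      using bound[OF c1] by simp
    also have "\<dots> \<le> 2 * ((norm w)\<^sup>2)\<^sup>2"
      using c(4) by (intro mult_left_mono power_mono) auto
    finally show ?thesis by simp
  qed
  have scale: "\<delta> (r *\<^sub>R w) = (r * r) *\<^sub>R \<delta> w" if "w \<in> N0 U V" "star w = w" for r w
    using sgs(3)[OF that that, of r] sgs(3)[of "w * w" "w * w" "r * r"] N[OF that(1,1)] that
    by (simp add: \<delta>_def scaleR_diff_right)
  \<comment> \<open>Scaling costs the factor \<open>r * r\<close>, while the quartic bound at
    \<open>a / r\<close> gains \<open>r ^ 4\<close>.\<close>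
  have "norm (\<delta> a) \<le> 2 * (norm a) ^ 4 / (real (Suc n) * real (Suc n))" if n: "norm a \<le> real (Suc n)" for n
  proof -
    define r where "r = real (Suc n)"
    have r: "r > 0" "norm a \<le> r" using n by (auto simp: r_def)
    define w where "w = (1 / r) *\<^sub>R a"
    have w: "w \<in> N0 U V" "star w = w" "norm w = norm a / r" "a = r *\<^sub>R w"
      using a r by (auto simp: w_def N0_scaleR)
    have "norm (\<delta> a) = r * r * norm (\<delta> w)"
      using scale[OF w(1,2), of r] w(4) r by simp
    also have "\<dots> \<le> r * r * (2 * (norm w) ^ 4)"
    proof (rule mult_left_mono[OF small[OF w(1,2)]])
      show "norm w \<le> 1" unfolding w(3) using r by simp
    qed (use r in simp)
    also have "\<dots> = 2 * (norm a) ^ 4 / (r * r)"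
      using r unfolding w(3) by (simp add: field_simps power4_eq_xxxx)
    finally show ?thesis by (simp add: r_def)
  qed
  moreover have "norm a \<le> real (Suc n)" if "nat \<lceil>norm a\<rceil> \<le> n" for n
    using that real_nat_ceiling_ge[of "norm a"] by linarith
  ultimately have ev: "\<forall>\<^sub>F n in sequentially. norm (\<delta> a) \<le> 2 * (norm a) ^ 4 * (1 / real (Suc n)) * (1 / real (Suc n))"
    by (intro eventually_sequentiallyI[of "nat \<lceil>norm a\<rceil>"]) simp
  have "(\<lambda>n. 2 * (norm a) ^ 4 * (1 / real (Suc n)) * (1 / real (Suc n))) \<longlonglongrightarrow> 2 * (norm a) ^ 4 * 0 * 0"
    by (intro tendsto_intros LIMSEQ_Suc lim_1_over_n)
  from tendsto_lowerbound[OF this ev] have "norm (\<delta> a) \<le> 0"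
    by simp
  then show ?thesis by (simp add: \<delta>_def)
qed

end

section \<open>Jordan homomorphisms onto prime rings\<close>

lemma double_eq_0: "z + z = 0 \<Longrightarrow> z = (0 :: 'a::real_vector)"
  using scaleR_2[of z] by simp

lemma double_cancel: "z + z = w + w \<Longrightarrow> z = (w :: 'a::real_vector)"
  using double_eq_0[of "z - w"] by (simp add: algebra_simps)

text \<open>\<open>A\<close> and \<open>B\<close> are carriers inside larger rings. Real scalars are
  available on the target for the cancellation of factors 2.\<close>

locale jordan_onto_prime =
  fixes A :: "'a::ring set" and B :: "'b::real_algebra set" and J :: "'a \<Rightarrow> 'b"
  assumes A_add: "x \<in> A \<Longrightarrow> y \<in> A \<Longrightarrow> x + y \<in> A"
    and A_minus: "x \<in> A \<Longrightarrow> - x \<in> A"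
    and A_mult: "x \<in> A \<Longrightarrow> y \<in> A \<Longrightarrow> x * y \<in> A"
    and J_add: "x \<in> A \<Longrightarrow> y \<in> A \<Longrightarrow> J (x + y) = J x + J y"
    and J_square: "x \<in> A \<Longrightarrow> J (x * x) = J x * J x"
    and J_onto: "J ` A = B"
    and B_add: "u \<in> B \<Longrightarrow> v \<in> B \<Longrightarrow> u + v \<in> B"
    and B_minus: "u \<in> B \<Longrightarrow> - u \<in> B"
    and B_mult: "u \<in> B \<Longrightarrow> v \<in> B \<Longrightarrow> u * v \<in> B"
    and B_prime: "u \<in> B \<Longrightarrow> v \<in> B \<Longrightarrow> (\<And>m. m \<in> B \<Longrightarrow> u * m * v = 0) \<Longrightarrow> u = 0 \<or> v = 0"
begin

lemmas A_closed = A_add A_minus A_mult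

lemma A_diff: "x \<in> A \<Longrightarrow> y \<in> A \<Longrightarrow> x - y \<in> A"
  using A_add[OF _ A_minus, of x y] by simp

lemma B_diff: "x \<in> B \<Longrightarrow> y \<in> B \<Longrightarrow> x - y \<in> B"
  using B_add[OF _ B_minus, of x y] by simp

lemma J_B: "x \<in> A \<Longrightarrow> J x \<in> B"
  using J_onto by blast

lemma J_zero: "x \<in> A \<Longrightarrow> J 0 = 0"
  using J_add[of "x - x" "x - x"] A_diff[of x x] by simp

lemma J_minus: "x \<in> A \<Longrightarrow> J (- x) = - J x"
  using J_add[of x "- x"] J_zero A_minus by (simp add: eq_neg_iff_add_eq_0 add.commute)

lemma J_diff: "x \<in> A \<Longrightarrow> y \<in> A \<Longrightarrow> J (x - y) = J x - J y"
  using J_add[of x "- y"] J_minus A_minus by simp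

lemma J_anticomm:
  assumes "x \<in> A" "y \<in> A"
  shows "J (x * y + y * x) = J x * J y + J y * J x"
proof -
  have "J ((x + y) * (x + y)) = J (x * x) + J (y * y) + J (x * y + y * x)"
  proof -
    have "(x + y) * (x + y) = x * x + y * y + (x * y + y * x)"
      by (simp add: distrib_left distrib_right)
    then show ?thesis using assms by (simp add: J_add A_closed)
  qed
  moreover have "J ((x + y) * (x + y)) = (J x + J y) * (J x + J y)"
    using assms by (simp add: J_square J_add A_closed)
  ultimately show ?thesis
    using assms by (simp add: J_square distrib_left distrib_right)
qed

text \<open>Twice \<open>x * y * x\<close> is an expression in Jordan products of \<open>x\<close>
  and \<open>y\<close> alone.\<close>

lemma J_xyx:
  assumes "x \<in> A" "y \<in> A"
  shows "J (x * y * x) = J x * J y * J x"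
proof -
  have "x * y * x + x * y * x = (x * (x * y + y * x) + (x * y + y * x) * x) - (x * x * y + y * (x * x))"
    by (simp add: distrib_left distrib_right mult.assoc)
  then have "J (x * y * x) + J (x * y * x)
      = J (x * (x * y + y * x) + (x * y + y * x) * x) - J (x * x * y + y * (x * x))"
    using assms by (simp add: A_closed A_diff flip: J_add J_diff)
  also have "\<dots> = J x * (J x * J y + J y * J x) + (J x * J y + J y * J x) * J x - (J x * J x * J y + J y * (J x * J x))"
    using assms by (simp add: J_anticomm J_square A_closed)
  also have "\<dots> = J x * J y * J x + J x * J y * J x"
    by (simp add: distrib_left distrib_right mult.assoc)
  finally show ?thesis by (rule double_cancel)
qed

lemma J_xyz:
  assumes "x \<in> A" "y \<in> A" "z \<in> A"
  shows "J (x * y * z + z * y * x) = J x * J y * J z + J z * J y * J x"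
proof -
  have "(x + z) * y * (x + z) = x * y * x + z * y * z + (x * y * z + z * y * x)"
    by (simp add: distrib_left distrib_right)
  then have "J ((x + z) * y * (x + z)) = J (x * y * x) + J (z * y * z) + J (x * y * z + z * y * x)"
    using assms by (simp add: J_add[of "x * y * x + z * y * z"] J_add[of "x * y * x"] A_closed)
  moreover have "J ((x + z) * y * (x + z)) = (J x + J z) * J y * (J x + J z)"
    using assms by (simp add: J_xyx A_closed J_add)
  ultimately show ?thesis
    using assms by (simp add: J_xyx distrib_left distrib_right)
qed

text \<open>Applying the hypothesis in turn to \<open>r * y * s\<close>, \<open>s\<close> and
  \<open>r\<close> returns \<open>x * r * y * s * y\<close> with the opposite sign, so it is 0.
  Primeness, used twice, then gives \<open>y = 0\<close> unless \<open>x = 0\<close>.\<close>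

lemma annihilate:
  assumes "x \<in> B" "y \<in> B" and xy: "\<And>r. r \<in> B \<Longrightarrow> x * r * y + y * r * x = 0"
  shows "x = 0 \<or> y = 0"
proof (rule ccontr)
  assume nz: "\<not> (x = 0 \<or> y = 0)"
  have sw: "y * r * x = - (x * r * y)" if "r \<in> B" for r
    using xy[OF that] by (simp add: eq_neg_iff_add_eq_0 add.commute)
  have *: "x * r * (y * s * y) = 0" if r: "r \<in> B" and s: "s \<in> B" for r s
  proof -
    have "x * (r * y * s) * y = - (y * (r * y * s) * x)"
      using sw[of "r * y * s"] r s assms(2) by (simp add: B_mult)
    also have "\<dots> = - (y * r * (y * s * x))"
      by (simp add: mult.assoc)
    also have "\<dots> = y * r * x * s * y"
      unfolding sw[OF s] by (simp add: mult.assoc)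
    also have "\<dots> = - (x * (r * y * s) * y)"
      unfolding sw[OF r] by (simp add: mult.assoc)
    finally have "x * (r * y * s) * y + x * (r * y * s) * y = 0"
      by (metis add.left_inverse)
    then have "x * (r * y * s) * y = 0" by (rule double_eq_0)
    then show ?thesis by (simp add: mult.assoc)
  qed
  have "y * s * y = 0" if "s \<in> B" for s
    using B_prime[of x "y * s * y"] * that assms nz by (auto simp: B_mult)
  then show False using B_prime[of y y] assms nz by blast
qed

text \<open>For a single pair, the deviations from being multiplicative and antimultiplicative
  annihilate each other in the sense of \<open>annihilate\<close>. This comes from evaluating
  \<open>J\<close> at \<open>a b r b a + b a r a b\<close> in two ways: with \<open>a * b\<close>
  and \<open>b * a\<close> as outer factors by \<open>J_xyz\<close>, and as nested products by
  \<open>J_xyx\<close>.\<close>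

lemma J_hom_or_anti:
  assumes a: "a \<in> A" and b: "b \<in> A"
  shows "J (a * b) = J a * J b \<or> J (a * b) = J b * J a"
proof -
  define p u v where "p = J (a * b)" and "u = J a * J b" and "v = J b * J a"
  have ab: "a * b \<in> A" "b * a \<in> A" using a b by (auto simp: A_mult)
  have ba: "J (b * a) = u + v - p"
    using J_anticomm[OF a b] J_add[OF ab] by (simp add: p_def u_def v_def algebra_simps)
  have "p - u = 0 \<or> p - v = 0"
  proof (rule annihilate)
    show "p - u \<in> B" "p - v \<in> B"
      using a b ab J_B by (auto simp: p_def u_def v_def intro!: B_diff B_mult)
    fix r' assume "r' \<in> B"
    then obtain r where r: "r \<in> A" "r' = J r" using J_onto by blast
    have "J (a * b * r * (b * a) + b * a * r * (a * b)) = p * r' * (u + v - p) + (u + v - p) * r' * p"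
      using J_xyz[OF ab(1) r(1) ab(2)] ba by (simp add: p_def r(2))
    moreover have "a * b * r * (b * a) + b * a * r * (a * b) = a * (b * r * b) * a + b * (a * r * a) * b"
      by (simp add: mult.assoc)
    moreover have "J (a * (b * r * b) * a + b * (a * r * a) * b) = u * r' * v + v * r' * u"
      using a b r J_xyx[of a "b * r * b"] J_xyx[of b "a * r * a"] J_xyx[of b r] J_xyx[of a r]
        J_add[of "a * (b * r * b) * a" "b * (a * r * a) * b"]
      by (simp add: A_mult) (simp add: u_def v_def mult.assoc)
    ultimately have "p * r' * (u + v - p) + (u + v - p) * r' * p = u * r' * v + v * r' * u"
      by simp
    then show "(p - u) * r' * (p - v) + (p - v) * r' * (p - u) = 0"
      by (simp add: algebra_simps)
  qed
  then show ?thesis by (auto simp: p_def u_def v_def)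
qed

text \<open>A group is not the union of two proper subgroups; this is applied first in the second argument of the
  product and then in the first.\<close>

theorem hom_or_anti:
  "(\<forall>a\<in>A. \<forall>b\<in>A. J (a * b) = J a * J b) \<or> (\<forall>a\<in>A. \<forall>b\<in>A. J (a * b) = J b * J a)"
proof -
  have row: "(\<forall>b\<in>A. J (a * b) = J a * J b) \<or> (\<forall>b\<in>A. J (a * b) = J b * J a)" if a: "a \<in> A" for a
  proof (rule ccontr)
    assume "\<not> ?thesis"
    then obtain b c where b: "b \<in> A" "J (a * b) \<noteq> J a * J b" and c: "c \<in> A" "J (a * c) \<noteq> J c * J a"
      by blast
    then have "J (a * b) = J b * J a" "J (a * c) = J a * J c"
      using J_hom_or_anti a by blast+
    moreover have "J (a * (b + c)) = J (a * b) + J (a * c)" "J (b + c) = J b + J c"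
      using a b c by (simp_all add: distrib_left J_add A_mult)
    moreover have "J (a * (b + c)) = J a * J (b + c) \<or> J (a * (b + c)) = J (b + c) * J a"
      using J_hom_or_anti a b c A_add by blast
    ultimately show False
      using b c by (auto simp: distrib_left distrib_right)
  qed
  show ?thesis
  proof (rule ccontr)
    assume "\<not> ?thesis"
    then obtain a b c d where h: "a \<in> A" "b \<in> A" "J (a * b) \<noteq> J a * J b" "c \<in> A" "d \<in> A" "J (c * d) \<noteq> J d * J c"
      by blast
    then have ca: "\<And>x. x \<in> A \<Longrightarrow> J (a * x) = J x * J a" "\<And>x. x \<in> A \<Longrightarrow> J (c * x) = J c * J x"
      using row by blast+
    have e: "J ((a + c) * x) = J x * J a + J c * J x" "J (a + c) = J a + J c" if "x \<in> A" for x
      using that h ca by (simp_all add: distrib_right J_add A_mult)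
    have "a + c \<in> A" using h A_add by blast
    from row[OF this] show False
    proof
      assume "\<forall>x\<in>A. J ((a + c) * x) = J (a + c) * J x"
      then have "J b * J a = J a * J b" using e h(2) by (auto simp: distrib_right)
      then show False using h ca by auto
    next
      assume "\<forall>x\<in>A. J ((a + c) * x) = J x * J (a + c)"
      then have "J c * J d = J d * J c" using e h(5) by (auto simp: distrib_left)
      then show False using h ca by auto
    qed
  qed
qed

end

section \<open>The isometry on a fixed frame\<close>

context factor
begin

text \<open>The conditional expectation onto \<open>N0 U V\<close>: the mean of the conjugates by
  \<open>1\<close>, \<open>U\<close>, \<open>V\<close> and \<open>U * V\<close>.\<close>

definition E0 :: "'h cop \<Rightarrow> 'h cop \<Rightarrow> 'h cop \<Rightarrow> 'h cop" where
  "E0 U V x = (1/4) *\<^sub>R (x + U * (x * U) + V * (x * V) + U * (V * (x * (V * U))))"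

lemma quarter: "(1/4) *\<^sub>R (A + (A + (A + A))) = (A :: 'h cop)"
proof -
  have "A + (A + (A + A)) = 4 *\<^sub>R A"
    using scaleR_add_left[of 2 2 A] by (simp add: scaleR_2 add.assoc)
  then show ?thesis by simp
qed

context
  fixes U V
  assumes U: "U \<in> S0" and V: "V \<in> S0" and UV: "U * V = - (V * U)"
begin

lemma frame_rules:
  "V * U = - (U * V)" "V * (U * A) = - (U * (V * A))" "U * U = 1" "V * V = 1" "U * (U * A) = A" "V * (V * A) = A"
proof -
  show 1: "V * U = - (U * V)" using UV by simp
  show "V * (U * A) = - (U * (V * A))"
    using mult_left_assoc[OF 1, of A] by (simp add: mult.assoc)
qed (use S0D[OF U] S0D[OF V] in auto)

lemma N0_rules:
  assumes "a \<in> N0 U V"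
  shows "U * a = a * U" "V * a = a * V" "U * (a * A) = a * (U * A)" "V * (a * A) = a * (V * A)" "a \<in> M"
  using assms mult_left_commute'[of U a] mult_left_commute'[of V a] by (auto simp: N0_def)

lemma E0_N0: "x \<in> M \<Longrightarrow> E0 U V x \<in> N0 U V"
  using S0D[OF U] S0D[OF V]
  by (simp add: N0_def E0_def distrib_left distrib_right left_diff_distrib right_diff_distrib mult.assoc frame_rules algebra_simps)

text \<open>The coordinates of \<open>x\<close> with respect to \<open>1\<close>, \<open>U\<close>,
  \<open>V\<close>, \<open>U * V\<close> over the commutant; each is the expectation of
  \<open>x\<close> times the inverse of the basis element, whence \<open>V * U\<close> in the last
  one.\<close>

lemma E0_decomp: "x = E0 U V x + E0 U V (x * U) * U + E0 U V (x * V) * V + E0 U V (x * (V * U)) * (U * V)"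
proof -
  have "E0 U V x + E0 U V (x * U) * U + E0 U V (x * V) * V + E0 U V (x * (V * U)) * (U * V) = (1/4) *\<^sub>R (x + (x + (x + x)))"
    unfolding E0_def mult_scaleR_left scaleR_add_right[symmetric]
    by (simp add: distrib_left distrib_right left_diff_distrib right_diff_distrib mult.assoc frame_rules algebra_simps)
  then show ?thesis by (simp add: quarter)
qed

lemma E0_coeffs:
  assumes "a \<in> N0 U V" "b \<in> N0 U V" "c \<in> N0 U V" "d \<in> N0 U V"
  defines "x \<equiv> a + b * U + c * V + d * (U * V)"
  shows "E0 U V x = a" "E0 U V (x * U) = b" "E0 U V (x * V) = c" "E0 U V (x * (V * U)) = d"
  unfolding E0_def x_def
  using quarter[of a] quarter[of b] quarter[of c] quarter[of d]
  by (simp_all add: distrib_left distrib_right left_diff_distrib right_diff_distrib mult.assoc frame_rules N0_rules[OF assms(1)] N0_rules[OF assms(2)]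
      N0_rules[OF assms(3)] N0_rules[OF assms(4)] add_ac)

text \<open>The algebra is generated by \<open>U\<close>, \<open>V\<close> and their commutant. In
  combination with \<open>center\<close> this makes such a \<open>K\<close> scalar.\<close>

lemma central_commute:
  assumes K: "K \<in> M" "K * U = U * K" "K * V = V * K" and h: "\<And>h. h \<in> N0 U V \<Longrightarrow> star h = h \<Longrightarrow> K * h = h * K" and x: "x \<in> M"
  shows "K * x = x * K"
proof -
  have all: "K * n = n * K" if n: "n \<in> N0 U V" for n
  proof -
    define r q where "r = (1/2) *\<^sub>R (n + star n)" and "q = cscale (- \<i> / 2) (n - star n)"
    have sn: "star n \<in> N0 U V"
      using N0_star[OF n] S0D[OF U] S0D[OF V] by simp
    have "r \<in> N0 U V" "star r = r" "q \<in> N0 U V" "star q = q"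
      using n sn by (auto simp: r_def q_def cscale_diff cscale_uminus add.commute intro!: N0_scaleR N0_add N0_cscale N0_diff)
    then have "K * r = r * K" "K * q = q * K" using h by auto
    moreover have "n = r + cscale \<i> q"
      by (simp add: r_def q_def cscale_diff)
        (simp add: cscale_add flip: cscale_of_real cscale_add_left)
    ultimately show ?thesis
      by (simp add: distrib_left distrib_right)
  qed
  have KU: "K * (a * U) = a * U * K" "K * (a * V) = a * V * K" "K * (a * (U * V)) = a * (U * V) * K" if "a \<in> N0 U V" for a
    using mult_left_commute'[OF all[OF that]] K mult_left_commute'[OF K(2)] by (simp_all add: mult.assoc)
  show ?thesis
    by (subst (1 2) E0_decomp[of x])
      (use x S0D[OF U] S0D[OF V] in \<open>simp add: distrib_left distrib_right all KU E0_N0\<close>)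
qed

end

end

section \<open>Rigidity of fixed symmetries and the orientation of a triple\<close>

context factor
begin

text \<open>The part \<open>r\<close> of \<open>z\<close> that anticommutes with \<open>Z\<close>
  belongs to \<open>AC Z\<close> and is orthogonal to the rest of \<open>z\<close>, so
  \<open>tr (r * r) = tr (z * r) = 0\<close>.\<close>

lemma orth_AC_commute:
  assumes Z: "Z \<in> S0" and z: "z \<in> M" "star z = z" and orth: "\<And>x. x \<in> AC Z \<Longrightarrow> tr (z * x) = 0"
  shows "z * Z = Z * z"
proof -
  note SD = S0D[OF Z]
  define r s where "r = (1/2) *\<^sub>R (z - Z * (z * Z))" and "s = (1/2) *\<^sub>R (z + Z * (z * Z))"
  have zrs: "z = s + r"
    by (simp add: r_def s_def scaleR_2[symmetric] flip: scaleR_add_right)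
  have M: "r \<in> M" "star r = r" "s \<in> M" using z SD by (auto simp: r_def s_def mult.assoc)
  have rZ: "r * Z = - (Z * r)"
    using SD by (simp add: r_def left_diff_distrib right_diff_distrib mult.assoc flip: scaleR_minus_right)
  have sZ: "s * Z = Z * s"
    using SD by (simp add: s_def distrib_left distrib_right mult.assoc add.commute)
  have "tr (z * r) = 0"
    using M rZ by (intro orth) (simp add: AC_def)
  moreover have "tr (s * r) = 0"
    using M rZ sZ SD by (intro tr_anti[of _ _ Z]) auto
  moreover have "z * r = s * r + r * r"
    by (simp add: zrs distrib_right)
  ultimately have "tr (r * r) = 0"
    using M by (simp add: tr_simps)
  then have "r = 0" using M tr_square_eq_0 by blast
  then show ?thesis using zrs sZ by simp
qed

lemma scalar_eq_0:
  assumes "z = cscale c 1" "star z = z" "z \<in> M" "tr z = 0"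
  shows "z = 0"
proof -
  have tr: "tr (cscale d 1) = Re d" for d
  proof -
    have "cscale (of_real (Re d) + \<i> * of_real (Im d)) 1 = Re d *\<^sub>R 1 + cscale \<i> (Im d *\<^sub>R (1 :: 'h cop))"
      unfolding cscale_add_left cscale_of_real using cscale_simps(3)[of \<i> "of_real (Im d)" "1 :: 'h cop"]
      by (simp only: cscale_of_real)
    moreover have "of_real (Re d) + \<i> * of_real (Im d) = d"
      by (rule complex_eq[symmetric])
    ultimately have "cscale d 1 = Re d *\<^sub>R 1 + cscale \<i> (Im d *\<^sub>R (1 :: 'h cop))"
      by simp
    then show ?thesis
      using tr_imag[of "Im d *\<^sub>R 1"] tr_add[of "Re d *\<^sub>R 1" "cscale \<i> (Im d *\<^sub>R 1)"] tr_scaleR[OF one_M]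
      by simp
  qed
  have "Re c = 0" using assms(1,4) tr by simp
  \<comment> \<open>\<open>tr\<close> sees only the real part of a scalar, so the imaginary part of
    \<open>c\<close> is read off from \<open>\<i> z\<close>.\<close>
  moreover have "tr (cscale \<i> z) = 0" using tr_imag assms by blast
  then have "Im c = 0" using tr[of "\<i> * c"] assms(1) by simp
  ultimately have "c = 0" by (simp add: complex_eq_iff)
  then show ?thesis using assms(1) by simp
qed

text \<open>An element that anticommutes with both \<open>U\<close> and \<open>V\<close> commutes
  with \<open>U * V\<close>; multiplying it by \<open>Y\<close> turns both signs into
  commutation.\<close>

lemma AC_third:
  assumes U: "U \<in> S0" and V: "V \<in> S0" and UV: "U * V = - (V * U)" and g: "g \<in> AC U" "g \<in> AC V"
  shows "\<exists>h\<in>N0 U V. star h = h \<and> g = h * cscale \<i> (U * V)"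
proof -
  define Y where "Y = cscale \<i> (U * V)"
  note Y = S0_third[OF U V UV, folded Y_def]
  note SD = S0D[OF U] S0D[OF V] S0D[OF Y(1)]
  have g': "g \<in> M" "star g = g" "g * U = - (U * g)" "g * V = - (V * g)" using g by (auto simp: AC_def)
  have gY: "g * Y = Y * g"
    using mult_left_assoc[OF g'(3), of V] g'(4) by (simp add: Y_def mult.assoc)
  have r: "Y * U = - (U * Y)" "Y * V = - (V * Y)" using Y by simp_all
  have "g * Y \<in> N0 U V"
    using g' SD mult_left_assoc[OF g'(3), of Y] mult_left_assoc[OF g'(4), of Y] by (simp add: N0_def mult.assoc r)
  moreover have "star (g * Y) = g * Y" using g' SD gY by simp
  moreover have "g = g * Y * Y" using SD by (simp add: mult.assoc)
  ultimately show ?thesis unfolding Y_def by blast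
qed

end

context sym_iso
begin

text \<open>The difference \<open>z\<close> of \<open>\<phi> W\<close> and \<open>W\<close> is
  orthogonal to every \<open>x\<close> in the span of \<open>S0\<close> with \<open>L x = x\<close>.
  These include \<open>AC U\<close> and, by \<open>fixZ\<close>, \<open>AC Z\<close> for each
  \<open>Z\<close> anticommuting with \<open>U\<close>. So \<open>z\<close> commutes with
  \<open>U\<close> and with all such \<open>Z\<close>, which makes it a scalar of trace 0.\<close>

lemma fixes_imp_identity:
  assumes U: "U \<in> S0" and fU: "\<phi> U = U" and fixd: "\<And>x. x \<in> AC U \<Longrightarrow> L x = x" and W: "W \<in> S0"
  shows "\<phi> W = W"
proof -
  define z where "z = \<phi> W - W"
  note WD = S0D[OF W] S0D[OF phi_S0[OF W]]
  have z: "z \<in> M" "star z = z" "tr z = 0" using WD by (auto simp: z_def tr_simps)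
  have orth: "tr (z * x) = 0" if "x \<in> SV" "L x = x" for x
    using L_inner[OF span_base[OF W] that(1)] that L_phi[OF W] span_M[OF that(1)] WD
    by (simp add: z_def left_diff_distrib tr_simps)
  \<comment> \<open>The part of \<open>x\<close> that anticommutes with \<open>U\<close> is fixed by
    assumption. The other part is \<open>h * U\<close> with \<open>h\<close> in the commutant of
    \<open>U\<close> and \<open>Z\<close>, and \<open>L_third\<close> compares it with
    \<open>h * Z\<close>, which anticommutes with \<open>U\<close>.\<close>
  have fixZ: "L x = x" if Z: "Z \<in> S0" "U * Z = - (Z * U)" and x: "x \<in> AC Z" for Z x
  proof -
    note SD = S0D[OF U] S0D[OF Z(1)]
    have x': "x \<in> M" "star x = x" "x * Z = - (Z * x)" "x * (Z * A) = - (Z * (x * A))" for A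
      using x mult_left_assoc[of x Z "- (Z * x)"] by (auto simp: AC_def mult.assoc)
    have UZ: "U * Z = - (Z * U)" "U * (Z * A) = - (Z * (U * A))" for A
      using Z(2) mult_left_assoc[OF Z(2)] by (auto simp: mult.assoc)
    define x1 x2 where "x1 = (1/2) *\<^sub>R (x + U * (x * U))" and "x2 = (1/2) *\<^sub>R (x - U * (x * U))"
    have xx: "x = x1 + x2"
      by (simp add: x1_def x2_def scaleR_2[symmetric] flip: scaleR_add_right)
    have x2: "x2 \<in> AC U"
      using x' SD by (simp add: AC_def x2_def left_diff_distrib right_diff_distrib mult.assoc flip: scaleR_minus_right)
    have x1: "x1 \<in> M" "star x1 = x1" "x1 * U = U * x1" "x1 * Z = - (Z * x1)"
      using x' SD by (auto simp: x1_def distrib_left distrib_right mult.assoc add.commute UZ scaleR_add_right scaleR_diff_right)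
    define h where "h = x1 * U"
    have h: "h \<in> N0 U Z" "star h = h" "x1 = h * U"
      using x1 SD mult_left_assoc[OF x1(4), of U] mult_left_assoc[OF x1(3), of U]
      by (auto simp: h_def N0_def mult.assoc UZ)
    have hZ: "h * Z \<in> AC U" by (rule N0_AC[OF h(1,2) U Z])
    have "Z \<in> AC U" using Z SD by (simp add: AC_def)
    then have fZ: "\<phi> Z = Z" using fixd L_phi[OF Z(1)] by simp
    have "L (h * U) * U = h * Z * Z"
      using L_third[OF U Z h(1,2)] fixd[OF hZ] fU fZ by simp
    then have "L (h * U) * U * U = h * Z * Z * U" by simp
    then have L1: "L x1 = x1"
      using SD h(3) by (simp add: mult.assoc)
    have "x1 \<in> AC Z" using x1 by (simp add: AC_def)
    then show ?thesis
      using L_add[OF AC_SV[OF Z(1)] AC_SV[OF U x2], of x1] L1 fixd[OF x2] xx by simp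
  qed
  have zZ: "z * Z = Z * z" if Z: "Z \<in> S0" "U * Z = - (Z * U)" for Z
    using orth_AC_commute[OF Z(1) z(1,2)] orth AC_SV[OF Z(1)] fixZ[OF Z] by blast
  have zU: "z * U = U * z"
    using orth_AC_commute[OF U z(1,2)] orth AC_SV[OF U] fixd by blast
  have zAC: "z * x = x * z" if "x \<in> AC U" for x
    using AC_span[OF U that]
  proof (induction rule: span_induct_alt)
    case (step c Z y)
    then have "z * Z = Z * z" by (intro zZ) (auto simp: AC_def)
    then show ?case using step by (simp add: distrib_left distrib_right)
  qed simp
  obtain V where V: "V \<in> S0" "V * U = - (U * V)"
    using common_anticommuting[OF U U] by blast
  have UV: "U * V = - (V * U)" using V by simp
  have zV: "z * V = V * z" using V S0D[OF V(1)] by (intro zAC) (simp add: AC_def)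
  have zh: "z * h = h * z" if h: "h \<in> N0 U V" "star h = h" for h
  proof -
    have "z * (h * V) = h * V * z" by (intro zAC N0_AC[OF h U V(1) UV])
    then have "z * h * V * V = h * z * V * V" using zV by (simp add: mult.assoc)
    then show ?thesis using S0D[OF V(1)] by (simp add: mult.assoc)
  qed
  have "\<exists>c. z = cscale c 1"
    using center[OF z(1)] central_commute[OF U V(1) UV z(1) zU zV zh] by blast
  then have "z = 0" using scalar_eq_0 z by blast
  then show ?thesis by (simp add: z_def)
qed

text \<open>The product \<open>K\<close> of the images of a triple, times \<i>, is a central
  symmetry, hence the sign \<kappa>; it compares the orientation of the image triple with that of
  the original. The same computation shows that \<open>frame_map\<close> reaches all self-adjoint
  elements of the new commutant.\<close>

lemma third_image:
  assumes U: "U \<in> S0" and V: "V \<in> S0" and UV: "U * V = - (V * U)"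
  defines "Y \<equiv> cscale \<i> (U * V)"
  shows "\<exists>\<kappa>::real. (\<kappa> = 1 \<or> \<kappa> = - 1) \<and> \<phi> Y = \<kappa> *\<^sub>R cscale \<i> (\<phi> U * \<phi> V) \<and>
    (\<forall>w\<in>N0 (\<phi> U) (\<phi> V). star w = w \<longrightarrow> (\<exists>h\<in>N0 U V. star h = h \<and> frame_map V h = w))"
proof -
  note Y = S0_third[OF U V UV, folded Y_def]
  define u v y where "u = \<phi> U" and "v = \<phi> V" and "y = \<phi> Y"
  have uS: "u \<in> S0" "v \<in> S0" "y \<in> S0" using U V Y phi_S0 by (auto simp: u_def v_def y_def)
  note SD = S0D[OF uS(1)] S0D[OF uS(2)] S0D[OF uS(3)]
  have uv: "u * v = - (v * u)" and uy: "u * y = - (y * u)" and vy: "v * y = - (y * v)"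
    using anticomm[OF U V UV] anticomm[OF U Y(1,2)] anticomm[OF V Y(1,3)] by (auto simp: u_def v_def y_def)
  have r: "v * u = - (u * v)" "v * (u * A) = - (u * (v * A))" "y * u = - (u * y)" "y * (u * A) = - (u * (y * A))"
    "y * v = - (v * y)" "y * (v * A) = - (v * (y * A))" for A
  proof -
    show 1: "v * u = - (u * v)" "y * u = - (u * y)" "y * v = - (v * y)" using uv uy vy by simp_all
    show "v * (u * A) = - (u * (v * A))" "y * (u * A) = - (u * (y * A))" "y * (v * A) = - (v * (y * A))"
      using 1[THEN mult_left_assoc, of A] by (simp_all add: mult.assoc)
  qed
  define K where "K = cscale \<i> (u * (v * y))"
  have K: "K \<in> M" "star K = K" "K * K = 1" "K * u = u * K" "K * v = v * K" "K * y = y * K"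
    using SD by (auto simp: K_def mult.assoc r cscale_uminus)
  \<comment> \<open>The element \<open>w * \<i> u v\<close> anticommutes with \<open>u\<close> and
    \<open>v\<close>, so it is \<open>L (h * Y)\<close> for some \<open>h\<close>, and
    multiplication by \<open>y\<close> produces \<open>K\<close>.\<close>
  have img: "\<exists>h\<in>N0 U V. star h = h \<and> frame_map V h = w * K" if w: "w \<in> N0 u v" "star w = w" for w
  proof -
    note wr = N0_rules[OF uS(1,2) uv w(1)]
    define g' where "g' = w * cscale \<i> (u * v)"
    have g'M: "g' \<in> M" "star g' = g'"
      using SD w wr by (auto simp: g'_def r mult.assoc cscale_uminus)
    have g'A: "g' * u = - (u * g')" "g' * v = - (v * g')"
      using SD by (simp_all add: g'_def mult.assoc r wr)
    obtain g where g: "g \<in> AC U" "g \<in> AC V" "L g = g'"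
      using L_onto_AC[OF U V, of g'] g'M g'A by (auto simp: AC_def u_def v_def)
    obtain h where h: "h \<in> N0 U V" "star h = h" "g = h * Y"
      using AC_third[OF U V UV g(1,2)] by (auto simp: Y_def)
    have "frame_map V h = L (h * Y) * y"
      using L_third[OF V Y(1,3)] N0_third(2)[OF h(1)] h(2) by (simp add: frame_map_def y_def Y_def)
    also have "\<dots> = w * K"
      using g(3) by (simp add: h(3)[symmetric] g'_def K_def mult.assoc)
    finally show ?thesis using h by blast
  qed
  \<comment> \<open>\<open>w * K\<close> is a value of \<open>frame_map\<close>; computed with
    \<open>V\<close> it commutes with \<open>u\<close> and \<open>v\<close>, computed with
    \<open>Y\<close> also with \<open>y\<close>, hence with \<open>K\<close>. Since
    \<open>K * K = 1\<close>, so does \<open>w\<close>.\<close>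
  have Kw: "K * w = w * K" if w: "w \<in> N0 u v" "star w = w" for w
  proof -
    obtain h where h: "h \<in> N0 U V" "star h = h" "frame_map V h = w * K"
      using img[OF w] by blast
    have 1: "frame_map V h * u = u * frame_map V h" "frame_map V h * v = v * frame_map V h"
      using frame_map_N0(1)[OF U V UV h(1,2)] by (auto simp: N0_def u_def v_def)
    have "frame_map V h = frame_map Y h"
      using L_third[OF V Y(1,3)] N0_third(2)[OF h(1)] h(2) by (simp add: frame_map_def Y_def)
    then have 2: "frame_map V h * y = y * frame_map V h"
      using frame_map_N0(1)[OF V Y(1,3), of h] N0_third(2)[OF h(1)] h(2) by (auto simp: N0_def y_def Y_def)
    have "frame_map V h * K = K * frame_map V h"
      unfolding K_def using 1 2 mult_left_commute'[OF 1(1)] mult_left_commute'[OF 1(2)]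
      by (simp add: mult.assoc)
    then have w': "w = K * (w * K)"
      unfolding h(3) by (simp add: mult.assoc K(3))
    have "K * w = K * K * (w * K)"
      by (subst w') (simp add: mult.assoc)
    then show ?thesis by (simp add: K(3))
  qed
  obtain c where c: "K = cscale c 1"
    using center[OF K(1)] central_commute[OF uS(1,2) uv K(1,4,5) Kw] by blast
  have ne: "(1 :: 'h cop) \<noteq> 0" using tr_one tr_zero by force
  have "cscale (c * c - 1) (1 :: 'h cop) = 0"
    using K(3) cscale_add_left[of "c * c - 1" 1 "1 :: 'h cop"] by (simp add: c)
  moreover have "d = 0" if "cscale d (1 :: 'h cop) = 0" for d
  proof (rule ccontr)
    assume "d \<noteq> 0"
    then have "(1 :: 'h cop) = cscale (inverse d) (cscale d 1)" by simp
    then show False using that ne by simp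
  qed
  ultimately have "c * c - 1 = 0" by blast
  then have "(c - 1) * (c + 1) = 0" by (simp add: algebra_simps)
  then have "c = 1 \<or> c = - 1" by (auto simp: eq_neg_iff_add_eq_0)
  then obtain \<kappa> :: real where k: "\<kappa> = 1 \<or> \<kappa> = - 1" "c = of_real \<kappa>"
    by (metis of_real_1 of_real_minus)
  then have Kk: "K = \<kappa> *\<^sub>R 1" using c by (simp add: cscale_of_real)
  have "K * y = cscale \<i> (u * v)"
    using SD by (simp add: K_def mult.assoc)
  then have "\<kappa> *\<^sub>R y = cscale \<i> (u * v)" by (simp add: Kk)
  then have "\<kappa> *\<^sub>R \<kappa> *\<^sub>R y = \<kappa> *\<^sub>R cscale \<i> (u * v)" by simp
  then have "y = \<kappa> *\<^sub>R cscale \<i> (u * v)" using k by auto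
  moreover have "\<exists>h\<in>N0 U V. star h = h \<and> frame_map V h = w" if w: "w \<in> N0 u v" "star w = w" for w
  proof -
    obtain h where h: "h \<in> N0 U V" "star h = h" "frame_map V h = \<kappa> *\<^sub>R w"
      using img[OF w] by (auto simp: Kk)
    have "frame_map V (\<kappa> *\<^sub>R h) = \<kappa> *\<^sub>R \<kappa> *\<^sub>R w"
      using frame_map_simps(3)[OF U V UV h(1,2) h(1,2), of \<kappa>] h(3) by simp
    then show ?thesis
      using h k by (intro bexI[of _ "\<kappa> *\<^sub>R h"]) (auto simp: N0_scaleR)
  qed
  ultimately show ?thesis
    using k(1) unfolding u_def v_def y_def by blast
qed

end

section \<open>Real and imaginary parts, and coordinates with respect to a frame\<close>

definition re_part :: "'h::complex_hilbert_space cop \<Rightarrow> 'h cop" where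
  "re_part x = (1/2) *\<^sub>R (x + star x)"

definition im_part :: "'h::complex_hilbert_space cop \<Rightarrow> 'h cop" where
  "im_part x = cscale (- \<i> / 2) (x - star x)"

lemma half_double: "(1/2) *\<^sub>R (x + x) = (x :: 'a::real_vector)"
  by (simp flip: scaleR_2)

lemma re_im_sa [simp]: "star (re_part x) = re_part x" "star (im_part x) = im_part x"
  by (simp_all add: re_part_def im_part_def cscale_diff cscale_uminus add.commute)

lemma re_im_decomp: "x = re_part x + cscale \<i> (im_part x)"
  by (simp add: re_part_def im_part_def cscale_diff) (simp add: cscale_add flip: cscale_of_real cscale_add_left)

lemma re_im_unique:
  assumes "star h = h" "star k = k"
  shows "re_part (h + cscale \<i> k) = h" "im_part (h + cscale \<i> k) = k"
  using cscale_add_left[of "1/2" "1/2" k]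
  by (simp_all add: re_part_def im_part_def assms cscale_uminus half_double cscale_add)

lemma re_im_add: "re_part (x + y) = re_part x + re_part y" "im_part (x + y) = im_part x + im_part y"
  by (simp_all add: re_part_def im_part_def cscale_diff cscale_add scaleR_add_right algebra_simps)

lemma re_im_scaleR: "re_part (r *\<^sub>R x) = r *\<^sub>R re_part x" "im_part (r *\<^sub>R x) = r *\<^sub>R im_part x"
  by (simp_all add: re_part_def im_part_def cscale_diff scaleR_add_right scaleR_diff_right)

lemma re_im_i: "re_part (cscale \<i> x) = - im_part x" "im_part (cscale \<i> x) = re_part x"
proof -
  have "cscale \<i> (re_part x + cscale \<i> (im_part x)) = - im_part x + cscale \<i> (re_part x)"
    by (simp add: cscale_add cscale_uminus)
  then have "cscale \<i> x = - im_part x + cscale \<i> (re_part x)"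
    unfolding re_im_decomp[symmetric] .
  then show "re_part (cscale \<i> x) = - im_part x" "im_part (cscale \<i> x) = re_part x"
    using re_im_unique[of "- im_part x" "re_part x"] by auto
qed

lemma re_im_star: "re_part (star x) = re_part x" "im_part (star x) = - im_part x"
  by (simp_all add: re_part_def im_part_def add.commute cscale_diff)

lemma cscale_split: "cscale c x = Re c *\<^sub>R x + Im c *\<^sub>R cscale \<i> x" for x :: "'h::complex_hilbert_space cop"
proof -
  have "cscale (of_real (Re c) + \<i> * of_real (Im c)) x = Re c *\<^sub>R x + cscale \<i> (cscale (of_real (Im c)) x)"
    unfolding cscale_add_left by (simp add: cscale_of_real flip: cscale_simps(3))
  then show ?thesis
    by (simp add: complex_eq[symmetric] cscale_of_real del: cscale_simps(3))
qed

context factor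
begin

text \<open>The general element in coordinates over the commutant; this replaces explicit 2 by 2
  matrices.\<close>

definition frame_sum :: "'h cop \<Rightarrow> 'h cop \<Rightarrow> 'h cop \<Rightarrow> 'h cop \<Rightarrow> 'h cop \<Rightarrow> 'h cop \<Rightarrow> 'h cop" where
  "frame_sum U V a b c d = a + b * U + c * V + d * (U * V)"

lemma frame_sum_add: "frame_sum U V a b c d + frame_sum U V a' b' c' d' = frame_sum U V (a + a') (b + b') (c + c') (d + d')"
  by (simp add: frame_sum_def distrib_right)

lemma frame_sum_cscale: "cscale k (frame_sum U V a b c d) = frame_sum U V (cscale k a) (cscale k b) (cscale k c) (cscale k d)"
  by (simp add: frame_sum_def cscale_add)

context
  fixes U V
  assumes U: "U \<in> S0" and V: "V \<in> S0" and UV: "U * V = - (V * U)"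
begin

lemma frame_sum_ex:
  assumes "x \<in> M"
  obtains a b c d where "x = frame_sum U V a b c d" "a \<in> N0 U V" "b \<in> N0 U V" "c \<in> N0 U V" "d \<in> N0 U V"
  using E0_decomp[OF U V UV, of x] E0_N0[OF U V UV] assms S0D(1)[OF U] S0D(1)[OF V]
  unfolding frame_sum_def by (metis mult_M)

lemma frame_sum_M: "a \<in> N0 U V \<Longrightarrow> b \<in> N0 U V \<Longrightarrow> c \<in> N0 U V \<Longrightarrow> d \<in> N0 U V \<Longrightarrow> frame_sum U V a b c d \<in> M"
  using S0D(1)[OF U] S0D(1)[OF V] by (auto simp: frame_sum_def N0_def)

lemma frame_sum_eq_iff:
  assumes "a \<in> N0 U V" "b \<in> N0 U V" "c \<in> N0 U V" "d \<in> N0 U V"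
    "a' \<in> N0 U V" "b' \<in> N0 U V" "c' \<in> N0 U V" "d' \<in> N0 U V"
  shows "frame_sum U V a b c d = frame_sum U V a' b' c' d' \<longleftrightarrow> a = a' \<and> b = b' \<and> c = c' \<and> d = d'"
  using E0_coeffs[OF U V UV assms(1-4)] E0_coeffs[OF U V UV assms(5-8)] unfolding frame_sum_def by metis

lemma frame_sum_star:
  assumes "a \<in> N0 U V" "b \<in> N0 U V" "c \<in> N0 U V" "d \<in> N0 U V"
  shows "star (frame_sum U V a b c d) = frame_sum U V (star a) (star b) (star c) (- star d)"
proof -
  have *: "star n \<in> N0 U V" if "n \<in> N0 U V" for n
    using N0_star[OF that] S0D[OF U] S0D[OF V] by simp
  show ?thesis
    using N0_rules[OF U V UV *[OF assms(2)]] N0_rules[OF U V UV *[OF assms(3)]] N0_rules[OF U V UV *[OF assms(4)]]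
      S0D[OF U] S0D[OF V] frame_rules[OF U V UV]
    by (simp add: frame_sum_def mult.assoc)
qed

lemma frame_sum_mult:
  assumes "a \<in> N0 U V" "b \<in> N0 U V" "c \<in> N0 U V" "d \<in> N0 U V"
    "a' \<in> N0 U V" "b' \<in> N0 U V" "c' \<in> N0 U V" "d' \<in> N0 U V"
  shows "frame_sum U V a b c d * frame_sum U V a' b' c' d' =
    frame_sum U V (a * a' + b * b' + c * c' - d * d') (a * b' + b * a' - c * d' + d * c')
      (a * c' + c * a' + b * d' - d * b') (a * d' + d * a' + b * c' - c * b')"
  unfolding frame_sum_def
  by (simp add: distrib_left distrib_right left_diff_distrib right_diff_distrib mult.assoc frame_rules[OF U V UV]
      N0_rules[OF U V UV assms(5)] N0_rules[OF U V UV assms(6)] N0_rules[OF U V UV assms(7)] N0_rules[OF U V UV assms(8)])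

lemma frame_sum_tr:
  assumes "a \<in> N0 U V" "b \<in> N0 U V" "c \<in> N0 U V" "d \<in> N0 U V"
  shows "tr (frame_sum U V a b c d) = tr a"
proof -
  note SD = S0D[OF U] S0D[OF V] and r = frame_rules[OF U V UV]
  have M: "a \<in> M" "b \<in> M" "c \<in> M" "d \<in> M" using assms by (auto simp: N0_def)
  have "tr (b * U) = 0"
    using assms SD UV by (intro tr_anti[of _ _ V]) (auto simp: N0_def)
  moreover have "tr (c * V) = 0"
    using assms SD r by (intro tr_anti[of _ _ U]) (auto simp: N0_def)
  moreover have "tr (d * (U * V)) = 0"
    using assms SD r by (intro tr_anti[of _ _ U]) (auto simp: N0_def mult.assoc)
  ultimately show ?thesis
    using M SD by (simp add: frame_sum_def tr_simps)
qed

end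

definition star_iso :: "('h cop \<Rightarrow> 'h cop) \<Rightarrow> bool" where
  "star_iso \<Phi> \<longleftrightarrow> bij_betw \<Phi> M M \<and> (\<forall>x\<in>M. \<forall>y\<in>M. \<Phi> (x + y) = \<Phi> x + \<Phi> y) \<and>
    (\<forall>c. \<forall>x\<in>M. \<Phi> (cscale c x) = cscale c (\<Phi> x)) \<and> (\<forall>x\<in>M. \<Phi> (star x) = star (\<Phi> x)) \<and>
    ((\<forall>x\<in>M. \<forall>y\<in>M. \<Phi> (x * y) = \<Phi> x * \<Phi> y) \<or> (\<forall>x\<in>M. \<forall>y\<in>M. \<Phi> (x * y) = \<Phi> y * \<Phi> x))"

text \<open>For \<open>\<epsilon> = -1\<close> the frame \<open>u, v\<close> is reversed, so that \<open>UV\<close> goes to \<open>vu\<close>.\<close>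

lemma frame_extension:
  assumes U: "U \<in> S0" and V: "V \<in> S0" and UV: "U * V = - (V * U)"
    and u: "u \<in> S0" and v: "v \<in> S0" and uv: "u * v = - (v * u)"
    and J: "bij_betw J (N0 U V) (N0 u v)"
    and J_add: "\<And>x y. x \<in> N0 U V \<Longrightarrow> y \<in> N0 U V \<Longrightarrow> J (x + y) = J x + J y"
    and J_cscale: "\<And>c x. x \<in> N0 U V \<Longrightarrow> J (cscale c x) = cscale c (J x)"
    and J_star: "\<And>x. x \<in> N0 U V \<Longrightarrow> J (star x) = star (J x)"
    and J_mult: "(\<epsilon> = 1 \<and> (\<forall>x\<in>N0 U V. \<forall>y\<in>N0 U V. J (x * y) = J x * J y)) \<or>
      (\<epsilon> = - 1 \<and> (\<forall>x\<in>N0 U V. \<forall>y\<in>N0 U V. J (x * y) = J y * J x))"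
  defines "N \<equiv> N0 U V"
  shows "\<exists>\<Phi>. star_iso \<Phi> \<and> (\<forall>a\<in>N. \<forall>b\<in>N. \<forall>c\<in>N. \<forall>d\<in>N.
    \<Phi> (frame_sum U V a b c d) = frame_sum u v (J a) (J b) (J c) (\<epsilon> *\<^sub>R J d))"
proof -
  \<comment> \<open>Reading the coordinates off with \<open>E0\<close> gives a function on all
    operators; \<open>E0_coeffs\<close> shows that it acts on coordinates as required.\<close>
  define \<Phi> where "\<Phi> x = frame_sum u v (J (E0 U V x)) (J (E0 U V (x * U))) (J (E0 U V (x * V))) (\<epsilon> *\<^sub>R J (E0 U V (x * (V * U))))" for x
  have F: "\<Phi> (frame_sum U V a b c d) = frame_sum u v (J a) (J b) (J c) (\<epsilon> *\<^sub>R J d)"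
    if "a \<in> N" "b \<in> N" "c \<in> N" "d \<in> N" for a b c d
    using E0_coeffs[OF U V UV that[unfolded N_def]] by (simp add: \<Phi>_def frame_sum_def)
  have JN: "J x \<in> N0 u v" if "x \<in> N" for x using J that by (auto simp: bij_betw_def N_def)
  have Jsc: "J (r *\<^sub>R x) = r *\<^sub>R J x" if "x \<in> N" for r x
    using J_cscale[of x "of_real r"] that by (simp add: N_def cscale_of_real)
  have Jm: "J (- x) = - J x" if "x \<in> N" for x
    using Jsc[OF that, of "-1"] by simp
  have Nc: "x + y \<in> N" "x - y \<in> N" "x * y \<in> N" "cscale c x \<in> N" "star x \<in> N" "- x \<in> N" if "x \<in> N" "y \<in> N" for x y c
    using that N0_star[of x] S0D[OF U] S0D[OF V] N0_scaleR[of x U V "-1"] unfolding N_def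
    by (auto intro: N0_add N0_diff N0_mult N0_cscale)
  have Jd: "J (x - y) = J x - J y" if "x \<in> N" "y \<in> N" for x y
    using J_add[of x "- y"] Jm that Nc by (simp add: N_def)
  have e: "\<epsilon> = 1 \<or> \<epsilon> = - 1" using J_mult by blast
  have Ja: "J (x + y) = J x + J y" if "x \<in> N" "y \<in> N" for x y using J_add that by (simp add: N_def)
  note ex = frame_sum_ex[OF U V UV, folded N_def]
  have add: "\<Phi> (x + y) = \<Phi> x + \<Phi> y" if xy: "x \<in> M" "y \<in> M" for x y
  proof -
    obtain a b c d where x: "x = frame_sum U V a b c d" "a \<in> N" "b \<in> N" "c \<in> N" "d \<in> N" using ex[OF xy(1)] by metis
    obtain a' b' c' d' where y: "y = frame_sum U V a' b' c' d'" "a' \<in> N" "b' \<in> N" "c' \<in> N" "d' \<in> N" using ex[OF xy(2)] by metis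
    show ?thesis
      using x(2-) y(2-) by (simp add: x(1) y(1) frame_sum_add F Nc Ja scaleR_add_right)
  qed
  have cs: "\<Phi> (cscale k x) = cscale k (\<Phi> x)" if xy: "x \<in> M" for x k
  proof -
    obtain a b c d where x: "x = frame_sum U V a b c d" "a \<in> N" "b \<in> N" "c \<in> N" "d \<in> N" using ex[OF xy] by metis
    show ?thesis
      using x(2-) J_cscale by (simp add: x(1) frame_sum_cscale F Nc) (simp add: N_def)
  qed
  have st: "\<Phi> (star x) = star (\<Phi> x)" if xy: "x \<in> M" for x
  proof -
    obtain a b c d where x: "x = frame_sum U V a b c d" "a \<in> N" "b \<in> N" "c \<in> N" "d \<in> N" using ex[OF xy] by metis
    have "\<epsilon> *\<^sub>R J d \<in> N0 u v" using JN[OF x(5)] by (rule N0_scaleR)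
    then show ?thesis
      using x(2-) J_star[folded N_def] JN
      by (simp add: x(1) frame_sum_star[OF U V UV, folded N_def] frame_sum_star[OF u v uv] F Nc Jm)
  qed
  have mult: "(\<forall>x\<in>M. \<forall>y\<in>M. \<Phi> (x * y) = \<Phi> x * \<Phi> y) \<or> (\<forall>x\<in>M. \<forall>y\<in>M. \<Phi> (x * y) = \<Phi> y * \<Phi> x)"
    using J_mult
  proof (elim disjE conjE)
    assume e: "\<epsilon> = 1" and h: "\<forall>x\<in>N0 U V. \<forall>y\<in>N0 U V. J (x * y) = J x * J y"
    have "\<Phi> (x * y) = \<Phi> x * \<Phi> y" if xy: "x \<in> M" "y \<in> M" for x y
    proof -
      obtain a b c d where x: "x = frame_sum U V a b c d" "a \<in> N" "b \<in> N" "c \<in> N" "d \<in> N" using ex[OF xy(1)] by metis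
      obtain a' b' c' d' where y: "y = frame_sum U V a' b' c' d'" "a' \<in> N" "b' \<in> N" "c' \<in> N" "d' \<in> N" using ex[OF xy(2)] by metis
      show ?thesis
        using x(2-) y(2-) h[folded N_def]
        by (simp add: x(1) y(1) frame_sum_mult[OF U V UV, folded N_def] frame_sum_mult[OF u v uv] F Nc Ja Jd e JN)
    qed
    then show ?thesis by blast
  next
    assume e: "\<epsilon> = - 1" and h: "\<forall>x\<in>N0 U V. \<forall>y\<in>N0 U V. J (x * y) = J y * J x"
    have "\<Phi> (x * y) = \<Phi> y * \<Phi> x" if xy: "x \<in> M" "y \<in> M" for x y
    proof -
      obtain a b c d where x: "x = frame_sum U V a b c d" "a \<in> N" "b \<in> N" "c \<in> N" "d \<in> N" using ex[OF xy(1)] by metis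
      obtain a' b' c' d' where y: "y = frame_sum U V a' b' c' d'" "a' \<in> N" "b' \<in> N" "c' \<in> N" "d' \<in> N" using ex[OF xy(2)] by metis
      have neg: "- J d \<in> N0 u v" "- J d' \<in> N0 u v"
        using N0_scaleR[OF JN[OF x(5)], of "-1"] N0_scaleR[OF JN[OF y(5)], of "-1"] by auto
      show ?thesis
        using x(2-) y(2-) h[folded N_def] neg
        by (simp add: x(1) y(1) frame_sum_mult[OF U V UV, folded N_def] frame_sum_mult[OF u v uv] F Nc Ja Jd e JN algebra_simps)
    qed
    then show ?thesis by blast
  qed
  have bij: "bij_betw \<Phi> M M"
  proof (rule bij_betwI')
    fix x y assume xy: "x \<in> M" "y \<in> M"
    obtain a b c d where x: "x = frame_sum U V a b c d" "a \<in> N" "b \<in> N" "c \<in> N" "d \<in> N" using ex[OF xy(1)] by metis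
    obtain a' b' c' d' where y: "y = frame_sum U V a' b' c' d'" "a' \<in> N" "b' \<in> N" "c' \<in> N" "d' \<in> N" using ex[OF xy(2)] by metis
    have "\<epsilon> *\<^sub>R J d \<in> N0 u v" "\<epsilon> *\<^sub>R J d' \<in> N0 u v" using JN x y N0_scaleR by auto
    moreover have "J n = J m \<longleftrightarrow> n = m" if "n \<in> N" "m \<in> N" for n m
      using J that by (auto simp: bij_betw_def N_def inj_on_def)
    ultimately show "\<Phi> x = \<Phi> y \<longleftrightarrow> x = y"
      using x(2-) y(2-) e by (auto simp: x(1) y(1) F frame_sum_eq_iff[OF U V UV, folded N_def] frame_sum_eq_iff[OF u v uv] JN)
  next
    fix x assume xy: "x \<in> M"
    obtain a b c d where x: "x = frame_sum U V a b c d" "a \<in> N" "b \<in> N" "c \<in> N" "d \<in> N" using ex[OF xy] by metis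
    show "\<Phi> x \<in> M"
      using x(2-) JN N0_scaleR by (simp add: x(1) F frame_sum_M[OF u v uv])
  next
    fix y assume "y \<in> M"
    then obtain a b c d where y: "y = frame_sum u v a b c d" "a \<in> N0 u v" "b \<in> N0 u v" "c \<in> N0 u v" "d \<in> N0 u v"
      using frame_sum_ex[OF u v uv] by metis
    have "\<exists>n\<in>N. J n = m" if "m \<in> N0 u v" for m
      using J that unfolding bij_betw_def N_def by (metis imageE)
    then obtain a' b' c' d' where "a' \<in> N" "J a' = a" "b' \<in> N" "J b' = b" "c' \<in> N" "J c' = c" "d' \<in> N" "J d' = \<epsilon> *\<^sub>R d"
      using y N0_scaleR by metis
    then show "\<exists>x\<in>M. y = \<Phi> x"
      using e by (intro bexI[of _ "frame_sum U V a' b' c' d'"]) (auto simp: F y(1) intro!: frame_sum_M[OF U V UV, folded N_def])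
  qed
  show ?thesis
    unfolding star_iso_def
    by (intro exI[of _ \<Phi>] conjI bij mult ballI allI add cs st F)
qed

end

section \<open>The Jordan isomorphism between the commutants\<close>

context sym_iso
begin

text \<open>The complex-linear extension of \<open>frame_map\<close> from the self-adjoint elements
  to the whole commutant.\<close>

definition J :: "'h cop \<Rightarrow> 'h cop \<Rightarrow> 'h cop" where
  "J V x = frame_map V (re_part x) + cscale \<i> (frame_map V (im_part x))"

context
  fixes U V
  assumes U: "U \<in> S0" and V: "V \<in> S0" and UV: "U * V = - (V * U)"
begin

lemma re_im_N0: "x \<in> N0 U V \<Longrightarrow> re_part x \<in> N0 U V" "x \<in> N0 U V \<Longrightarrow> im_part x \<in> N0 U V"
  using N0_star[of x U V] S0D(2)[OF U] S0D(2)[OF V]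
  by (auto simp: re_part_def im_part_def intro!: N0_scaleR N0_add N0_cscale N0_diff)

lemma J_sa: 
  assumes "h \<in> N0 U V" "star h = h" shows "J V h = frame_map V h"
proof -
  have "re_part h = h" "im_part h = 0"
    using re_im_unique[of h 0] assms by auto
  moreover have "frame_map V 0 = 0"
    using frame_map_simps(3)[OF U V UV assms assms, of 0] by simp
  ultimately show ?thesis by (simp add: J_def)
qed

lemma J_add: "x \<in> N0 U V \<Longrightarrow> y \<in> N0 U V \<Longrightarrow> J V (x + y) = J V x + J V y"
  by (simp add: J_def re_im_add frame_map_simps[OF U V UV] re_im_N0 cscale_add)

lemma J_scaleR: "x \<in> N0 U V \<Longrightarrow> J V (r *\<^sub>R x) = r *\<^sub>R J V x"
  using frame_map_simps(3)[OF U V UV, of "re_part x" "re_part x" r] frame_map_simps(3)[OF U V UV, of "im_part x" "im_part x" r]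
  by (simp add: J_def re_im_scaleR re_im_N0 scaleR_add_right)

lemma J_i: "x \<in> N0 U V \<Longrightarrow> J V (cscale \<i> x) = cscale \<i> (J V x)"
  using frame_map_simps(3)[OF U V UV, of "im_part x" "im_part x" "-1"]
  by (simp add: J_def re_im_i re_im_N0 cscale_add cscale_uminus)

lemma J_cscale: "x \<in> N0 U V \<Longrightarrow> J V (cscale c x) = cscale c (J V x)"
  by (subst (1 2) cscale_split) (simp add: J_add J_scaleR J_i N0_scaleR N0_cscale)

lemma frame_map_sa: "x \<in> N0 U V \<Longrightarrow> star x = x \<Longrightarrow> star (frame_map V x) = frame_map V x"
  using frame_map_N0(2)[OF U V UV] .

lemma J_star: "x \<in> N0 U V \<Longrightarrow> J V (star x) = star (J V x)"
  using frame_map_simps(3)[OF U V UV, of "im_part x" "im_part x" "-1"]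
  by (simp add: J_def re_im_star re_im_N0 frame_map_sa cscale_uminus)

lemma J_N0: "x \<in> N0 U V \<Longrightarrow> J V x \<in> N0 (\<phi> U) (\<phi> V)"
  unfolding J_def using frame_map_N0(1)[OF U V UV] by (auto intro!: N0_add N0_cscale simp: re_im_N0)

lemma frame_map_anticomm:
  assumes h: "h \<in> N0 U V" "star h = h" and k: "k \<in> N0 U V" "star k = k"
  shows "frame_map V (h * k + k * h) = frame_map V h * frame_map V k + frame_map V k * frame_map V h"
proof -
  have hk: "h + k \<in> N0 U V" "star (h + k) = h + k" using h k by (auto intro: N0_add)
  have sq: "h * h \<in> N0 U V" "k * k \<in> N0 U V" "h * k + k * h \<in> N0 U V" using h k by (auto intro!: N0_mult N0_add)
  have "(h + k) * (h + k) = (h * h + k * k) + (h * k + k * h)"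
    by (simp add: distrib_left distrib_right)
  then have "frame_map V ((h + k) * (h + k)) = frame_map V (h * h) + frame_map V (k * k) + frame_map V (h * k + k * h)"
    using h k sq by (simp add: frame_map_simps(1)[OF U V UV] N0_add add.commute)
  moreover have "frame_map V ((h + k) * (h + k)) = (frame_map V h + frame_map V k) * (frame_map V h + frame_map V k)"
    by (simp only: frame_map_square[OF U V UV hk] frame_map_simps(1)[OF U V UV h k])
  ultimately show ?thesis
    using h k by (simp add: frame_map_square[OF U V UV] distrib_left distrib_right)
qed

lemma J_square:
  assumes x: "x \<in> N0 U V" shows "J V (x * x) = J V x * J V x"
proof -
  define h k where "h = re_part x" and "k = im_part x"
  have h: "h \<in> N0 U V" "star h = h" and k: "k \<in> N0 U V" "star k = k" 
    using x re_im_N0 by (auto simp: h_def k_def)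
  have xe: "x = h + cscale \<i> k" unfolding h_def k_def by (rule re_im_decomp)
  have "x * x = (h * h - k * k) + cscale \<i> (h * k + k * h)"
    by (simp add: xe distrib_left distrib_right cscale_add cscale_uminus)
  then have "re_part (x * x) = h * h - k * k" "im_part (x * x) = h * k + k * h"
    using re_im_unique[of "h * h - k * k" "h * k + k * h"] h k by (auto simp: add.commute)
  then have "J V (x * x) = frame_map V h * frame_map V h - frame_map V k * frame_map V k + cscale \<i> (frame_map V h * frame_map V k + frame_map V k * frame_map V h)"
    using h k frame_map_anticomm[OF h k] frame_map_square[OF U V UV h] frame_map_square[OF U V UV k]
    by (simp add: J_def frame_map_simps(2)[OF U V UV] N0_mult)
  moreover have "J V x = frame_map V h + cscale \<i> (frame_map V k)"
    by (simp add: J_def h_def k_def)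
  ultimately show ?thesis
    by (simp add: distrib_left distrib_right cscale_add cscale_uminus)
qed

lemma J_tr: 
  assumes "x \<in> N0 U V" shows "tr (J V x) = tr x"
proof -
  have h: "re_part x \<in> N0 U V" "im_part x \<in> N0 U V" using assms re_im_N0 by auto
  then have M: "re_part x \<in> M" "im_part x \<in> M" "frame_map V (re_part x) \<in> M" "frame_map V (im_part x) \<in> M"
    using frame_map_N0(1)[OF U V UV] by (auto simp: N0_def)
  have "tr (J V x) = tr (frame_map V (re_part x))"
    using M tr_imag[of "frame_map V (im_part x)"] frame_map_sa[OF h(2)] by (simp add: J_def tr_simps)
  also have "\<dots> = tr (re_part x)"
    using frame_map_tr[OF U V UV h(1)] by simp
  also have "\<dots> = tr (re_part x + cscale \<i> (im_part x))"
    using M tr_imag[of "im_part x"] by (simp add: tr_simps)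
  finally show ?thesis unfolding re_im_decomp[symmetric] .
qed

text \<open>Injectivity on self-adjoint elements holds because \<open>frame_map\<close> preserves
  squares and traces, hence \<open>tr (h * h)\<close>, and the trace is faithful. Surjectivity is
  part of \<open>third_image\<close>.\<close>

lemma J_bij: "bij_betw (J V) (N0 U V) (N0 (\<phi> U) (\<phi> V))"
proof -
  note P = S0D[OF phi_S0[OF U]] S0D[OF phi_S0[OF V]]
  have sg0: "h = 0" if h: "h \<in> N0 U V" "star h = h" "frame_map V h = 0" for h
  proof -
    have hh: "h * h \<in> N0 U V" "star (h * h) = h * h" using h by (auto intro: N0_mult)
    have "tr (h * h) = 0"
      using frame_map_tr[OF U V UV hh] frame_map_square[OF U V UV h(1,2)] h(3) by simp
    then show ?thesis using h tr_square_eq_0[of h] by (auto simp: N0_def)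
  qed
  have inj: "inj_on (J V) (N0 U V)"
  proof
    fix x y assume xy: "x \<in> N0 U V" "y \<in> N0 U V" "J V x = J V y"
    define z where "z = x - y"
    have z: "z \<in> N0 U V" using xy by (simp add: z_def N0_diff)
    have "J V z = 0"
      using J_add[of x "(-1) *\<^sub>R y"] J_scaleR[of y "-1"] xy N0_scaleR[of y U V "-1"] by (simp add: z_def)
    then have "frame_map V (re_part z) + cscale \<i> (frame_map V (im_part z)) = 0" by (simp add: J_def)
    then have "re_part 0 = frame_map V (re_part z)" "im_part 0 = frame_map V (im_part z)"
      using re_im_unique[of "frame_map V (re_part z)" "frame_map V (im_part z)"] frame_map_sa re_im_N0[OF z] by auto
    then have "frame_map V (re_part z) = 0" "frame_map V (im_part z) = 0"
      by (simp_all add: re_part_def im_part_def)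
    then have "re_part z = 0" "im_part z = 0" using sg0 re_im_N0[OF z] by auto
    then have "z = 0" using re_im_decomp[of z] by simp
    then show "x = y" by (simp add: z_def)
  qed
  have "w \<in> J V ` N0 U V" if w: "w \<in> N0 (\<phi> U) (\<phi> V)" for w
  proof -
    have sw: "star w \<in> N0 (\<phi> U) (\<phi> V)" using N0_star[OF w] P by simp
    have hw: "re_part w \<in> N0 (\<phi> U) (\<phi> V)" "im_part w \<in> N0 (\<phi> U) (\<phi> V)"
      using w sw by (auto simp: re_part_def im_part_def intro!: N0_scaleR N0_add N0_cscale N0_diff)
    obtain h where h: "h \<in> N0 U V" "star h = h" "frame_map V h = re_part w"
      using third_image[OF U V UV] hw(1) re_im_sa(1) by metis
    obtain k where k: "k \<in> N0 U V" "star k = k" "frame_map V k = im_part w"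
      using third_image[OF U V UV] hw(2) re_im_sa(2) by metis
    have "J V (h + cscale \<i> k) = w"
      using re_im_decomp[of w] re_im_unique[OF h(2) k(2)] h k by (simp add: J_def)
    then show ?thesis using h k by (intro image_eqI[of _ _ "h + cscale \<i> k"]) (auto intro!: N0_add N0_cscale)
  qed
  then show ?thesis
    using inj J_N0 unfolding bij_betw_def by blast
qed

text \<open>Primeness of the target commutant is inherited from the factor: in coordinates every
  \<open>m\<close> is a combination of frame elements over the commutant, and \<open>y\<close>
  commutes with the frame, so vanishing of \<open>x * n * y\<close> on the commutant extends to all
  \<open>m\<close>.\<close>

lemma J_hom_or_anti:
  "(\<forall>x\<in>N0 U V. \<forall>y\<in>N0 U V. J V (x * y) = J V x * J V y) \<or> (\<forall>x\<in>N0 U V. \<forall>y\<in>N0 U V. J V (x * y) = J V y * J V x)"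
proof -
  note u = phi_S0[OF U] phi_S0[OF V] anticomm[OF U V UV]
  interpret jordan_onto_prime "N0 U V" "N0 (\<phi> U) (\<phi> V)" "J V"
  proof
    show "J V ` N0 U V = N0 (\<phi> U) (\<phi> V)" using J_bij by (simp add: bij_betw_def)
    show "x = 0 \<or> y = 0"
      if x: "x \<in> N0 (\<phi> U) (\<phi> V)" and y: "y \<in> N0 (\<phi> U) (\<phi> V)" and 0: "\<And>m. m \<in> N0 (\<phi> U) (\<phi> V) \<Longrightarrow> x * m * y = 0" for x y
    proof (rule prime)
      show "x \<in> M" "y \<in> M" using x y by (auto simp: N0_def)
      fix m assume "m \<in> M"
      then obtain a b c d where m: "m = frame_sum (\<phi> U) (\<phi> V) a b c d" "a \<in> N0 (\<phi> U) (\<phi> V)" "b \<in> N0 (\<phi> U) (\<phi> V)"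
        "c \<in> N0 (\<phi> U) (\<phi> V)" "d \<in> N0 (\<phi> U) (\<phi> V)"
        using frame_sum_ex[OF u] by metis
      have z: "x * (n * y) = 0" "x * (n * (y * A)) = 0" if "n \<in> N0 (\<phi> U) (\<phi> V)" for n A
        using 0[OF that] by (simp_all add: mult.assoc) (metis mult.assoc mult_zero_left)
      show "x * m * y = 0"
        unfolding m(1) frame_sum_def using m(2-)
        by (simp add: distrib_left distrib_right mult.assoc N0_rules[OF u y] z)
    qed
  next
    fix x :: "'h cop" assume "x \<in> N0 U V" then show "- x \<in> N0 U V" using N0_scaleR[of x U V "-1"] by simp
  next
    fix x :: "'h cop" assume "x \<in> N0 (\<phi> U) (\<phi> V)" then show "- x \<in> N0 (\<phi> U) (\<phi> V)" using N0_scaleR[of x _ _ "-1"] by simp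
  qed (auto intro: N0_add N0_mult J_add J_square)
  show ?thesis by (rule hom_or_anti)
qed

end

end

section \<open>Implementation by automorphisms and antiautomorphisms\<close>

context factor
begin

text \<open>Conjugation by \<open>V\<close> splits \<open>x\<close> into a part commuting with
  \<open>V\<close>, a multiple of \<open>V\<close>, and a part anticommuting with \<open>V\<close>,
  a multiple of \<open>\<i> U V\<close>.\<close>

lemma AC_decomp:
  assumes U: "U \<in> S0" and V: "V \<in> S0" and UV: "U * V = - (V * U)" and x: "x \<in> AC U"
  shows "\<exists>h\<in>N0 U V. \<exists>k\<in>N0 U V. star h = h \<and> star k = k \<and> x = h * V + k * cscale \<i> (U * V)"
proof -
  note SD = S0D[OF U] S0D[OF V]
  have x': "x \<in> M" "star x = x" "x * U = - (U * x)" "x * (U * A) = - (U * (x * A))" for A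
    using x mult_left_assoc[of x U "- (U * x)"] by (auto simp: AC_def mult.assoc)
  note r = frame_rules[OF U V UV]
  define x1 x2 where "x1 = (1/2) *\<^sub>R (x + V * (x * V))" and "x2 = (1/2) *\<^sub>R (x - V * (x * V))"
  have xx: "x = x1 + x2"
    by (simp add: x1_def x2_def scaleR_2[symmetric] flip: scaleR_add_right)
  have x2: "x2 \<in> M" "star x2 = x2" "x2 * U = - (U * x2)" "x2 * V = - (V * x2)"
    using x' SD r by (auto simp: x2_def left_diff_distrib right_diff_distrib mult.assoc scaleR_diff_right)
  have x1: "x1 \<in> M" "star x1 = x1" "x1 * V = V * x1" "x1 * U = - (U * x1)"
    using x' SD r by (auto simp: x1_def distrib_left distrib_right mult.assoc add.commute scaleR_add_right scaleR_diff_right)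
  have h: "x1 * V \<in> N0 U V" "star (x1 * V) = x1 * V" "x1 = x1 * V * V"
    using x1 SD r mult_left_assoc[OF x1(4), of V] mult_left_commute'[OF x1(3)] by (auto simp: N0_def mult.assoc)
  obtain k where "k \<in> N0 U V" "star k = k" "x2 = k * cscale \<i> (U * V)"
    using AC_third[OF U V UV, of x2] x2 by (auto simp: AC_def)
  then show ?thesis
    using h xx by metis
qed

lemma star_iso_S0:
  assumes \<Phi>: "star_iso \<Phi>" and tr: "\<And>x. x \<in> M \<Longrightarrow> tr (\<Phi> x) = tr x"
  shows "\<Phi> ` S0 = S0"
proof -
  have P: "bij_betw \<Phi> M M" and P_star: "\<And>x. x \<in> M \<Longrightarrow> \<Phi> (star x) = star (\<Phi> x)"
    and P_sq: "\<And>x. x \<in> M \<Longrightarrow> \<Phi> (x * x) = \<Phi> x * \<Phi> x"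
    using \<Phi> unfolding star_iso_def by blast+
  have inj: "\<Phi> x = \<Phi> y \<longleftrightarrow> x = y" if "x \<in> M" "y \<in> M" for x y
    using P that by (auto simp: bij_betw_def inj_on_def)
  have PM: "\<Phi> x \<in> M" if "x \<in> M" for x using P that by (auto simp: bij_betw_def)
  have ex: "\<exists>x\<in>M. \<Phi> x = y" if "y \<in> M" for y using P that unfolding bij_betw_def by (metis imageE)
  have one: "\<Phi> 1 = 1"
  proof -
    obtain e where e: "e \<in> M" "\<Phi> e = 1" using ex[OF one_M] by blast
    have "\<Phi> (e * 1) = \<Phi> e * \<Phi> 1 \<or> \<Phi> (e * 1) = \<Phi> 1 * \<Phi> e"
      using \<Phi> e(1) one_M unfolding star_iso_def by blast
    then show ?thesis using e by simp
  qed
  have iff: "\<Phi> x \<in> S0 \<longleftrightarrow> x \<in> S0" if x: "x \<in> M" for x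
  proof -
    have "star (\<Phi> x) = \<Phi> x \<longleftrightarrow> star x = x" "\<Phi> x * \<Phi> x = 1 \<longleftrightarrow> x * x = 1"
      using inj[of "star x" x] inj[of "x * x" 1] x by (simp_all add: P_star P_sq one)
    then show ?thesis
      using x PM tr by (simp add: S0_def)
  qed
  show ?thesis
  proof
    show "\<Phi> ` S0 \<subseteq> S0" using iff S0D(1) by blast
    show "S0 \<subseteq> \<Phi> ` S0"
    proof
      fix y assume y: "y \<in> S0"
      then obtain x where "x \<in> M" "\<Phi> x = y" using ex S0D(1) by blast
      then show "y \<in> \<Phi> ` S0" using iff y by blast
    qed
  qed
qed

end

context sym_iso
begin

theorem implemented:
  assumes U: "U \<in> S0"
  shows "\<exists>\<Phi> \<sigma>. star_iso \<Phi> \<and> (\<sigma> = 1 \<or> \<sigma> = - 1) \<and> (\<forall>W\<in>S0. \<phi> W = \<sigma> *\<^sub>R \<Phi> W)"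
proof -
  obtain V where V: "V \<in> S0" "V * U = - (U * V)"
    using common_anticommuting[OF U U] by blast
  have UV: "U * V = - (V * U)" using V by simp
  define Y where "Y = cscale \<i> (U * V)"
  note Y = S0_third[OF U V(1) UV, folded Y_def]
  obtain \<kappa> :: real where k: "\<kappa> = 1 \<or> \<kappa> = - 1" "\<phi> Y = \<kappa> *\<^sub>R cscale \<i> (\<phi> U * \<phi> V)"
    using third_image[OF U V(1) UV] unfolding Y_def by blast
  define N where "N = N0 U V"
  obtain \<epsilon> :: real where e: "(\<epsilon> = 1 \<and> (\<forall>x\<in>N. \<forall>y\<in>N. J V (x * y) = J V x * J V y)) \<or>
      (\<epsilon> = - 1 \<and> (\<forall>x\<in>N. \<forall>y\<in>N. J V (x * y) = J V y * J V x))"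
    using J_hom_or_anti[OF U V(1) UV] unfolding N_def by blast
  \<comment> \<open>The scaled extension must match \<phi> on the whole triple. The sign cancels on
    \<open>U\<close> and \<open>V\<close>, whose images are rescaled by \<sigma>, but the third
    member goes to \<sigma> \<epsilon> times \<open>\<i> u v\<close>, and this factor has to be
    \<kappa>.\<close>
  define \<sigma> where "\<sigma> = \<kappa> * \<epsilon>"
  have s: "\<sigma> = 1 \<or> \<sigma> = - 1" "\<sigma> * \<epsilon> = \<kappa>" "\<sigma> * \<sigma> = 1" using k e by (auto simp: \<sigma>_def)
  define u v where "u = \<sigma> *\<^sub>R \<phi> U" and "v = \<sigma> *\<^sub>R \<phi> V"
  have uv: "u \<in> S0" "v \<in> S0" "u * v = - (v * u)" "u * v = \<phi> U * \<phi> V"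
  proof -
    have "\<phi> V * \<phi> U = - (\<phi> U * \<phi> V)"
      using anticomm[OF U V(1) UV] by simp
    then show "u \<in> S0" "v \<in> S0" "u * v = - (v * u)" "u * v = \<phi> U * \<phi> V"
      using s(1) phi_S0[OF U] phi_S0[OF V(1)] S0_uminus[OF phi_S0[OF U]] S0_uminus[OF phi_S0[OF V(1)]]
      by (elim disjE; simp add: u_def v_def)+
  qed
  have Nuv: "N0 u v = N0 (\<phi> U) (\<phi> V)"
    using s(1) by (auto simp: u_def v_def N0_def)
  have "\<exists>\<Phi>. star_iso \<Phi> \<and> (\<forall>a\<in>N0 U V. \<forall>b\<in>N0 U V. \<forall>c\<in>N0 U V. \<forall>d\<in>N0 U V.
      \<Phi> (frame_sum U V a b c d) = frame_sum u v (J V a) (J V b) (J V c) (\<epsilon> *\<^sub>R J V d))"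
  proof (rule frame_extension[OF U V(1) UV uv(1-3)])
    show "bij_betw (J V) (N0 U V) (N0 u v)"
      unfolding Nuv by (rule J_bij[OF U V(1) UV])
  qed (use J_add[OF U V(1) UV] J_cscale[OF U V(1) UV] J_star[OF U V(1) UV] e[unfolded N_def] in auto)
  then obtain \<Phi> where iso: "star_iso \<Phi>" and F: "\<And>a b c d. a \<in> N \<Longrightarrow> b \<in> N \<Longrightarrow> c \<in> N \<Longrightarrow> d \<in> N \<Longrightarrow>
      \<Phi> (frame_sum U V a b c d) = frame_sum u v (J V a) (J V b) (J V c) (\<epsilon> *\<^sub>R J V d)"
    unfolding N_def by blast
  have \<Phi>: "bij_betw \<Phi> M M" "\<And>x y. x \<in> M \<Longrightarrow> y \<in> M \<Longrightarrow> \<Phi> (x + y) = \<Phi> x + \<Phi> y"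
    "\<And>c x. x \<in> M \<Longrightarrow> \<Phi> (cscale c x) = cscale c (\<Phi> x)"
    "(\<forall>x\<in>M. \<forall>y\<in>M. \<Phi> (x * y) = \<Phi> x * \<Phi> y) \<or> (\<forall>x\<in>M. \<forall>y\<in>M. \<Phi> (x * y) = \<Phi> y * \<Phi> x)"
    using iso unfolding star_iso_def by blast+
  have JN: "J V x \<in> N0 u v" if "x \<in> N" for x
    using J_N0[OF U V(1) UV] that unfolding N_def Nuv by blast
  have tr: "tr (\<Phi> x) = tr x" if xM: "x \<in> M" for x
  proof -
    obtain a b c d where x: "x = frame_sum U V a b c d" "a \<in> N" "b \<in> N" "c \<in> N" "d \<in> N"
      using frame_sum_ex[OF U V(1) UV xM] unfolding N_def by metis
    have "\<epsilon> *\<^sub>R J V d \<in> N0 u v" using JN[OF x(5)] by (rule N0_scaleR)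
    then have "tr (\<Phi> x) = tr (J V a)"
      using x(2-) JN by (simp add: x(1) F frame_sum_tr[OF uv(1-3)])
    also have "\<dots> = tr x"
      using x(2-) frame_sum_tr[OF U V(1) UV] J_tr[OF U V(1) UV] by (simp add: x(1) N_def)
    finally show ?thesis .
  qed
  have sR: "\<Phi> (r *\<^sub>R x) = r *\<^sub>R \<Phi> x" if "x \<in> M" for r x
    using \<Phi>(3)[OF that, of "of_real r"] by (simp add: cscale_of_real)
  have PM: "\<Phi> x \<in> M" if "x \<in> M" for x using \<Phi>(1) that by (auto simp: bij_betw_def)
  have trtr: "tr (\<Phi> x * \<Phi> y) = tr (x * y)" if "x \<in> M" "y \<in> M" for x y
    using \<Phi>(4) tr[of "x * y"] tr_commute[of "\<Phi> x" "\<Phi> y"] that PM by auto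
  define \<theta> where "\<theta> W = \<sigma> *\<^sub>R \<Phi> W" for W
  have neg: "uminus ` S0 = S0"
  proof
    show "S0 \<subseteq> uminus ` S0"
    proof
      fix x assume "x \<in> S0"
      then show "x \<in> uminus ` S0"
        using S0_uminus by (intro image_eqI[of _ uminus "- x"]) auto
    qed
  qed (use S0_uminus in auto)
  have chiS: "\<theta> ` S0 = S0"
  proof -
    have "\<theta> ` S0 = (\<lambda>x. \<sigma> *\<^sub>R x) ` \<Phi> ` S0" unfolding \<theta>_def by (simp add: image_image)
    then show ?thesis using s(1) neg star_iso_S0[OF iso tr] by auto
  qed
  interpret c: sym_iso M tr \<theta>
  proof
    show "tr (\<theta> A * \<theta> B) = tr (A * B)" if "A \<in> S0" "B \<in> S0" for A B
      using trtr S0D(1) that s(3) by (simp add: \<theta>_def tr_scaleR)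
  qed (rule chiS)
  interpret i: sym_iso M tr "inv_into S0 \<theta>" by (rule c.inverse_iso)
  \<comment> \<open>Dividing \<phi> by the scaled extension leaves a trace-preserving bijection of
    \<open>S0\<close> to which \<open>fixes_imp_identity\<close> applies.\<close>
  define \<psi> where "\<psi> W = inv_into S0 \<theta> (\<phi> W)" for W
  have chipsi: "\<theta> (\<psi> W) = \<phi> W" "\<psi> W \<in> S0" if "W \<in> S0" for W
    unfolding \<psi>_def using f_inv_into_f[of "\<phi> W" \<theta> S0] inv_into_into[of "\<phi> W" \<theta> S0] phi_S0[OF that] chiS by auto
  interpret p: sym_iso M tr \<psi>
  proof
    have "\<psi> ` S0 = inv_into S0 \<theta> ` \<phi> ` S0" unfolding \<psi>_def by (simp add: image_image)
    then show "\<psi> ` S0 = S0" using surj i.surj by simp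
    show "tr (\<psi> A * \<psi> B) = tr (A * B)" if "A \<in> S0" "B \<in> S0" for A B
      unfolding \<psi>_def using i.pres phi_S0 pres that by simp
  qed
  have zero: "0 \<in> N" "1 \<in> N" unfolding N_def by (simp_all add: N0_def)
  have J01: "J V 0 = 0" "J V 1 = 1"
    using J_cscale[OF U V(1) UV, of 0 0] J_sa[OF U V(1) UV, of 1] zero frame_map_one[OF V(1)] by (auto simp: N_def)
  have LV: "L (h * V) = \<theta> (h * V)" and LY: "L (h * Y) = \<theta> (h * Y)" if h: "h \<in> N" "star h = h" for h
  proof -
    have Jh: "J V h = frame_map V h" using J_sa[OF U V(1) UV] h by (simp add: N_def)
    have "\<Phi> (h * V) = frame_map V h * v"
      using F[OF zero(1) zero(1) h(1) zero(1)] by (simp add: frame_sum_def J01 Jh)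
    then show "L (h * V) = \<theta> (h * V)"
      using s(3) by (simp add: \<theta>_def v_def L_frame_map[OF V(1)])
    have ih: "cscale \<i> h \<in> N" using h by (simp add: N_def N0_cscale)
    have "\<Phi> (h * Y) = \<epsilon> *\<^sub>R cscale \<i> (frame_map V h) * (u * v)"
      using F[OF zero(1) zero(1) zero(1) ih] J_cscale[OF U V(1) UV, of h \<i>] h
      by (simp add: frame_sum_def J01 Jh Y_def N_def)
    then have "\<theta> (h * Y) = \<kappa> *\<^sub>R cscale \<i> (frame_map V h * (\<phi> U * \<phi> V))"
      by (simp add: \<theta>_def uv(4) s(2)[symmetric])
    moreover have "L (h * Y) = frame_map V h * \<phi> Y"
      using L_third[OF V(1) Y(1,3)] N0_third(2)[of h U V] h S0D[OF phi_S0[OF Y(1)]]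
      by (simp add: frame_map_def Y_def N_def mult.assoc)
    ultimately show "L (h * Y) = \<theta> (h * Y)" by (simp add: k(2))
  qed
  have LAC: "L x = \<theta> x" if x: "x \<in> AC U" for x
  proof -
    obtain h g where h: "h \<in> N" "star h = h" and g: "g \<in> N" "star g = g" and xe: "x = h * V + g * Y"
      using AC_decomp[OF U V(1) UV x] unfolding N_def Y_def by blast
    have "h * V \<in> AC U" "g * Y \<in> AC U"
      using N0_AC[OF _ h(2) U V(1) UV] N0_AC[OF _ g(2) U Y(1,2)] h g N0_third(1)[of g U V] by (auto simp: N_def Y_def)
    then have SV: "h * V \<in> SV" "g * Y \<in> SV" and M: "h * V \<in> M" "g * Y \<in> M"
      using AC_SV[OF U] by (auto simp: AC_def)
    then show ?thesis
      unfolding xe using L_add[OF SV] LV[OF h] LY[OF g] \<Phi>(2)[OF M] by (simp add: \<theta>_def scaleR_add_right)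
  qed
  have fU: "\<phi> U = \<theta> U"
    using F[OF zero(1) zero(2) zero(1) zero(1)] s(3) by (simp add: frame_sum_def J01 \<theta>_def u_def)
  have "\<psi> W = W" if W: "W \<in> S0" for W
  proof (rule p.fixes_imp_identity[OF U _ _ W])
    show "\<psi> U = U"
      unfolding \<psi>_def fU by (rule inv_into_f_f[OF c.inj U])
    fix x assume x: "x \<in> AC U"
    show "p.L x = x"
    proof (rule p.L_eqI[OF AC_SV[OF U x]])
      fix W assume W: "W \<in> S0"
      have xM: "x \<in> M" using x by (simp add: AC_def)
      have "tr (x * W) = tr (L x * \<phi> W)"
        using L_tr[OF AC_SV[OF U x] W] by simp
      also have "\<dots> = tr (\<theta> x * \<theta> (\<psi> W))"
        by (simp add: LAC[OF x] chipsi[OF W])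
      also have "\<dots> = tr (x * \<psi> W)"
        using trtr[OF xM, of "\<psi> W"] S0D(1)[OF chipsi(2)[OF W]] s(3) xM PM by (simp add: \<theta>_def tr_scaleR)
      finally show "tr (x * \<psi> W) = tr (x * W)" by simp
    qed
  qed
  then have "\<phi> W = \<sigma> *\<^sub>R \<Phi> W" if "W \<in> S0" for W
    using chipsi(1)[OF that] that by (simp add: \<theta>_def)
  then show ?thesis using iso s(1) by blast
qed

end

section \<open>Isometries preserve the trace of products\<close>

text \<open>The factor \<open>sgn (q - 1)\<close> treats the convex and the concave case at once.
  Away from 0, Taylor's formula gives both bounds. Near 0, the lower bound follows because
  \<open>F\<close> decreases towards \<open>y\<close>, and the upper bound because \<open>F\<close>
  is bounded while \<open>(s - y)\<^sup>2\<close> stays away from 0.\<close>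

lemma powr_tangent:
  fixes q y :: real
  assumes q: "0 < q" "q \<noteq> 1" and y: "0 < y" "y < 1"
  defines "F \<equiv> \<lambda>s. sgn (q - 1) * (s powr q - (y powr q + q * y powr (q - 1) * (s - y)))"
  shows "\<exists>c K. 0 < c \<and> (\<forall>s\<in>{0..1}. c * (s - y)\<^sup>2 \<le> F s \<and> F s \<le> K * (s - y)\<^sup>2)"
proof -
  \<comment> \<open>Taylor's formula is used on \<open>[a, 1]\<close> only, since at 0 the second
    derivative of \<open>s powr q\<close> may blow up or vanish.\<close>
  define a where "a = y / 2"
  have a: "0 < a" "a < y" "a < 1" using y by (auto simp: a_def)
  define d where "d m s = (if m = 0 then s powr q else if m = 1 then q * s powr (q - 1) else q * (q - 1) * s powr (q - 2))"
    for m :: nat and s :: real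
  have d: "d 0 = (\<lambda>s. s powr q)" "d (Suc 0) = (\<lambda>s. q * s powr (q - 1))"
    "d (Suc (Suc 0)) = (\<lambda>s. q * (q - 1) * s powr (q - 2))"
    by (simp_all add: d_def fun_eq_iff)
  define l u where "l = min 1 (a powr (q - 2))" and "u = max 1 (a powr (q - 2))"
  have lu: "0 < l" "0 < u" using a by (auto simp: l_def u_def)
  define k where "k = q * \<bar>q - 1\<bar> / 2"
  have k: "k > 0" using q by (simp add: k_def)
  have bounds: "l \<le> x powr (q - 2) \<and> x powr (q - 2) \<le> u" if x: "a \<le> x" "x \<le> 1" for x
  proof (cases "q \<ge> 2")
    case True
    then have "a powr (q - 2) \<le> x powr (q - 2)" "x powr (q - 2) \<le> 1 powr (q - 2)"
      using x a powr_mono2[of "q - 2" a x] powr_mono2[of "q - 2" x 1] by auto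
    then show ?thesis by (simp add: l_def u_def)
  next
    case False
    then have "x powr (q - 2) \<le> a powr (q - 2)" "1 powr (q - 2) \<le> x powr (q - 2)"
      using x a powr_mono2'[of "q - 2" a x] powr_mono2'[of "q - 2" x 1] by auto
    then show ?thesis by (simp add: l_def u_def)
  qed
  have frame_map: "sgn (q - 1) * (q - 1) = \<bar>q - 1\<bar>" by (simp add: sgn_if abs_if)
  have near: "k * l * (s - y)\<^sup>2 \<le> F s \<and> F s \<le> k * u * (s - y)\<^sup>2" if s: "a \<le> s" "s \<le> 1" for s
  proof (cases "s = y")
    case False
    have "\<forall>m t. m < 2 \<and> a \<le> t \<and> t \<le> 1 \<longrightarrow> DERIV (d m) t :> d (Suc m) t"
    proof (intro allI impI)
      fix m :: nat and t :: real assume h: "m < 2 \<and> a \<le> t \<and> t \<le> 1"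
      then have "t > 0" using a by simp
      from h consider "m = 0" | "m = 1" by linarith
      then show "DERIV (d m) t :> d (Suc m) t"
      proof cases
        case 1
        then show ?thesis using has_real_derivative_powr[OF \<open>t > 0\<close>, of q] by (simp add: d)
      next
        case 2
        then show ?thesis
          using DERIV_cmult[OF has_real_derivative_powr[OF \<open>t > 0\<close>, of "q - 1"], of q] by (simp add: d mult.assoc)
      qed
    qed
    from Taylor[OF zero_less_numeral d(1) this, where c = y and x = s] obtain t where
      t: "if s < y then s < t \<and> t < y else y < t \<and> t < s"
      and eq: "s powr q = (\<Sum>m<2. (d m y / fact m) * (s - y) ^ m) + (d 2 t / fact 2) * (s - y) ^ 2"
      using a y s False by auto
    have t': "a \<le> t" "t \<le> 1" using t s a y by (auto split: if_splits)
    have "F s = sgn (q - 1) * (q * (q - 1) * t powr (q - 2) / 2 * (s - y)\<^sup>2)"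
      unfolding F_def eq by (simp add: d lessThan_Suc numeral_2_eq_2)
    also have "\<dots> = k * t powr (q - 2) * (s - y)\<^sup>2"
      unfolding k_def frame_map[symmetric] by simp
    finally show ?thesis
      using bounds[OF t'] k by (auto intro!: mult_right_mono mult_left_mono)
  qed (use s in \<open>simp add: F_def\<close>)
  have F_dec: "F a \<le> F s" if s: "0 \<le> s" "s \<le> a" for s
  proof (rule DERIV_nonpos_imp_decreasing_open[OF s(2)])
    fix x assume x: "s < x" "x < a"
    then have x0: "x > 0" using s by simp
    have "(F has_real_derivative sgn (q - 1) * (q * x powr (q - 1) - q * y powr (q - 1))) (at x)"
      unfolding F_def using x0 by (auto intro!: derivative_eq_intros)
    moreover have "sgn (q - 1) * (q * x powr (q - 1) - q * y powr (q - 1)) \<le> 0"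
    proof (cases "q > 1")
      case True
      then have "x powr (q - 1) \<le> y powr (q - 1)" using x0 x a by (intro powr_mono2) auto
      then show ?thesis using True by simp
    next
      case False
      then have "y powr (q - 1) \<le> x powr (q - 1)" using x0 x a by (intro powr_mono2') auto
      then show ?thesis using False q by (simp add: sgn_if)
    qed
    ultimately show "\<exists>z. DERIV F x :> z \<and> z \<le> 0" by blast
  next
    show "continuous_on {s..a} F"
      unfolding F_def using s q by (intro continuous_intros continuous_on_powr') auto
  qed
  define B where "B = 1 + y powr q + q * y powr (q - 1)"
  have B: "F s \<le> B" if s: "0 \<le> s" "s \<le> 1" for s
  proof -
    have "\<bar>F s\<bar> \<le> \<bar>s powr q - (y powr q + q * y powr (q - 1) * (s - y))\<bar>"
      unfolding F_def abs_mult by (intro mult_left_le_one_le) (auto simp: sgn_if)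
    also have "\<dots> \<le> \<bar>s powr q\<bar> + (\<bar>y powr q\<bar> + \<bar>q * y powr (q - 1) * (s - y)\<bar>)"
      by (intro order.trans[OF abs_triangle_ineq4] add_left_mono abs_triangle_ineq)
    also have "\<bar>s powr q\<bar> \<le> 1"
      using s q powr_mono2[of q s 1] by simp
    also have "\<bar>q * y powr (q - 1) * (s - y)\<bar> \<le> q * y powr (q - 1)"
      using q y s unfolding abs_mult by (auto intro!: mult_right_le_one_le)
    finally show ?thesis by (simp add: B_def)
  qed
  have B0: "B > 0" using q by (simp add: B_def add_pos_nonneg)
  \<comment> \<open>On \<open>[0, a]\<close> the chain is
    \<open>F s \<ge> F a \<ge> c \<ge> c * (s - y)\<^sup>2\<close>; the factor
    \<open>(y - a)\<^sup>2\<close>, at most 1, lets the same \<open>c\<close> serve on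
    \<open>[a, 1]\<close>. The second entry of \<open>K\<close> covers
    \<open>[0, a]\<close>.\<close>
  define c K where "c = k * l * (y - a)\<^sup>2" and "K = max (k * u) (B / (y - a)\<^sup>2)"
  have c0: "0 < c" unfolding c_def using k lu a by simp
  have c1: "c \<le> k * l"
  proof -
    have "(y - a)\<^sup>2 \<le> 1" using a y by (intro power_le_one) auto
    then show ?thesis unfolding c_def using k lu by (intro mult_right_le_one_le) auto
  qed
  have "c * (s - y)\<^sup>2 \<le> F s \<and> F s \<le> K * (s - y)\<^sup>2" if s: "0 \<le> s" "s \<le> 1" for s
  proof (cases "a \<le> s")
    case True
    have "c * (s - y)\<^sup>2 \<le> k * l * (s - y)\<^sup>2" "k * u * (s - y)\<^sup>2 \<le> K * (s - y)\<^sup>2"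
      using c1 by (auto intro!: mult_right_mono simp: K_def)
    then show ?thesis using near[OF True s(2)] by linarith
  next
    case False
    then have "F a \<le> F s" using F_dec s by simp
    moreover have "c \<le> F a" using near[of a] a by (auto simp: c_def power2_commute)
    moreover have "(s - y)\<^sup>2 \<le> 1"
      using s y by (simp add: abs_square_le_1)
    then have "c * (s - y)\<^sup>2 \<le> c" using c0 by (intro mult_right_le_one_le) auto
    moreover have "F s \<le> K * (s - y)\<^sup>2"
    proof -
      have "(y - a)\<^sup>2 \<le> (s - y)\<^sup>2"
        using False a by (subst power2_commute[of s]) (intro power_mono, auto)
      then have "B / (y - a)\<^sup>2 * (y - a)\<^sup>2 \<le> K * (s - y)\<^sup>2"
        using B0 k lu by (intro mult_mono) (auto simp: K_def le_max_iff_disj)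
      then show ?thesis using B[OF s] a by simp
    qed
    ultimately show ?thesis by linarith
  qed
  then show ?thesis using c0 by (intro exI[of _ c] exI[of _ K]) auto
qed

text \<open>For \<open>q \<ge> 1\<close> this is \<open>s powr q \<le> s\<close>, for
  \<open>q < 1\<close> the tangent at 1 of a concave function, in the form of Young's inequality.
  The positive slope makes maximal distance detectable.\<close>

lemma powr_le_linear:
  fixes q s :: real
  assumes q: "0 < q" and s: "0 \<le> s" "s \<le> 1"
  shows "s powr q \<le> 1 - min 1 q * (1 - s)"
proof (cases "s = 0")
  case False
  then have s0: "s > 0" using s by simp
  show ?thesis
  proof (cases "q \<ge> 1")
    case True
    then have "s powr q \<le> s powr 1" using s0 s by (intro powr_mono') auto
    then show ?thesis using True s0 by simp
  next
    case False
    then show ?thesis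
      using Youngs_inequality_0[of q "1 - q" s 1] q s0 by (simp add: algebra_simps)
  qed
qed (use q in simp)

lemma cfc_scalar:
  fixes f :: "real \<Rightarrow> real"
  assumes f: "continuous_on UNIV f"
  shows "cfc f (y *\<^sub>R 1) = f y *\<^sub>R (1 :: 'h::complex_hilbert_space cop)"
proof -
  have A: "star (y *\<^sub>R 1 :: 'h cop) = y *\<^sub>R 1" by simp
  have "rspec (y *\<^sub>R 1 :: 'h cop) \<subseteq> {y..y}"
    by (rule rspec_interval) auto
  then have "cfc f (y *\<^sub>R 1 :: 'h cop) = cfc (\<lambda>_. f y) (y *\<^sub>R 1)"
    by (intro cfc_cong[OF A f]) auto
  then show ?thesis by (simp add: cfc_const)
qed

lemma continuous_abs_powr: "0 < p \<Longrightarrow> continuous_on UNIV (\<lambda>t :: real. \<bar>t\<bar> powr p)"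
  by (intro continuous_on_powr' continuous_intros) auto

section \<open>Traces of powers of absolute values\<close>

context factor
begin

lemma tr_cfc_mono:
  assumes B: "B \<in> M" "star B = B" and f: "continuous_on UNIV f" and g: "continuous_on UNIV g"
    and le: "\<And>s. s \<in> rspec B \<Longrightarrow> f s \<le> g s"
  shows "tr (cfc f B) \<le> tr (cfc g B)"
proof -
  define h where "h s = sqrt (max 0 (g s - f s))" for s
  have h: "continuous_on UNIV h"
    unfolding h_def by (intro continuous_intros f g)
  have "cfc h B * cfc h B = cfc (\<lambda>s. g s - f s) B"
    unfolding cfc_mult[OF B(2) h h, symmetric]
    by (rule cfc_cong[OF B(2)]) (use le f g h in \<open>auto simp: h_def intro!: continuous_intros\<close>)
  also have "\<dots> = cfc g B - cfc f B" by (rule cfc_diff[OF B(2) g f])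
  finally have "0 \<le> tr (cfc g B - cfc f B)"
    using tr_square_nonneg[OF cfc_M[OF B h] star_cfc[OF B(2) h]] by simp
  then show ?thesis using cfc_M[OF B f] cfc_M[OF B g] by (simp add: tr_simps)
qed

text \<open>The p-th power of the Lp norm. The absolute value of \<open>t\<close> gives a function
  continuous on the whole line and changes nothing on the nonnegative spectrum.\<close>

definition pow_trace :: "real \<Rightarrow> 'h cop \<Rightarrow> real" where
  "pow_trace p D = tr (cfc (\<lambda>t. \<bar>t\<bar> powr p) (cfc sqrt (D * D)))"

lemma abs_facts:
  assumes D: "D \<in> M" "star D = D" "norm D \<le> 1"
  defines "B \<equiv> cfc sqrt (D * D)"
  shows "B \<in> M" "star B = B" "B * B = D * D" "rspec B \<subseteq> {0..1}"
proof -
  have T: "D * D \<in> M" "star (D * D) = D * D" using D by auto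
  have c: "continuous_on UNIV sqrt" by (intro continuous_intros)
  show B: "B \<in> M" "star B = B"
    unfolding B_def using cfc_M[OF T c] star_cfc[OF T(2) c] by auto
  have pos: "0 \<le> s" if "s \<in> rspec (D * D)" for s
    using rspec_square[OF D(2) that] .
  have "cfc (\<lambda>s. sqrt s * sqrt s) (D * D) = cfc (\<lambda>s. s) (D * D)"
    using pos by (intro cfc_cong[OF T(2)] continuous_intros) auto
  then show BB: "B * B = D * D"
    unfolding B_def cfc_mult[OF T(2) c c, symmetric] cfc_id[OF T(2)] .
  have "norm (D * D) \<le> 1"
    by (rule order.trans[OF norm_mult_ineq]) (use D(3) in \<open>simp add: mult_le_one\<close>)
  then have "norm B \<le> 1"
    unfolding B_def using pos rspec_norm[of _ "D * D"] by (intro cfc_norm_le[OF T(2) c]) (fastforce simp: abs_if)+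
  show "rspec B \<subseteq> {0..1}"
  proof (rule rspec_interval[OF B(2)])
    fix x
    show "0 * (norm x)\<^sup>2 \<le> quad_form B x"
      unfolding B_def using quad_form_cfc_nonneg[OF T(2) c, of x] pos by simp
    have "quad_form B x \<le> norm x * norm (app B x)"
      unfolding quad_form_def by (rule Re_cinner_le)
    also have "\<dots> \<le> norm x * (norm B * norm x)"
      by (intro mult_left_mono norm_app) simp
    also have "\<dots> \<le> norm x * (1 * norm x)"
      by (intro mult_left_mono mult_right_mono \<open>norm B \<le> 1\<close>) auto
    finally show "quad_form B x \<le> 1 * (norm x)\<^sup>2" by (simp add: power2_eq_square)
  qed simp
qed

lemma cfc_quadratic:
  assumes B: "star B = B"
  shows "cfc (\<lambda>t. a + b * (t * t) + c * ((t * t) * (t * t))) B = a *\<^sub>R 1 + b *\<^sub>R (B * B) + c *\<^sub>R (B * B * (B * B))"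
  by (simp add: cfc_add[OF B] cfc_scale[OF B] cfc_const[OF B] cfc_mult[OF B] cfc_id[OF B] continuous_intros)

text \<open>A pointwise quadratic bound in the variable \<open>s = t * t\<close> passes to traces,
  because the square of the absolute value of \<open>D\<close> is \<open>D * D\<close>. The factor
  \<open>e\<close> is there so that \<open>e = -1\<close> yields lower bounds.\<close>

lemma pow_trace_le:
  assumes D: "D \<in> M" "star D = D" "norm D \<le> 1" and p: "0 < p"
    and le: "\<And>s. 0 \<le> s \<Longrightarrow> s \<le> 1 \<Longrightarrow> e * s powr (p / 2) \<le> a + b * s + c * (s * s)"
  shows "e * pow_trace p D \<le> a + b * tr (D * D) + c * tr (D * D * (D * D))"
proof -
  define B where "B = cfc sqrt (D * D)"
  note B = abs_facts[OF D, folded B_def]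
  note cp = continuous_abs_powr[OF p]
  have "tr (cfc (\<lambda>t. e * \<bar>t\<bar> powr p) B) \<le> tr (cfc (\<lambda>t. a + b * (t * t) + c * ((t * t) * (t * t))) B)"
  proof (rule tr_cfc_mono[OF B(1,2)])
    fix t assume "t \<in> rspec B"
    then have t: "0 \<le> t" "t \<le> 1" using B(4) by auto
    have "(t * t) powr (p / 2) = t powr p"
      using t by (cases "t = 0") (auto simp: powr_mult simp flip: powr_add)
    then show "e * \<bar>t\<bar> powr p \<le> a + b * (t * t) + c * ((t * t) * (t * t))"
      using le[of "t * t"] t by (simp add: mult_le_one)
  qed (intro continuous_intros cp)+
  then show ?thesis
    unfolding cfc_quadratic[OF B(2)] cfc_scale[OF B(2) cp] B(3)
    using cfc_M[OF B(1,2) cp] D by (simp add: tr_simps pow_trace_def B_def)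
qed

lemma pow_trace_scalar:
  assumes "D * D = y *\<^sub>R 1" "0 \<le> y" "0 < p"
  shows "pow_trace p D = y powr (p / 2)"
proof -
  have "cfc sqrt (D * D) = sqrt y *\<^sub>R (1 :: 'h cop)"
    unfolding assms(1) by (intro cfc_scalar continuous_intros)
  then have "pow_trace p D = tr (\<bar>sqrt y\<bar> powr p *\<^sub>R (1 :: 'h cop))"
    unfolding pow_trace_def by (simp add: cfc_scalar[OF continuous_abs_powr[OF assms(3)]])
  also have "\<dots> = y powr (p / 2)"
    using assms(2) by (simp add: tr_simps powr_half_sqrt[symmetric] powr_powr)
  finally show ?thesis .
qed

lemma pow_trace_two:
  assumes D: "D \<in> M" "star D = D" "norm D \<le> 1"
  shows "pow_trace 2 D = tr (D * D)"
proof -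
  have "pow_trace 2 D \<le> tr (D * D)"
    using pow_trace_le[OF D, of 2 1 0 1 0] by simp
  moreover have "- pow_trace 2 D \<le> - tr (D * D)"
    using pow_trace_le[OF D, of 2 "-1" 0 "-1" 0] by simp
  ultimately show ?thesis by simp
qed

text \<open>\<open>powr_tangent\<close> integrated against \<open>D * D\<close>: the deviation from
  the tangent is comparable with the squared trace distance of \<open>D * D\<close> from the scalar
  \<open>y\<close>.\<close>

lemma pow_trace_tangent:
  assumes p: "0 < p" "p \<noteq> 2" and y: "0 < y" "y < 1"
  defines "q \<equiv> p / 2"
  shows "\<exists>c K. 0 < c \<and> (\<forall>D\<in>M. star D = D \<longrightarrow> norm D \<le> 1 \<longrightarrow>
    c * tr ((D * D - y *\<^sub>R 1) * (D * D - y *\<^sub>R 1)) \<le> sgn (q - 1) * (pow_trace p D - (y powr q + q * y powr (q - 1) * (tr (D * D) - y))) \<and>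
    sgn (q - 1) * (pow_trace p D - (y powr q + q * y powr (q - 1) * (tr (D * D) - y))) \<le> K * tr ((D * D - y *\<^sub>R 1) * (D * D - y *\<^sub>R 1)))"
proof -
  have q: "0 < q" "q \<noteq> 1" using p by (auto simp: q_def)
  obtain c K where c: "0 < c" and cK: "\<forall>s\<in>{0..1}.
      c * (s - y)\<^sup>2 \<le> sgn (q - 1) * (s powr q - (y powr q + q * y powr (q - 1) * (s - y))) \<and>
      sgn (q - 1) * (s powr q - (y powr q + q * y powr (q - 1) * (s - y))) \<le> K * (s - y)\<^sup>2"
    using powr_tangent[OF q y] by blast
  have T: "c * (s - y)\<^sup>2 \<le> sgn (q - 1) * (s powr q - (y powr q + q * y powr (q - 1) * (s - y)))"
      "sgn (q - 1) * (s powr q - (y powr q + q * y powr (q - 1) * (s - y))) \<le> K * (s - y)\<^sup>2"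
    if "0 \<le> s" "s \<le> 1" for s
    using cK that by auto
  define e l where "e = sgn (q - 1)" and "l = q * y powr (q - 1)"
  show ?thesis
  proof (intro exI conjI ballI impI)
    fix D assume D: "D \<in> M" "star D = D" "norm D \<le> 1"
    have sq: "tr ((D * D - y *\<^sub>R 1) * (D * D - y *\<^sub>R 1)) = tr (D * D * (D * D)) - 2 * y * tr (D * D) + y * y"
      using D by (simp add: left_diff_distrib right_diff_distrib tr_simps)
    have "- e * pow_trace p D \<le> (- e * (y powr q - l * y) - c * y * y) + (2 * c * y - e * l) * tr (D * D) + (- c) * tr (D * D * (D * D))"
    proof (rule pow_trace_le[OF D p(1)])
      fix s :: real assume "0 \<le> s" "s \<le> 1"
      from T(1)[OF this] show "- e * s powr (p / 2) \<le> - e * (y powr q - l * y) - c * y * y + (2 * c * y - e * l) * s + - c * (s * s)"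
        unfolding e_def[symmetric] l_def[symmetric] q_def[symmetric] by (simp add: power2_eq_square algebra_simps)
    qed
    then show "c * tr ((D * D - y *\<^sub>R 1) * (D * D - y *\<^sub>R 1)) \<le> sgn (q - 1) * (pow_trace p D - (y powr q + q * y powr (q - 1) * (tr (D * D) - y)))"
      unfolding sq e_def[symmetric] l_def[symmetric] by (simp add: algebra_simps)
    have "e * pow_trace p D \<le> (e * (y powr q - l * y) + K * y * y) + (e * l - 2 * K * y) * tr (D * D) + K * tr (D * D * (D * D))"
    proof (rule pow_trace_le[OF D p(1)])
      fix s :: real assume "0 \<le> s" "s \<le> 1"
      from T(2)[OF this] show "e * s powr (p / 2) \<le> e * (y powr q - l * y) + K * y * y + (e * l - 2 * K * y) * s + K * (s * s)"
        unfolding e_def[symmetric] l_def[symmetric] q_def[symmetric] by (simp add: power2_eq_square algebra_simps)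
    qed
    then show "sgn (q - 1) * (pow_trace p D - (y powr q + q * y powr (q - 1) * (tr (D * D) - y))) \<le> K * tr ((D * D - y *\<^sub>R 1) * (D * D - y *\<^sub>R 1))"
      unfolding sq e_def[symmetric] l_def[symmetric] by (simp add: algebra_simps)
  qed (rule c)
qed

text \<open>With \<open>U = 2P - 1\<close> and \<open>V = 2Q - 1\<close> this is
  \<open>P - Q\<close>.\<close>

definition half_diff :: "'h cop \<Rightarrow> 'h cop \<Rightarrow> 'h cop" where
  "half_diff U V = (1/2) *\<^sub>R (U - V)"

lemma half_diff_facts:
  assumes U: "U \<in> S0" and V: "V \<in> S0"
  shows "half_diff U V \<in> M" "star (half_diff U V) = half_diff U V" "norm (half_diff U V) \<le> 1"
    "half_diff U V * half_diff U V = (1/2) *\<^sub>R 1 - (1/4) *\<^sub>R (U * V + V * U)"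
    "tr (half_diff U V * half_diff U V) = 1/2 - tr (U * V) / 2"
proof -
  note SD = S0D[OF U] S0D[OF V]
  show "half_diff U V \<in> M" "star (half_diff U V) = half_diff U V" using SD by (auto simp: half_diff_def)
  have "norm (half_diff U V) \<le> (1/2) * (norm U + norm V)"
    unfolding half_diff_def norm_scaleR by (simp add: norm_triangle_ineq4)
  then show "norm (half_diff U V) \<le> 1" using norm_S0[OF U] norm_S0[OF V] by simp
  have "(U - V) * (U - V) = 2 *\<^sub>R 1 - (U * V + V * U)"
    using SD by (simp add: left_diff_distrib right_diff_distrib scaleR_2)
  then show eq: "half_diff U V * half_diff U V = (1/2) *\<^sub>R 1 - (1/4) *\<^sub>R (U * V + V * U)"
    unfolding half_diff_def mult_scaleR_left mult_scaleR_right scaleR_scaleR by (simp add: scaleR_diff_right)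
  show "tr (half_diff U V * half_diff U V) = 1/2 - tr (U * V) / 2"
    unfolding eq using SD tr_commute[OF SD(1,6)] by (simp add: tr_simps)
qed

text \<open>This makes tangent inequalities for the distances to \<open>V\<close> and to
  \<open>- V\<close> point in opposite directions.\<close>

lemma half_diff_complement:
  assumes "U \<in> S0" "V \<in> S0"
  shows "half_diff U (- V) * half_diff U (- V) = 1 - half_diff U V * half_diff U V"
  using half_diff_facts(4)[OF assms] half_diff_facts(4)[OF assms(1) S0_uminus[OF assms(2)]]
  by (simp flip: scaleR_add_left) (simp add: algebra_simps flip: scaleR_add_left)

end

section \<open>Isometries, antipodes and circles of symmetries\<close>

locale Lp_iso = factor M tr for M :: "'h::complex_hilbert_space cop set" and tr +
  fixes p :: real and \<phi> :: "'h cop \<Rightarrow> 'h cop"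
  assumes p: "0 < p" and surj: "\<phi> ` S0 = S0"
    and dist: "U \<in> S0 \<Longrightarrow> V \<in> S0 \<Longrightarrow> pow_trace p (half_diff (\<phi> U) (\<phi> V)) = pow_trace p (half_diff U V)"
begin

lemma phi_S0: "U \<in> S0 \<Longrightarrow> \<phi> U \<in> S0"
  using surj by blast

text \<open>The distance of \<open>U\<close> and \<open>- U\<close> is the maximal one, and
  \<open>powr_le_linear\<close> then forces the trace of \<open>D * D\<close> to be at least 1 for
  the images. The complementary square has trace at most 0, so
  \<open>\<phi> U + \<phi> (- U)\<close> vanishes.\<close>

lemma phi_uminus:
  assumes U: "U \<in> S0"
  shows "\<phi> (- U) = - \<phi> U"
proof -
  have mU: "- U \<in> S0" by (rule S0_uminus[OF U])
  define D where "D = half_diff (\<phi> U) (\<phi> (- U))"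
  note H = half_diff_facts[OF phi_S0[OF U] phi_S0[OF mU]]
  have "half_diff U (- U) = U" by (simp add: half_diff_def half_double)
  then have "pow_trace p (half_diff U (- U)) = 1"
    using pow_trace_scalar[of U 1 p] p S0D[OF U] by simp
  then have "1 = pow_trace p D" using dist[OF U mU] by (simp add: D_def)
  also have "1 * pow_trace p D \<le> (1 - min 1 (p/2)) + min 1 (p/2) * tr (D * D) + 0 * tr (D * D * (D * D))"
  proof (rule pow_trace_le)
    fix s :: real assume "0 \<le> s" "s \<le> 1"
    then show "1 * s powr (p / 2) \<le> 1 - min 1 (p / 2) + min 1 (p / 2) * s + 0 * (s * s)"
      using powr_le_linear[of "p / 2" s] p by (simp add: algebra_simps)
  qed (use H p in \<open>auto simp: D_def\<close>)
  finally have "min 1 (p/2) * 1 \<le> min 1 (p/2) * tr (D * D)" by simp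
  then have "1 \<le> tr (D * D)" using p by (subst (asm) mult_le_cancel_left_pos) auto
  define E where "E = half_diff (\<phi> U) (- \<phi> (- U))"
  note HE = half_diff_facts[OF phi_S0[OF U] S0_uminus[OF phi_S0[OF mU]], folded E_def]
  have "E * E = 1 - D * D"
    unfolding E_def D_def by (rule half_diff_complement[OF phi_S0[OF U] phi_S0[OF mU]])
  then have "tr (E * E) \<le> 0"
    using \<open>1 \<le> _\<close> H(1) by (simp add: tr_simps D_def)
  then have "E = 0"
    using tr_square_nonneg[OF HE(1,2)] tr_square_eq_0[OF HE(1,2)] by simp
  then show ?thesis by (simp add: E_def half_diff_def eq_neg_iff_add_eq_0 add.commute)
qed

text \<open>The squares of both half differences are scalars \<open>y\<close> and
  \<open>1 - y\<close>, so both distances are known exactly. For the images the tangent inequality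
  at \<open>y\<close> fixes the sign of \<open>b - y\<close>, the one at \<open>1 - y\<close> the
  opposite sign. Thus \<open>b = y\<close>, the quadratic remainder vanishes and
  \<open>D * D\<close> is scalar. The strict bound on \<open>t\<close> puts both base points inside
  the open interval.\<close>

lemma isoclinic:
  assumes p2: "p \<noteq> 2" and U: "U \<in> S0" and V: "V \<in> S0" and t: "\<bar>t\<bar> < 1" and UV: "U * V + V * U = (2 * t) *\<^sub>R 1"
  shows "\<phi> U * \<phi> V + \<phi> V * \<phi> U = (2 * t) *\<^sub>R 1"
proof -
  define q y where "q = p / 2" and "y = (1 - t) / 2"
  have y: "0 < y" "y < 1" "0 < 1 - y" "1 - y < 1" using t by (auto simp: y_def abs_if split: if_splits)
  have q: "0 < q" "q \<noteq> 1" using p p2 by (auto simp: q_def)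
  note mV = S0_uminus[OF V]
  have 1: "half_diff U V * half_diff U V = y *\<^sub>R 1"
    unfolding half_diff_facts(4)[OF U V] UV by (simp add: y_def field_simps flip: scaleR_diff_left)
  have 2: "half_diff U (- V) * half_diff U (- V) = (1 - y) *\<^sub>R 1"
    unfolding half_diff_complement[OF U V] 1 by (simp add: scaleR_diff_left)
  define D E where "D = half_diff (\<phi> U) (\<phi> V)" and "E = half_diff (\<phi> U) (- \<phi> V)"
  note D = half_diff_facts[OF phi_S0[OF U] phi_S0[OF V], folded D_def]
  note E = half_diff_facts[OF phi_S0[OF U] S0_uminus[OF phi_S0[OF V]], folded E_def]
  have nD: "pow_trace p D = y powr q"
    using pow_trace_scalar[OF 1 _ p] y dist[OF U V] by (simp add: D_def q_def)
  have nE: "pow_trace p E = (1 - y) powr q"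
    using pow_trace_scalar[OF 2 _ p] y dist[OF U mV] by (simp add: E_def q_def phi_uminus[OF V])
  have EE: "E * E = 1 - D * D"
    unfolding E_def D_def by (rule half_diff_complement[OF phi_S0[OF U] phi_S0[OF V]])
  define b where "b = tr (D * D)"
  have b: "tr (E * E) = 1 - b" unfolding EE b_def using D(1) by (simp add: tr_simps)
  define e where "e = sgn (q - 1)"
  have sqM: "(D * D - y *\<^sub>R 1) \<in> M" "star (D * D - y *\<^sub>R 1) = D * D - y *\<^sub>R 1"
    "(E * E - (1 - y) *\<^sub>R 1) \<in> M" "star (E * E - (1 - y) *\<^sub>R 1) = E * E - (1 - y) *\<^sub>R 1"
    using D(1-3) E(1-3) by auto
  obtain c where c: "0 < c" "c * tr ((D * D - y *\<^sub>R 1) * (D * D - y *\<^sub>R 1)) \<le> e * (- (q * y powr (q - 1) * (b - y)))"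
    using pow_trace_tangent[OF p p2 y(1,2)] D nD unfolding q_def[symmetric] e_def[symmetric] b_def by fastforce
  obtain c' where c': "0 < c'" "c' * tr ((E * E - (1 - y) *\<^sub>R 1) * (E * E - (1 - y) *\<^sub>R 1))
      \<le> e * (- (q * (1 - y) powr (q - 1) * (1 - b - (1 - y))))"
    using pow_trace_tangent[OF p p2 y(3,4)] E nE b unfolding q_def[symmetric] e_def[symmetric] by fastforce
  have "0 \<le> c * tr ((D * D - y *\<^sub>R 1) * (D * D - y *\<^sub>R 1))" "0 \<le> c' * tr ((E * E - (1 - y) *\<^sub>R 1) * (E * E - (1 - y) *\<^sub>R 1))"
    using c(1) c'(1) tr_square_nonneg[OF sqM(1,2)] tr_square_nonneg[OF sqM(3,4)] by simp_all
  then have "0 \<le> (q * y powr (q - 1)) * (e * (y - b))" "0 \<le> (q * (1 - y) powr (q - 1)) * (e * (b - y))"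
    using c(2) c'(2) by (simp_all add: algebra_simps)
  moreover have "0 < q * y powr (q - 1)" "0 < q * (1 - y) powr (q - 1)"
    using q y by simp_all
  ultimately have "0 \<le> e * (y - b)" "0 \<le> e * (b - y)"
    by (metis mult_pos_neg not_le)+
  then have "e * (b - y) = 0" by (auto simp: algebra_simps)
  then have "b = y" using q by (simp add: e_def sgn_if split: if_splits)
  then have "tr ((D * D - y *\<^sub>R 1) * (D * D - y *\<^sub>R 1)) = 0"
    using c tr_square_nonneg[OF sqM(1,2)] by (simp add: mult_le_0_iff)
  then have "D * D - y *\<^sub>R 1 = 0" using tr_square_eq_0 sqM by blast
  then have "(1/2) *\<^sub>R 1 - (1/4) *\<^sub>R (\<phi> U * \<phi> V + \<phi> V * \<phi> U) = y *\<^sub>R 1"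
    using D(4) by simp
  then have "(1/4) *\<^sub>R (\<phi> U * \<phi> V + \<phi> V * \<phi> U) = (1/2 - y) *\<^sub>R 1"
    by (simp add: algebra_simps)
  then have "4 *\<^sub>R ((1/4) *\<^sub>R (\<phi> U * \<phi> V + \<phi> V * \<phi> U)) = 4 *\<^sub>R ((1/2 - y) *\<^sub>R 1)"
    by (rule arg_cong)
  moreover have "4 * (1/2 - y) = 2 * t" by (simp add: y_def field_simps)
  ultimately show ?thesis by simp
qed

lemma circle:
  assumes W: "W \<in> S0" and Z: "Z \<in> S0" and WZ: "Z * W = - (W * Z)" and x: "x * x + r * r = 1"
  shows "x *\<^sub>R W + r *\<^sub>R Z \<in> S0"
proof -
  note SD = S0D[OF W] S0D[OF Z]
  have "(x *\<^sub>R W + r *\<^sub>R Z) * (x *\<^sub>R W + r *\<^sub>R Z) = (x * x + r * r) *\<^sub>R 1"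
    using SD WZ by (simp add: distrib_left distrib_right scaleR_add_left scaleR_add_right scaleR_diff_right mult.commute[of r x])
  then show ?thesis
    using SD x by (simp add: S0_def tr_simps)
qed

text \<open>The anticommutators with \<open>w\<close> and \<open>z\<close> are scalars preserved by
  \<phi>, so \<open>a\<close> differs from the expected point \<open>B\<close> by some
  \<open>Y\<close> that anticommutes with \<open>w\<close>, \<open>z\<close> and hence
  \<open>B\<close>. Then \<open>1 = a * a = 1 + Y * Y\<close>.\<close>

lemma phi_circle:
  assumes p2: "p \<noteq> 2" and W: "W \<in> S0" and Z: "Z \<in> S0" and WZ: "Z * W = - (W * Z)"
    and x: "x * x + r * r = 1" "\<bar>x\<bar> < 1" "\<bar>r\<bar> < 1"
  shows "\<phi> (x *\<^sub>R W + r *\<^sub>R Z) = x *\<^sub>R \<phi> W + r *\<^sub>R \<phi> Z"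
proof -
  define A where "A = x *\<^sub>R W + r *\<^sub>R Z"
  note SD = S0D[OF W] S0D[OF Z]
  have A: "A \<in> S0" unfolding A_def by (rule circle[OF W Z WZ x(1)])
  define w z a where "w = \<phi> W" and "z = \<phi> Z" and "a = \<phi> A"
  note P = S0D[OF phi_S0[OF W], folded w_def] S0D[OF phi_S0[OF Z], folded z_def] S0D[OF phi_S0[OF A], folded a_def]
  have "W * A + A * W = (2 * x) *\<^sub>R 1" "Z * A + A * Z = (2 * r) *\<^sub>R 1"
    using SD WZ by (simp_all add: A_def distrib_left distrib_right flip: scaleR_2 scaleR_add_left)
  then have wa: "w * a + a * w = (2 * x) *\<^sub>R 1" "z * a + a * z = (2 * r) *\<^sub>R 1"
    using isoclinic[OF p2 W A x(2)] isoclinic[OF p2 Z A x(3)] by (auto simp: w_def z_def a_def)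
  have "w * z + z * w = 0"
    using isoclinic[OF p2 W Z, of 0] WZ by (simp add: w_def z_def)
  then have zw: "z * w = - (w * z)" by (simp add: eq_neg_iff_add_eq_0 add.commute)
  define B Y where "B = x *\<^sub>R w + r *\<^sub>R z" and "Y = a - B"
  have "w * B + B * w = (2 * x) *\<^sub>R 1" "z * B + B * z = (2 * r) *\<^sub>R 1"
    using P zw by (simp_all add: B_def distrib_left distrib_right flip: scaleR_2 scaleR_add_left)
  then have "w * Y + Y * w = 0" "z * Y + Y * z = 0"
    using wa unfolding Y_def left_diff_distrib right_diff_distrib by (simp_all add: algebra_simps)
  then have Yw: "Y * w = - (w * Y)" "Y * z = - (z * Y)"
    by (simp_all add: eq_neg_iff_add_eq_0 add.commute)
  have "B * B = (x * x + r * r) *\<^sub>R 1"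
    using P zw by (simp add: B_def distrib_left distrib_right scaleR_add_left scaleR_add_right scaleR_diff_right mult.commute[of r x])
  then have BB: "B * B = 1" using x by simp
  have YB: "Y * B = - (B * Y)"
    using Yw by (simp add: B_def distrib_left distrib_right)
  have "a * a = (B + Y) * (B + Y)" by (simp add: Y_def)
  also have "\<dots> = 1 + Y * Y" using BB YB by (simp add: distrib_left distrib_right)
  finally have "Y * Y = 0" using P by simp
  moreover have "Y \<in> M" "star Y = Y" using P by (auto simp: Y_def B_def)
  ultimately have "Y = 0" using tr_square_eq_0[of Y] by simp
  then show ?thesis by (simp add: Y_def B_def a_def A_def w_def z_def)
qed

text \<open>Since \<open>Z\<close> anticommutes with \<open>V\<close>, the coefficient
  \<open>r\<close> drops out and \<open>D * D\<close> is affine in \<open>x\<close>; this isolates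
  the first-order term.\<close>

lemma half_diff_circle:
  assumes V: "V \<in> S0" and W: "W \<in> S0" and Z: "Z \<in> S0" and ZW: "Z * W = - (W * Z)" and ZV: "Z * V = - (V * Z)"
    and x: "x * x + r * r = 1"
  defines "D \<equiv> half_diff V (x *\<^sub>R W + r *\<^sub>R Z)" and "C \<equiv> (1/2) *\<^sub>R (V * W + W * V)"
  shows "D \<in> M" "star D = D" "norm D \<le> 1" "tr (D * D) - 1/2 = - x * tr (V * W) / 2"
    "tr ((D * D - (1/2) *\<^sub>R 1) * (D * D - (1/2) *\<^sub>R 1)) = x\<^sup>2 / 4 * tr (C * C)"
proof -
  define A where "A = x *\<^sub>R W + r *\<^sub>R Z"
  have A: "A \<in> S0" unfolding A_def by (rule circle[OF W Z ZW x])
  note SD = S0D[OF V] S0D[OF W] S0D[OF Z]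
  note H = half_diff_facts[OF V A, folded A_def, folded D_def[folded A_def]]
  have D: "D = half_diff V A" by (simp add: D_def A_def)
  show "D \<in> M" "star D = D" "norm D \<le> 1" unfolding D using half_diff_facts[OF V A] by auto
  have VA: "V * A + A * V = (2 * x) *\<^sub>R C"
    using ZV by (simp add: A_def C_def distrib_left distrib_right scaleR_add_right)
  have DD: "D * D = (1/2) *\<^sub>R 1 - (x / 2) *\<^sub>R C"
    unfolding D half_diff_facts(4)[OF V A] VA by simp
  have C: "C \<in> M" "tr C = tr (V * W)"
    using SD tr_commute[of W V] by (auto simp: C_def tr_simps)
  show "tr (D * D) - 1/2 = - x * tr (V * W) / 2"
    unfolding DD using C by (simp add: tr_simps)
  have "(D * D - (1/2) *\<^sub>R 1) * (D * D - (1/2) *\<^sub>R 1) = (x\<^sup>2 / 4) *\<^sub>R (C * C)"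
    unfolding DD by (simp add: power2_eq_square)
  then show "tr ((D * D - (1/2) *\<^sub>R 1) * (D * D - (1/2) *\<^sub>R 1)) = x\<^sup>2 / 4 * tr (C * C)"
    using C by (simp add: tr_scaleR)
qed

text \<open>The first-order term of \<open>\<tau>(\<bar>V - W\<^sub>x\<bar>\<^sup>p)\<close> at \<open>x = 0\<close>, where \<open>W\<^sub>x = x W + \<surd>(1 - x\<^sup>2) Z\<close> and \<open>Z\<close> anticommutes with
  both \<open>V\<close> and \<open>W\<close>, is a nonzero multiple of \<open>\<tau>(V W)\<close>.\<close>

lemma tr_preserved:
  assumes V: "V \<in> S0" and W: "W \<in> S0"
  shows "tr (\<phi> V * \<phi> W) = tr (V * W)"
proof (cases "p = 2")
  case True
  have "tr (half_diff (\<phi> V) (\<phi> W) * half_diff (\<phi> V) (\<phi> W)) = tr (half_diff V W * half_diff V W)"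
    using dist[OF V W] pow_trace_two[OF half_diff_facts(1-3)[OF V W]] pow_trace_two[OF half_diff_facts(1-3)[OF phi_S0[OF V] phi_S0[OF W]]] True
    by simp
  then show ?thesis
    unfolding half_diff_facts(5)[OF V W] half_diff_facts(5)[OF phi_S0[OF V] phi_S0[OF W]] by simp
next
  case False
  obtain Z where Z: "Z \<in> S0" "Z * V = - (V * Z)" "Z * W = - (W * Z)"
    using common_anticommuting[OF V W] by blast
  define v w z where "v = \<phi> V" and "w = \<phi> W" and "z = \<phi> Z"
  have S: "v \<in> S0" "w \<in> S0" "z \<in> S0" using V W Z phi_S0 by (auto simp: v_def w_def z_def)
  have "v * z + z * v = 0" "w * z + z * w = 0"
    using isoclinic[OF False V Z(1), of 0] isoclinic[OF False W Z(1), of 0] Z by (auto simp: v_def w_def z_def)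
  then have zvw: "z * v = - (v * z)" "z * w = - (w * z)"
    by (simp_all add: eq_neg_iff_add_eq_0 add.commute)
  define C C' where "C = (1/2) *\<^sub>R (V * W + W * V)" and "C' = (1/2) *\<^sub>R (v * w + w * v)"
  \<comment> \<open>\<open>l\<close> is the derivative of \<open>s powr q\<close> at
    \<open>1/2\<close>, the value of the squared half difference at \<open>x = 0\<close>.\<close>
  define q l where "q = p / 2" and "l = q * (1/2) powr (q - 1)"
  have q: "0 < q" "q \<noteq> 1" "l > 0" using p False by (auto simp: q_def l_def)
  obtain c K where T: "0 < c" "\<And>D. D \<in> M \<Longrightarrow> star D = D \<Longrightarrow> norm D \<le> 1 \<Longrightarrow>
    c * tr ((D * D - (1/2) *\<^sub>R 1) * (D * D - (1/2) *\<^sub>R 1)) \<le> sgn (q - 1) * (pow_trace p D - ((1/2) powr q + l * (tr (D * D) - 1/2))) \<and>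
    sgn (q - 1) * (pow_trace p D - ((1/2) powr q + l * (tr (D * D) - 1/2))) \<le> K * tr ((D * D - (1/2) *\<^sub>R 1) * (D * D - (1/2) *\<^sub>R 1))"
    using pow_trace_tangent[OF p False, of "1/2"] unfolding q_def l_def by force
  define a b where "a = tr (V * W)" and "b = tr (v * w)"
  define N where "N = \<bar>K\<bar> * (tr (C * C) + tr (C' * C'))"
  have "C \<in> M" "star C = C" "C' \<in> M" "star C' = C'"
    using S0D[OF V] S0D[OF W] S0D[OF S(1)] S0D[OF S(2)]
    by (auto simp: C_def C'_def add.commute)
  then have C: "0 \<le> tr (C * C)" "0 \<le> tr (C' * C')"
    using tr_square_nonneg by auto
  \<comment> \<open>The same number \<open>m\<close> is approximated by \<open>- l x a / 2\<close>
    before and \<open>- l x b / 2\<close> after applying \<phi>, both up to multiples of the square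
    of \<open>x\<close>.\<close>
  have est: "x * (l * \<bar>a - b\<bar>) \<le> x * (x * N)" if x: "0 < x" "x < 1" for x
  proof -
    define r where "r = sqrt (1 - x * x)"
    have "x * x < 1 * 1" using x by (intro mult_strict_mono) auto
    then have r: "x * x + r * r = 1" "\<bar>r\<bar> < 1" "\<bar>x\<bar> < 1" using x by (auto simp: r_def)
    define D where "D = half_diff V (x *\<^sub>R W + r *\<^sub>R Z)"
    define D' where "D' = half_diff v (x *\<^sub>R w + r *\<^sub>R z)"
    note D = half_diff_circle[OF V W Z(1,3,2) r(1), folded D_def C_def a_def]
    note D' = half_diff_circle[OF S(1,2,3) zvw(2,1) r(1), folded D'_def C'_def b_def]
    have "pow_trace p D' = pow_trace p D"
      using dist[OF V circle[OF W Z(1,3) r(1)]] phi_circle[OF False W Z(1,3) r(1,3,2)]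
      by (simp add: D_def D'_def v_def w_def z_def)
    define m where "m = pow_trace p D - (1/2) powr q"
    define e where "e = sgn (q - 1)"
    have e: "e = 1 \<or> e = - 1" using q by (auto simp: e_def sgn_if)
    have 1: "\<bar>m + l * x * a / 2\<bar> \<le> \<bar>K\<bar> * (x\<^sup>2 / 4 * tr (C * C))"
    proof -
      have "e * (m + l * x * a / 2) \<le> K * (x\<^sup>2 / 4 * tr (C * C))" "0 \<le> e * (m + l * x * a / 2)"
        using T(2)[OF D(1-3)] T(1) C unfolding D(4,5) e_def[symmetric] m_def by (auto simp: algebra_simps intro: order.trans[rotated])
      moreover have "K * (x\<^sup>2 / 4 * tr (C * C)) \<le> \<bar>K\<bar> * (x\<^sup>2 / 4 * tr (C * C))"
        using C by (intro mult_right_mono) auto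
      ultimately show ?thesis using e by auto
    qed
    have 2: "\<bar>m + l * x * b / 2\<bar> \<le> \<bar>K\<bar> * (x\<^sup>2 / 4 * tr (C' * C'))"
    proof -
      have "e * (m + l * x * b / 2) \<le> K * (x\<^sup>2 / 4 * tr (C' * C'))" "0 \<le> e * (m + l * x * b / 2)"
        using T(2)[OF D'(1-3)] T(1) C unfolding D'(4,5) e_def[symmetric] m_def \<open>pow_trace p D' = pow_trace p D\<close>
        by (auto simp: algebra_simps intro: order.trans[rotated])
      moreover have "K * (x\<^sup>2 / 4 * tr (C' * C')) \<le> \<bar>K\<bar> * (x\<^sup>2 / 4 * tr (C' * C'))"
        using C by (intro mult_right_mono) auto
      ultimately show ?thesis using e by auto
    qed
    have "\<bar>l * x * a / 2 - l * x * b / 2\<bar> \<le> x\<^sup>2 / 4 * N"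
    proof -
      have "\<bar>\<alpha> - \<beta>\<bar> \<le> P + P'" if "\<bar>m + \<alpha>\<bar> \<le> P" "\<bar>m + \<beta>\<bar> \<le> P'" for \<alpha> \<beta> P P' :: real
        using that by linarith
      from this[OF 1 2] show ?thesis by (simp add: N_def algebra_simps)
    qed
    moreover have "\<bar>l * x * a / 2 - l * x * b / 2\<bar> = x * (l * \<bar>a - b\<bar>) / 2"
    proof -
      have "l * x * a / 2 - l * x * b / 2 = (l * x / 2) * (a - b)" by (simp add: algebra_simps)
      then show ?thesis using q x by (simp only: abs_mult) simp
    qed
    moreover have "0 \<le> x\<^sup>2 * N" using C by (simp add: N_def)
    ultimately have "x * (l * \<bar>a - b\<bar>) \<le> x\<^sup>2 * N" by linarith
    then show ?thesis by (simp add: power2_eq_square mult.assoc)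
  qed
  have "a = b"
  proof (rule ccontr)
    assume ne: "a \<noteq> b"
    have N0: "0 \<le> N" using C by (simp add: N_def)
    \<comment> \<open>Chosen so that \<open>x * N\<close> is at most half of
      \<open>l * \<bar>a - b\<bar>\<close>; \<open>N + 1\<close> is a positive denominator, and the
      minimum keeps \<open>x\<close> below 1.\<close>
    define x where "x = min (1/2) (l * \<bar>a - b\<bar> / (2 * (N + 1)))"
    have x: "0 < x" "x < 1" using ne q N0 by (auto simp: x_def)
    have "x * N \<le> (l * \<bar>a - b\<bar> / (2 * (N + 1))) * (N + 1)"
      using N0 x q by (intro mult_mono) (auto simp: x_def)
    also have "\<dots> = l * \<bar>a - b\<bar> / 2"
      using N0 nonzero_mult_div_cancel_right[of "N + 1" "l * \<bar>a - b\<bar> / 2"]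
      by (simp add: add_nonneg_eq_0_iff)
    finally have "x * N \<le> l * \<bar>a - b\<bar> / 2" .
    moreover have "0 < l * \<bar>a - b\<bar>" using ne q by simp
    ultimately have "x * N < l * \<bar>a - b\<bar>" by linarith
    moreover have "l * \<bar>a - b\<bar> \<le> x * N" using est[OF x] x(1) by simp
    ultimately show False by simp
  qed
  then show ?thesis by (simp add: a_def b_def v_def w_def)
qed

lemma sym_iso: "sym_iso M tr \<phi>"
  by standard (use surj tr_preserved in auto)

end

section \<open>Transfer to the operator algebra\<close>

context factor
begin

lemma pow_trace_nonneg: "D \<in> M \<Longrightarrow> star D = D \<Longrightarrow> norm D \<le> 1 \<Longrightarrow> 0 < p \<Longrightarrow> 0 \<le> pow_trace p D"
  using pow_trace_le[of D p "-1" 0 0 0] by simp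

end

text \<open>The strong operator topology is pulled back from the topology of pointwise convergence,
  so pointwise limits of sequences are limits in it.\<close>

lemma strong_closed_limit:
  fixes X :: "nat \<Rightarrow> 'a::real_normed_vector \<Rightarrow>\<^sub>L 'b::real_normed_vector"
  assumes cl: "closedin strong_operator_topology S" and X: "\<And>n. X n \<in> S"
    and lim: "\<And>x. (\<lambda>n. blinfun_apply (X n) x) \<longlonglongrightarrow> blinfun_apply A x"
  shows "A \<in> S"
proof (rule limitin_closedin[OF _ cl])
  have f: "limitin (euclidean :: ('a \<Rightarrow> 'b) topology) (\<lambda>n. blinfun_apply (X n)) (blinfun_apply A) sequentially"
    unfolding euclidean_product_topology[symmetric] limitin_componentwise using lim by simp
  show "limitin strong_operator_topology X A sequentially"
    unfolding limitin_def strong_operator_topology_topspace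
  proof (intro conjI allI impI UNIV_I)
    fix W assume W: "openin strong_operator_topology W \<and> A \<in> W"
    then obtain U where U: "openin (euclidean :: ('a \<Rightarrow> 'b) topology) U" "W = blinfun_apply -` U \<inter> UNIV"
      unfolding strong_operator_topology_def openin_pullback_topology by blast
    then have "\<forall>\<^sub>F n in sequentially. blinfun_apply (X n) \<in> U"
      using f W unfolding limitin_def by blast
    then show "\<forall>\<^sub>F n in sequentially. X n \<in> W"
      using U(2) by simp
  qed
qed (use X in auto)

locale operator_factor =
  fixes M :: "('h::complex_hilbert_space \<Rightarrow>\<^sub>L 'h) set" and \<tau> :: "('h \<Rightarrow>\<^sub>L 'h) \<Rightarrow> complex"
  assumes fin: "finite_factor M \<tau>"
begin

definition MC :: "'h cop set" where "MC = {A. Rep_cop A \<in> M}"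

definition trC :: "'h cop \<Rightarrow> real" where "trC A = Re (\<tau> (Rep_cop A))"

lemma Abs_M: "A \<in> M \<Longrightarrow> Rep_cop (Abs_cop A) = A" "A \<in> M \<Longrightarrow> Abs_cop A \<in> MC"
  using fin Abs_cop_inverse[of A]
  by (auto simp: finite_factor_def vn_factor_def von_neumann_algebra_def MC_def)

lemma MC_closed:
  "1 \<in> MC" "A \<in> MC \<Longrightarrow> B \<in> MC \<Longrightarrow> A + B \<in> MC" "A \<in> MC \<Longrightarrow> B \<in> MC \<Longrightarrow> A * B \<in> MC"
  "A \<in> MC \<Longrightarrow> cscale c A \<in> MC" "A \<in> MC \<Longrightarrow> star A \<in> MC"
  using fin by (auto simp: finite_factor_def vn_factor_def von_neumann_algebra_def MC_def one_cop.rep_eq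
      plus_cop.rep_eq times_cop.rep_eq cscale.rep_eq star.rep_eq)

lemma tau_rules:
  "A \<in> MC \<Longrightarrow> B \<in> MC \<Longrightarrow> \<tau> (Rep_cop (A + B)) = \<tau> (Rep_cop A) + \<tau> (Rep_cop B)"
  "A \<in> MC \<Longrightarrow> \<tau> (Rep_cop (cscale c A)) = c * \<tau> (Rep_cop A)"
  "A \<in> MC \<Longrightarrow> \<tau> (Rep_cop (star A * A)) \<in> \<real>\<^sub>\<ge>\<^sub>0"
  "\<tau> (Rep_cop 1) = 1"
  "A \<in> MC \<Longrightarrow> B \<in> MC \<Longrightarrow> \<tau> (Rep_cop (A * B)) = \<tau> (Rep_cop (B * A))"
  using fin by (auto simp: finite_factor_def tracial_state_def MC_def one_cop.rep_eq
      plus_cop.rep_eq times_cop.rep_eq cscale.rep_eq star.rep_eq)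

text \<open>\<open>4 A\<close> is the difference of the squares of \<open>1 + A\<close> and
  \<open>1 - A\<close>, whose traces are nonnegative reals.\<close>

lemma tau_real:
  assumes A: "A \<in> MC" "star A = A"
  shows "Im (\<tau> (Rep_cop A)) = 0"
proof -
  have sc: "r *\<^sub>R B \<in> MC" "\<tau> (Rep_cop (r *\<^sub>R B)) = of_real r * \<tau> (Rep_cop B)" if "B \<in> MC" for r B
    using MC_closed(4)[OF that, of "of_real r"] tau_rules(2)[OF that, of "of_real r"] by (auto simp: cscale_of_real)
  define P Q where "P = 1 + A" and "Q = 1 + (-1) *\<^sub>R A"
  have PQ: "P \<in> MC" "Q \<in> MC" "star P = P" "star Q = Q"
    using MC_closed(2)[OF MC_closed(1) A(1)] MC_closed(2)[OF MC_closed(1) sc(1)[OF A(1)]] A(2)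
    by (simp_all only: P_def Q_def star_simps)
  have "P * P = Q * Q + 4 *\<^sub>R A"
    using scaleR_add_left[of 2 2 A]
    by (simp add: P_def Q_def distrib_left distrib_right left_diff_distrib right_diff_distrib scaleR_2 algebra_simps)
  then have "\<tau> (Rep_cop (P * P)) = \<tau> (Rep_cop (Q * Q)) + 4 * \<tau> (Rep_cop A)"
    using tau_rules(1)[of "Q * Q" "4 *\<^sub>R A"] sc[OF A(1), of 4] MC_closed(3)[OF PQ(2,2)] by simp
  moreover have "Im (\<tau> (Rep_cop (P * P))) = 0" "Im (\<tau> (Rep_cop (Q * Q))) = 0"
    using tau_rules(3)[OF PQ(1)] tau_rules(3)[OF PQ(2)] PQ by (auto simp: complex_nonneg_Reals_iff)
  ultimately show ?thesis by simp
qed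

sublocale factor MC trC
proof
  fix A B :: "'h cop" and c :: complex
  show "1 \<in> MC" by (rule MC_closed)
  show "A \<in> MC \<Longrightarrow> B \<in> MC \<Longrightarrow> A + B \<in> MC" "A \<in> MC \<Longrightarrow> B \<in> MC \<Longrightarrow> A * B \<in> MC"
    "A \<in> MC \<Longrightarrow> cscale c A \<in> MC" "A \<in> MC \<Longrightarrow> star A \<in> MC" by (rule MC_closed; assumption)+
  show "A \<in> MC \<Longrightarrow> B \<in> MC \<Longrightarrow> trC (A + B) = trC A + trC B" "A \<in> MC \<Longrightarrow> B \<in> MC \<Longrightarrow> trC (A * B) = trC (B * A)"
    by (simp_all add: trC_def tau_rules(1) tau_rules(5)[of A B])
  show "A \<in> MC \<Longrightarrow> trC (r *\<^sub>R A) = r * trC A" for r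
    using tau_rules(2)[of A "of_real r"] by (simp add: trC_def cscale_of_real)
  show "A \<in> MC \<Longrightarrow> star A = A \<Longrightarrow> trC (cscale \<i> A) = 0"
    using tau_real by (simp add: trC_def tau_rules(2))
  show "A \<in> MC \<Longrightarrow> 0 \<le> trC (star A * A)"
    using tau_rules(3) by (simp add: trC_def complex_nonneg_Reals_iff)
  show "trC 1 = 1" by (simp add: trC_def tau_rules(4))
  show "A = 0" if "A \<in> MC" "trC (star A * A) = 0"
  proof -
    have "\<tau> (Rep_cop (star A * A)) = 0"
      using tau_rules(3)[OF that(1)] that(2) by (simp add: trC_def complex_nonneg_Reals_iff complex_eq_iff)
    then have "Rep_cop A = 0"
      using fin that(1) by (simp add: finite_factor_def faithful_on_def MC_def times_cop.rep_eq star.rep_eq)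
    then show ?thesis by (metis Rep_cop_inject zero_cop.rep_eq)
  qed
next
  fix X :: "nat \<Rightarrow> 'h cop" and A assume X: "\<And>n. X n \<in> MC" and A: "slim X A"
  have "Rep_cop A \<in> M"
  proof (rule strong_closed_limit)
    show "closedin strong_operator_topology M"
      using fin by (simp add: finite_factor_def vn_factor_def von_neumann_algebra_def)
    show "Rep_cop (X n) \<in> M" for n using X by (simp add: MC_def)
    show "(\<lambda>n. blinfun_apply (Rep_cop (X n)) x) \<longlonglongrightarrow> blinfun_apply (Rep_cop A) x" for x
      using A by (simp add: slim_def app.rep_eq)
  qed
  then show "A \<in> MC" by (simp add: MC_def)
next
  fix A assume A: "A \<in> MC" and comm: "\<And>B. B \<in> MC \<Longrightarrow> A * B = B * A"
  have "Rep_cop A o\<^sub>L B = B o\<^sub>L Rep_cop A" if "B \<in> M" for B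
    using comm[of "Abs_cop B"] Abs_M[OF that] by (metis times_cop.rep_eq)
  then have "Rep_cop A \<in> range (\<lambda>c. scaleC_op c id_blinfun)"
    using fin A unfolding finite_factor_def vn_factor_def MC_def by blast
  then obtain c where "Rep_cop A = scaleC_op c id_blinfun" by blast
  then have "Rep_cop A = Rep_cop (cscale c 1)" by (simp add: cscale.rep_eq one_cop.rep_eq)
  then show "\<exists>c. A = cscale c 1" by (auto simp: Rep_cop_inject)
qed

lemma Lp_norm_pow_trace:
  assumes D: "D \<in> MC" "star D = D" "norm D \<le> 1" and p: "0 < p"
  shows "Lp_norm \<tau> p (Rep_cop D) = pow_trace p D powr (1 / p)"
proof -
  define B where "B = cfc sqrt (D * D)"
  note B = abs_facts[OF D, folded B_def]
  have T: "star (D * D) = D * D" using D by simp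
  have sq: "continuous_on UNIV sqrt" by (intro continuous_intros)
  have "abs_op (Rep_cop D) = cont_fun_calc sqrt (Rep_cop (D * D))"
    using D(2) unfolding abs_op_def by (metis star.rep_eq times_cop.rep_eq)
  also have "\<dots> = Rep_cop B"
    unfolding B_def by (rule Rep_cfc[OF T sq, symmetric])
  finally have 1: "abs_op (Rep_cop D) = Rep_cop B" .
  \<comment> \<open>\<open>cont_fun_calc\<close> looks at the function on the spectrum only, and
    there \<open>t\<close> is nonnegative.\<close>
  have "cont_fun_calc (\<lambda>t. t powr p) (Rep_cop B) = cont_fun_calc (\<lambda>t. \<bar>t\<bar> powr p) (Rep_cop B)"
  proof -
    have "uniform_limit (rspec B) (\<lambda>n. poly (q n)) (\<lambda>t. t powr p) sequentially \<longleftrightarrow>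
      uniform_limit (rspec B) (\<lambda>n. poly (q n)) (\<lambda>t. \<bar>t\<bar> powr p) sequentially" for q :: "nat \<Rightarrow> real poly"
      by (rule uniform_limit_cong') (use B(4) in auto)
    then show ?thesis unfolding cont_fun_calc_def op_spectrum_rspec by simp
  qed
  also have "\<dots> = Rep_cop (cfc (\<lambda>t. \<bar>t\<bar> powr p) B)"
    by (rule Rep_cfc[OF B(2) continuous_abs_powr[OF p], symmetric])
  finally show ?thesis
    unfolding Lp_norm_def powr_op_def 1 by (simp add: pow_trace_def trC_def B_def)
qed

definition proj_of :: "'h cop \<Rightarrow> ('h \<Rightarrow>\<^sub>L 'h)" where
  "proj_of U = Rep_cop ((1/2) *\<^sub>R (1 + U))"

definition sym_of :: "('h \<Rightarrow>\<^sub>L 'h) \<Rightarrow> 'h cop" where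
  "sym_of P = 2 *\<^sub>R Abs_cop P - 1"

lemma proj_of_half:
  assumes U: "U \<in> S0"
  shows "proj_of U \<in> half_projections M \<tau>" "sym_of (proj_of U) = U"
proof -
  define P where "P = (1/2) *\<^sub>R (1 + U)"
  note SD = S0D[OF U]
  have P: "P \<in> MC" "star P = P" using SD by (auto simp: P_def)
  have "(1 + U) * (1 + U) = 2 *\<^sub>R (1 + U)"
    using SD by (simp add: distrib_left distrib_right scaleR_2)
  then have PP: "P * P = P" by (simp add: P_def)
  have "trC P = 1/2" using SD by (simp add: P_def tr_simps)
  then have "\<tau> (Rep_cop P) = 1/2"
    using tau_real[OF P] by (simp add: trC_def complex_eq_iff)
  then show "proj_of U \<in> half_projections M \<tau>"
    using P(1) arg_cong[OF PP, of Rep_cop] arg_cong[OF P(2), of Rep_cop]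
    unfolding proj_of_def P_def[symmetric] half_projections_def times_cop.rep_eq star.rep_eq
    by (simp add: MC_def)
  show "sym_of (proj_of U) = U"
    by (simp add: sym_of_def proj_of_def Rep_cop_inverse)
qed

lemma sym_of_S0:
  assumes P: "P \<in> half_projections M \<tau>"
  shows "sym_of P \<in> S0" "proj_of (sym_of P) = P"
proof -
  define A where "A = Abs_cop P"
  have PM: "P \<in> M" "P o\<^sub>L P = P" "adjoint_op P = P" "\<tau> P = 1/2" using P by (auto simp: half_projections_def)
  note RA = Abs_M[OF PM(1), folded A_def]
  have A: "A * A = A" "star A = A"
    using PM RA(1) by (simp_all add: times_cop.rep_eq star.rep_eq flip: Rep_cop_inject)
  have "trC A = 1/2" using arg_cong[OF PM(4), of Re] RA(1) by (simp add: trC_def)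
  then show "sym_of P \<in> S0"
    using A RA(2) by (simp add: sym_of_def A_def[symmetric] S0_def tr_simps left_diff_distrib right_diff_distrib distrib_left distrib_right scaleR_2)
  show "proj_of (sym_of P) = P"
    using RA(1) by (simp add: proj_of_def sym_of_def A_def)
qed

lemma proj_of_diff: "proj_of U - proj_of V = Rep_cop (half_diff U V)"
proof -
  have "(1/2) *\<^sub>R (1 + U) - (1/2) *\<^sub>R (1 + V) = half_diff U V"
    by (simp add: half_diff_def scaleR_add_right scaleR_diff_right)
  then show ?thesis
    unfolding proj_of_def by (metis minus_cop.rep_eq)
qed

text \<open>Projections and symmetries correspond affinely, differences becoming
  \<open>half_diff\<close>; raising the norms to the power \<open>p\<close> removes the outer
  exponent \<open>1 / p\<close>.\<close>

lemma Lp_iso_sym: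
  assumes p: "0 < p" and iso: "Lp_isometry_on \<tau> p (half_projections M \<tau>) \<phi>"
    and onto: "\<phi> ` half_projections M \<tau> = half_projections M \<tau>"
  shows "Lp_iso MC trC p (\<lambda>U. sym_of (\<phi> (proj_of U)))"
proof
  define X where "X = half_projections M \<tau>"
  have sX: "sym_of ` X = S0" and pX: "proj_of ` S0 = X"
    using sym_of_S0 proj_of_half unfolding X_def by (force simp: image_iff)+
  have "(\<lambda>U. sym_of (\<phi> (proj_of U))) ` S0 = sym_of ` \<phi> ` proj_of ` S0"
    by (simp add: image_image)
  then show "(\<lambda>U. sym_of (\<phi> (proj_of U))) ` S0 = S0"
    using onto sX pX by (simp add: X_def)
  fix U V assume UV: "U \<in> S0" "V \<in> S0"
  define U' V' where "U' = sym_of (\<phi> (proj_of U))" and "V' = sym_of (\<phi> (proj_of V))"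
  have h: "proj_of U \<in> X" "proj_of V \<in> X" using proj_of_half UV by (auto simp: X_def)
  then have h': "\<phi> (proj_of U) \<in> X" "\<phi> (proj_of V) \<in> X" using onto by (auto simp: X_def)
  then have UV': "U' \<in> S0" "V' \<in> S0" "proj_of U' = \<phi> (proj_of U)" "proj_of V' = \<phi> (proj_of V)"
    using sym_of_S0 by (auto simp: U'_def V'_def X_def)
  have "Lp_norm \<tau> p (proj_of U - proj_of V) = Lp_norm \<tau> p (proj_of U' - proj_of V')"
    using iso h unfolding UV'(3,4) Lp_isometry_on_def X_def by blast
  then have "pow_trace p (half_diff U V) powr (1 / p) = pow_trace p (half_diff U' V') powr (1 / p)"
    unfolding proj_of_diff Lp_norm_pow_trace[OF half_diff_facts(1-3)[OF UV] p] Lp_norm_pow_trace[OF half_diff_facts(1-3)[OF UV'(1,2)] p] .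
  then have "(pow_trace p (half_diff U V) powr (1 / p)) powr p = (pow_trace p (half_diff U' V') powr (1 / p)) powr p"
    by simp
  then show "pow_trace p (half_diff (sym_of (\<phi> (proj_of U))) (sym_of (\<phi> (proj_of V)))) = pow_trace p (half_diff U V)"
    unfolding U'_def[symmetric] V'_def[symmetric]
    using p pow_trace_nonneg[OF half_diff_facts(1-3)[OF UV] p] pow_trace_nonneg[OF half_diff_facts(1-3)[OF UV'(1,2)] p]
    by (simp add: powr_powr)
qed (rule p)

lemma star_iso_automorphism:
  assumes \<Phi>: "star_iso \<Phi>"
  defines "\<Psi> \<equiv> \<lambda>A. Rep_cop (\<Phi> (Abs_cop A))"
  shows "star_automorphism M \<Psi> \<or> star_anti_automorphism M \<Psi>"
proof -
  have P: "bij_betw \<Phi> MC MC" "\<And>x y. x \<in> MC \<Longrightarrow> y \<in> MC \<Longrightarrow> \<Phi> (x + y) = \<Phi> x + \<Phi> y"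
    "\<And>c x. x \<in> MC \<Longrightarrow> \<Phi> (cscale c x) = cscale c (\<Phi> x)" "\<And>x. x \<in> MC \<Longrightarrow> \<Phi> (star x) = star (\<Phi> x)"
    "(\<forall>x\<in>MC. \<forall>y\<in>MC. \<Phi> (x * y) = \<Phi> x * \<Phi> y) \<or> (\<forall>x\<in>MC. \<forall>y\<in>MC. \<Phi> (x * y) = \<Phi> y * \<Phi> x)"
    using \<Phi> unfolding star_iso_def by blast+
  have Abs: "Abs_cop (A + B) = Abs_cop A + Abs_cop B" "Abs_cop (A o\<^sub>L B) = Abs_cop A * Abs_cop B"
    "Abs_cop (scaleC_op c A) = cscale c (Abs_cop A)" "Abs_cop (adjoint_op A) = star (Abs_cop A)"
    if "A \<in> M" "B \<in> M" for A B c
    using Abs_M(1)[OF that(1)] Abs_M(1)[OF that(2)]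
    by (metis Rep_cop_inverse plus_cop.rep_eq times_cop.rep_eq cscale.rep_eq star.rep_eq)+
  have "bij_betw Abs_cop M MC" "bij_betw Rep_cop MC M"
    using Abs_M Rep_cop_inverse
    by (auto simp: MC_def intro!: bij_betwI[of Abs_cop _ _ Rep_cop] bij_betwI[of Rep_cop _ _ Abs_cop])
  then have "bij_betw (Rep_cop \<circ> (\<Phi> \<circ> Abs_cop)) M M"
    using P(1) by (blast intro: bij_betw_trans)
  then have "star_linear_bij M \<Psi>"
    unfolding star_linear_bij_def \<Psi>_def
    by (auto simp: comp_def Abs Abs_M P plus_cop.rep_eq cscale.rep_eq star.rep_eq)
  then show ?thesis
    using P(5) unfolding star_automorphism_def star_anti_automorphism_def
    by (auto simp: \<Psi>_def Abs Abs_M times_cop.rep_eq)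
qed

end

theorem theorem3p1:
  fixes M :: "('h::complex_hilbert_space \<Rightarrow>\<^sub>L 'h) set"
    and \<tau> :: "('h \<Rightarrow>\<^sub>L 'h) \<Rightarrow> complex"
    and \<phi> :: "('h \<Rightarrow>\<^sub>L 'h) \<Rightarrow> ('h \<Rightarrow>\<^sub>L 'h)"
    and p :: real
  assumes "0 < p"
    and "finite_factor M \<tau>"
    and "half_projections M \<tau> \<noteq> {}"
    and "Lp_isometry_on \<tau> p (half_projections M \<tau>) \<phi>"
    and "\<phi> ` half_projections M \<tau> = half_projections M \<tau>"
  shows "\<exists>\<Phi>. (star_automorphism M \<Phi> \<or> star_anti_automorphism M \<Phi>) \<and>
    ((\<forall>P\<in>half_projections M \<tau>. \<phi> P = \<Phi> P) \<or>
     (\<forall>P\<in>half_projections M \<tau>. \<phi> P = id_blinfun - \<Phi> P))"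
proof -
  interpret operator_factor M \<tau>
    by standard (rule assms(2))
  interpret I: Lp_iso MC trC p "\<lambda>U. sym_of (\<phi> (proj_of U))"
    by (rule Lp_iso_sym[OF assms(1,4,5)])
  interpret S: sym_iso MC trC "\<lambda>U. sym_of (\<phi> (proj_of U))"
    by (rule I.sym_iso)
  obtain P0 where "P0 \<in> half_projections M \<tau>" using assms(3) by blast
  then obtain \<Psi> \<sigma> where iso: "star_iso \<Psi>" and \<sigma>: "\<sigma> = 1 \<or> \<sigma> = - 1"
    and impl: "\<And>W. W \<in> S0 \<Longrightarrow> sym_of (\<phi> (proj_of W)) = \<sigma> *\<^sub>R \<Psi> W"
    using S.implemented[OF sym_of_S0(1)] by blast
  define \<Phi> where "\<Phi> A = Rep_cop (\<Psi> (Abs_cop A))" for A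
  have "bij_betw \<Psi> MC MC" and add: "\<And>x y. x \<in> MC \<Longrightarrow> y \<in> MC \<Longrightarrow> \<Psi> (x + y) = \<Psi> x + \<Psi> y"
    and cs: "\<And>c x. x \<in> MC \<Longrightarrow> \<Psi> (cscale c x) = cscale c (\<Psi> x)"
    and mult: "(\<forall>x\<in>MC. \<forall>y\<in>MC. \<Psi> (x * y) = \<Psi> x * \<Psi> y) \<or> (\<forall>x\<in>MC. \<forall>y\<in>MC. \<Psi> (x * y) = \<Psi> y * \<Psi> x)"
    using iso unfolding star_iso_def by blast+
  obtain e where "e \<in> MC" "\<Psi> e = 1"
    using \<open>bij_betw \<Psi> MC MC\<close> one_M unfolding bij_betw_def by (metis imageE)
  moreover have "\<Psi> (e * 1) = \<Psi> e * \<Psi> 1 \<or> \<Psi> (e * 1) = \<Psi> 1 * \<Psi> e"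
    using mult calculation(1) one_M by blast
  ultimately have one: "\<Psi> 1 = 1" by auto
  \<comment> \<open>The implementation formula rewritten for projections:
    \<open>(1 + \<sigma> (2 \<Psi>(P) - 1)) / 2\<close> is \<open>\<Psi>(P)\<close> for \<sigma> = 1
    and \<open>1 - \<Psi>(P)\<close> for \<sigma> = -1, which are the two forms of the
    conclusion.\<close>
  have half: "\<phi> P = Rep_cop ((1/2) *\<^sub>R (1 + \<sigma> *\<^sub>R (2 *\<^sub>R \<Psi> (Abs_cop P) - 1)))" if P: "P \<in> half_projections M \<tau>" for P
  proof -
    have PM: "Abs_cop P \<in> MC" using P Abs_M(2) by (auto simp: half_projections_def)
    have "\<Psi> (2 *\<^sub>R Abs_cop P) = 2 *\<^sub>R \<Psi> (Abs_cop P)" "\<Psi> ((-1) *\<^sub>R 1) = (-1) *\<^sub>R \<Psi> 1"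
      using cs[OF PM, of "of_real 2"] cs[OF one_M, of "of_real (-1)"] unfolding cscale_of_real .
    then have "\<Psi> (sym_of P) = 2 *\<^sub>R \<Psi> (Abs_cop P) - 1"
      using add[of "2 *\<^sub>R Abs_cop P" "(-1) *\<^sub>R 1"] PM one by (simp add: sym_of_def)
    moreover have "sym_of (\<phi> P) = \<sigma> *\<^sub>R \<Psi> (sym_of P)"
      using impl[OF sym_of_S0(1)[OF P]] sym_of_S0(2)[OF P] by simp
    moreover have "\<phi> P \<in> half_projections M \<tau>" using assms(5) P by blast
    ultimately show ?thesis
      using sym_of_S0(2)[of "\<phi> P"] by (simp add: proj_of_def)
  qed
  have "(\<forall>P\<in>half_projections M \<tau>. \<phi> P = \<Phi> P) \<or> (\<forall>P\<in>half_projections M \<tau>. \<phi> P = id_blinfun - \<Phi> P)"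
    using \<sigma>
  proof
    assume "\<sigma> = 1"
    then show ?thesis by (simp add: half \<Phi>_def)
  next
    assume s: "\<sigma> = - 1"
    have "\<phi> P = id_blinfun - \<Phi> P" if "P \<in> half_projections M \<tau>" for P
    proof -
      have "(1/2) *\<^sub>R (1 + \<sigma> *\<^sub>R (2 *\<^sub>R \<Psi> (Abs_cop P) - 1)) = 1 - \<Psi> (Abs_cop P)"
        using half_double[of "1 - \<Psi> (Abs_cop P)"] by (simp add: s scaleR_2 algebra_simps)
      then show ?thesis
        using half[OF that] by (simp add: \<Phi>_def minus_cop.rep_eq one_cop.rep_eq)
    qed
    then show ?thesis by blast
  qed
  then show ?thesis
    using star_iso_automorphism[OF iso] unfolding \<Phi>_def by blast
qed

end
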